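(* Let $(\mathbb{X}_t)_{t\ge0}$ be a free Lévy process in $\mathcal{A}$ such that $\tau(\mathbb{X}_t)=0$ and $\tau(\mathbb{X}_t^2)=t$ for all $t>0$. Let $a\in\mathbb{R}$ and $b\ge0$. Then the increments $(\mathbb{X}_{t+s}-\mathbb{X}_t)/\sqrt{s}$ have the free Meixner law $\mu_{a/\sqrt{s},\,b/s}$ for all $t,s>0$ if and only if for all $0<t<s$ $$\tau(\mathbb{X}_t\mathbb{X}_s\mathbb{X}_t\,|\,\mathbb{X}_s)=\frac{(s-t)t}{s^2(b+s)^2}\Big(b^2\mathbb{X}_s^3+2bas\,\mathbb{X}_s^2+(b+a^2)s^2\,\mathbb{X}_s+as^3\,\mathbb{I}\Big)+\frac{t^2}{s^2}\mathbb{X}_s^3 .$$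
   Context: $\mathcal{A}$ is a von Neumann algebra with unit $\mathbb{I}$ and a normal faithful tracial state $\tau:\mathcal{A}\to\mathbb{C}$. A random variable is a self-adjoint element of $\mathcal{A}$; its law is the compactly supported probability measure on $\mathbb{R}$ with the same moments. Free Lévy process: a family $(\mathbb{X}_t)_{t\ge0}$ of self-adjoint elements of $\mathcal{A}$ with $\mathbb{X}_0=0$ having free and stationary additive increments: for $0\le t_1<\dots<t_n$ the increments $\mathbb{X}_{t_2}-\mathbb{X}_{t_1},\dots,\mathbb{X}_{t_n}-\mathbb{X}_{t_{n-1}}$ are free, and the law of $\mathbb{X}_{t+s}-\mathbb{X}_t$ depends only on $s$. Freeness is with respect to $\tau$ (equivalently, all mixed free cumulants vanish). Free Meixner laws: for $a\in\mathbb{R}$, $b\ge-1$, $\mu_{a,b}$ is the compactly supported probability measure on $\mathbb{R}$ with Cauchy–Stieltjes transform $$\int_{\mathbb{R}}\frac{1}{z-y}\,\mu_{a,b}(dy)=\frac{(1+2b)z+a-\sqrt{(z-a)^2-4(1+b)}}{2(bz^2+az+1)},\qquad \Im z>0,$$ the branch of the square root being such that the transform maps the upper half plane to the closed lower half plane. It has mean $0$ and variance $1$. Equivalently, its $\mathcal{R}$-transform $\sum_{i\ge0}R_{i+1}z^i$ ($R_i$ being its free cumulants) is $\dfrac{2z}{1-za+\sqrt{(1-za)^2-4z^2b}}$ for small $|z|$, with the root chosen so that it tends to $0$ as $z\to0$. Conditional expectation: for self-adjoint $\mathbb{V}\in\mathcal{A}$, $\tau(\cdot|\mathbb{V})$ is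 the unique $\tau$-preserving conditional expectation of $\mathcal{A}$ onto the von Neumann subalgebra $\mathcal{B}$ generated by $\mathbb{V}$ and $\mathbb{I}$, characterized by $\tau(\mathbb{U}\mathbb{W})=\tau(\tau(\mathbb{U}|\mathbb{V})\mathbb{W})$ for all $\mathbb{W}\in\mathcal{B}$. *)

theory Defs
  imports "HOL-Probability.Probability" "HOL-Complex_Analysis.Complex_Analysis"
begin

section \<open>Bounded operators on a complex Hilbert space\<close>

class complex_vector = real_vector +
  fixes scaleC :: "complex \<Rightarrow> 'a \<Rightarrow> 'a" (infixr "*\<^sub>C" 75)
  assumes scaleC_add_right: "c *\<^sub>C (x + y) = c *\<^sub>C x + c *\<^sub>C y"
    and scaleC_add_left: "(c + d) *\<^sub>C x = c *\<^sub>C x + d *\<^sub>C x"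
    and scaleC_scaleC: "c *\<^sub>C d *\<^sub>C x = (c * d) *\<^sub>C x"
    and scaleC_of_real: "complex_of_real r *\<^sub>C x = r *\<^sub>R x"

text \<open>The inner product is linear in its first argument. The class \<^class>\<open>banach\<close> supplies
  completeness with respect to the norm induced by it.\<close>

class complex_hilbert = banach + complex_vector +
  fixes cinner :: "'a \<Rightarrow> 'a \<Rightarrow> complex"
  assumes cinner_add_left: "cinner (x + y) z = cinner x z + cinner y z"
    and cinner_scaleC_left: "cinner (c *\<^sub>C x) y = c * cinner x y"
    and cinner_commute: "cinner x y = cnj (cinner y x)"
    and cinner_self: "cinner x x = complex_of_real ((norm x)\<^sup>2)"

definition bounded_clinear :: "('h::complex_hilbert \<Rightarrow> 'h) \<Rightarrow> bool" where
  "bounded_clinear T \<longleftrightarrow> bounded_linear T \<and> (\<forall>c x. T (c *\<^sub>C x) = c *\<^sub>C T x)"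

lemma scaleC_minus_right: "c *\<^sub>C (- x) = - (c *\<^sub>C (x::'a::complex_vector))"
proof -
  have "c *\<^sub>C (0::'a) = 0"
    using scaleC_add_right[of c 0 "0::'a"] by simp
  then show ?thesis
    using scaleC_add_right[of c x "- x"] by (simp add: eq_neg_iff_add_eq_0 add.commute)
qed

lemma bounded_clinear_0: "bounded_clinear (\<lambda>_. 0)"
  unfolding bounded_clinear_def
  using scaleC_add_right[of _ 0 "0::'a"] by (auto simp: bounded_linear_zero)

lemma bounded_clinear_scaleC_right: "bounded_clinear (\<lambda>x::'h::complex_hilbert. c *\<^sub>C x)"
proof -
  have "norm (c *\<^sub>C x) = norm x * norm c" for x :: 'h
  proof -
    have "complex_of_real ((norm (c *\<^sub>C x))\<^sup>2) = c * cnj c * cinner x x"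
      by (metis cinner_commute cinner_scaleC_left cinner_self complex_cnj_mult mult.assoc
          mult.left_commute)
    also have "\<dots> = complex_of_real ((norm c)\<^sup>2) * complex_of_real ((norm x)\<^sup>2)"
      by (simp only: cinner_self complex_norm_square)
    also have "\<dots> = complex_of_real ((norm x * norm c)\<^sup>2)"
      by (simp add: power_mult_distrib)
    finally have "(norm (c *\<^sub>C x))\<^sup>2 = (norm x * norm c)\<^sup>2"
      by (simp only: of_real_eq_iff)
    then show ?thesis
      by (simp add: power2_eq_iff_nonneg)
  qed
  moreover have "c *\<^sub>C r *\<^sub>R x = r *\<^sub>R c *\<^sub>C x" for r and x :: 'h
    by (metis mult.commute scaleC_of_real scaleC_scaleC)
  ultimately have "bounded_linear (\<lambda>x::'h. c *\<^sub>C x)"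
    by (intro bounded_linear_intro[where K = "norm c"]) (auto simp: scaleC_add_right)
  then show ?thesis
    by (simp add: bounded_clinear_def scaleC_scaleC mult.commute)
qed

typedef (overloaded) 'h oper = "{T :: 'h::complex_hilbert \<Rightarrow> 'h. bounded_clinear T}"
  morphisms app Oper
  using bounded_clinear_0 by blast

setup_lifting type_definition_oper

instantiation oper :: (complex_hilbert) "{ring, monoid_mult}"
begin

lift_definition zero_oper :: "'a oper" is "\<lambda>_. 0"
  by (rule bounded_clinear_0)

lift_definition one_oper :: "'a oper" is "\<lambda>x. x"
  by (simp add: bounded_clinear_def)

lift_definition plus_oper :: "'a oper \<Rightarrow> 'a oper \<Rightarrow> 'a oper" is "\<lambda>S T x. S x + T x"
  by (auto simp: bounded_clinear_def scaleC_add_right intro: bounded_linear_add)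

lift_definition uminus_oper :: "'a oper \<Rightarrow> 'a oper" is "\<lambda>T x. - T x"
  by (auto simp: bounded_clinear_def scaleC_minus_right intro: bounded_linear_minus)

definition minus_oper :: "'a oper \<Rightarrow> 'a oper \<Rightarrow> 'a oper" where
  "minus_oper S T = S + - T"

lift_definition times_oper :: "'a oper \<Rightarrow> 'a oper \<Rightarrow> 'a oper" is "\<lambda>S T x. S (T x)"
  by (auto simp: bounded_clinear_def intro: bounded_linear_compose)

instance
proof
  fix R S T :: "'a oper"
  show "R * S * T = R * (S * T)" "1 * R = R" "R * 1 = R" "R + S + T = R + (S + T)"
    "R + S = S + R" "0 + R = R" "- R + R = 0" "(R + S) * T = R * T + S * T"
    by (transfer; auto simp: algebra_simps)+
  show "R * (S + T) = R * S + R * T"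
    by transfer (auto simp: bounded_clinear_def linear_add bounded_linear.linear)
qed (simp add: minus_oper_def)

end

instantiation oper :: (complex_hilbert) "{real_algebra, complex_vector}"
begin

lift_definition scaleC_oper :: "complex \<Rightarrow> 'a oper \<Rightarrow> 'a oper" is "\<lambda>c T x. c *\<^sub>C T x"
  using bounded_clinear_scaleC_right
  by (auto simp: bounded_clinear_def scaleC_scaleC mult.commute intro: bounded_linear_compose)

definition scaleR_oper :: "real \<Rightarrow> 'a oper \<Rightarrow> 'a oper" where
  "scaleR_oper r T = complex_of_real r *\<^sub>C T"

instance
proof
  fix r s :: real and c d :: complex and S T :: "'a oper"
  show "c *\<^sub>C (S + T) = c *\<^sub>C S + c *\<^sub>C T" "(c + d) *\<^sub>C T = c *\<^sub>C T + d *\<^sub>C T"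
    "c *\<^sub>C d *\<^sub>C T = (c * d) *\<^sub>C T"
    by (transfer; simp add: scaleC_add_right scaleC_add_left scaleC_scaleC)+
  show "complex_of_real r *\<^sub>C T = r *\<^sub>R T"
    by (simp add: scaleR_oper_def)
  show "r *\<^sub>R (S + T) = r *\<^sub>R S + r *\<^sub>R T" "(r + s) *\<^sub>R T = r *\<^sub>R T + s *\<^sub>R T"
    "r *\<^sub>R s *\<^sub>R T = (r * s) *\<^sub>R T" "1 *\<^sub>R T = T" "r *\<^sub>R S * T = r *\<^sub>R (S * T)"
    unfolding scaleR_oper_def
    by (transfer; simp only: scaleC_of_real scaleR_add_right scaleR_add_left scaleR_scaleR
        scaleR_one)+
  show "S * r *\<^sub>R T = r *\<^sub>R (S * T)"
    unfolding scaleR_oper_def by transfer (simp add: bounded_clinear_def)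
qed

end

definition is_adjoint :: "'h::complex_hilbert oper \<Rightarrow> 'h oper \<Rightarrow> bool" where
  "is_adjoint S T \<longleftrightarrow> (\<forall>x y. cinner (app S x) y = cinner x (app T y))"

definition selfadjoint :: "'h::complex_hilbert oper \<Rightarrow> bool" where
  "selfadjoint T \<longleftrightarrow> is_adjoint T T"

section \<open>Von Neumann algebras and traces\<close>

text \<open>The ultraweak (\<open>\<sigma>\<close>-weak) topology is the coarsest one making continuous all functionals
  \<open>T \<mapsto> \<Sum>n. \<langle>T \<xi>\<^sub>n, \<eta>\<^sub>n\<rangle>\<close> with \<open>\<Sum>n. \<parallel>\<xi>\<^sub>n\<parallel>\<^sup>2\<close> and
  \<open>\<Sum>n. \<parallel>\<eta>\<^sub>n\<parallel>\<^sup>2\<close> finite.\<close>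

definition ultraweak_functionals :: "('h::complex_hilbert oper \<Rightarrow> complex) set" where
  "ultraweak_functionals =
     {\<lambda>T. \<Sum>n. cinner (app T (\<xi> n)) (\<eta> n) | \<xi> \<eta> :: nat \<Rightarrow> 'h.
        summable (\<lambda>n. (norm (\<xi> n))\<^sup>2) \<and> summable (\<lambda>n. (norm (\<eta> n))\<^sup>2)}"

definition ultraweak_topology :: "'h::complex_hilbert oper topology" where
  "ultraweak_topology =
     topology_generated_by {\<phi> -` U | \<phi> U. \<phi> \<in> ultraweak_functionals \<and> open U}"

text \<open>A von Neumann algebra is a *-algebra of bounded operators containing the identity and closed
  in the ultraweak topology (equivalently in the weak operator topology, or equal to its
  bicommutant).\<close>

definition von_neumann_algebra :: "'h::complex_hilbert oper set \<Rightarrow> bool" where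
  "von_neumann_algebra A \<longleftrightarrow>
     1 \<in> A \<and>
     (\<forall>S\<in>A. \<forall>T\<in>A. S + T \<in> A \<and> S * T \<in> A) \<and>
     (\<forall>c. \<forall>T\<in>A. c *\<^sub>C T \<in> A) \<and>
     (\<forall>T\<in>A. \<exists>S\<in>A. is_adjoint S T) \<and>
     closedin ultraweak_topology A"

definition generated_vN :: "'h::complex_hilbert oper \<Rightarrow> 'h oper set" where
  "generated_vN V = von_neumann_algebra hull {V}"

text \<open>Only the values of \<open>\<tau>\<close> on \<open>A\<close> matter. Normality is ultraweak continuity on \<open>A\<close>.\<close>

definition normal_faithful_tracial_state ::
    "'h::complex_hilbert oper set \<Rightarrow> ('h oper \<Rightarrow> complex) \<Rightarrow> bool" where
  "normal_faithful_tracial_state A \<tau> \<longleftrightarrow>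
     (\<forall>S\<in>A. \<forall>T\<in>A. \<tau> (S + T) = \<tau> S + \<tau> T) \<and>
     (\<forall>c. \<forall>T\<in>A. \<tau> (c *\<^sub>C T) = c * \<tau> T) \<and>
     \<tau> 1 = 1 \<and>
     (\<forall>S\<in>A. \<forall>T\<in>A. is_adjoint S T \<longrightarrow> \<tau> (S * T) \<in> \<real> \<and> 0 \<le> Re (\<tau> (S * T))) \<and>
     (\<forall>S\<in>A. \<forall>T\<in>A. is_adjoint S T \<longrightarrow> \<tau> (S * T) = 0 \<longrightarrow> T = 0) \<and>
     (\<forall>S\<in>A. \<forall>T\<in>A. \<tau> (S * T) = \<tau> (T * S)) \<and>
     continuous_map (subtopology ultraweak_topology A) euclidean \<tau>"

text \<open>\<open>\<tau>(U | V) = E\<close>: such an \<open>E\<close> is unique because \<open>\<tau>\<close> is faithful, and its existence is a general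
  theorem about finite von Neumann algebras.\<close>

definition is_cond_exp ::
    "('h::complex_hilbert oper \<Rightarrow> complex) \<Rightarrow> 'h oper \<Rightarrow> 'h oper \<Rightarrow> 'h oper \<Rightarrow> bool" where
  "is_cond_exp \<tau> U V E \<longleftrightarrow>
     E \<in> generated_vN V \<and> (\<forall>W\<in>generated_vN V. \<tau> (U * W) = \<tau> (E * W))"

section \<open>Laws, freeness and free Levy processes\<close>

definition compactly_supported_prob :: "real measure \<Rightarrow> bool" where
  "compactly_supported_prob \<mu> \<longleftrightarrow>
     prob_space \<mu> \<and> sets \<mu> = sets borel \<and> (\<exists>K. compact K \<and> (AE y in \<mu>. y \<in> K))"

definition has_law ::
    "('h::complex_hilbert oper \<Rightarrow> complex) \<Rightarrow> 'h oper \<Rightarrow> real measure \<Rightarrow> bool" where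
  "has_law \<tau> T \<mu> \<longleftrightarrow>
     compactly_supported_prob \<mu> \<and>
     (\<forall>n. \<tau> (T ^ n) = complex_of_real (LINT y|\<mu>. y ^ n))"

definition poly_oper :: "complex poly \<Rightarrow> 'h::complex_hilbert oper \<Rightarrow> 'h oper" where
  "poly_oper p T = (\<Sum>i\<le>degree p. coeff p i *\<^sub>C T ^ i)"

definition free_subalgebras ::
    "('h::complex_hilbert oper \<Rightarrow> complex) \<Rightarrow> 'i set \<Rightarrow> ('i \<Rightarrow> 'h oper set) \<Rightarrow> bool" where
  "free_subalgebras \<tau> I B \<longleftrightarrow>
     (\<forall>k\<ge>1. \<forall>(i :: nat \<Rightarrow> 'i) T.
        (\<forall>j<k. i j \<in> I \<and> T j \<in> B (i j) \<and> \<tau> (T j) = 0) \<longrightarrow>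
        (\<forall>j. Suc j < k \<longrightarrow> i j \<noteq> i (Suc j)) \<longrightarrow>
        \<tau> (prod_list (map T [0..<k])) = 0)"

text \<open>Freeness of self-adjoint elements is freeness of the unital algebras they generate.\<close>

definition free_elements ::
    "('h::complex_hilbert oper \<Rightarrow> complex) \<Rightarrow> 'i set \<Rightarrow> ('i \<Rightarrow> 'h oper) \<Rightarrow> bool" where
  "free_elements \<tau> I T \<longleftrightarrow> free_subalgebras \<tau> I (\<lambda>i. range (\<lambda>p. poly_oper p (T i)))"

text \<open>Only the values \<open>X t\<close> with \<open>t \<ge> 0\<close> matter. The measure \<open>\<nu>\<close> below is the common law of the
  increments of length \<open>s\<close>.\<close>

definition free_levy_process ::
    "'h::complex_hilbert oper set \<Rightarrow> ('h oper \<Rightarrow> complex) \<Rightarrow> (real \<Rightarrow> 'h oper) \<Rightarrow> bool" where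
  "free_levy_process A \<tau> X \<longleftrightarrow>
     (\<forall>t\<ge>0. X t \<in> A \<and> selfadjoint (X t)) \<and>
     X 0 = 0 \<and>
     (\<forall>n (t :: nat \<Rightarrow> real). 0 \<le> t 0 \<longrightarrow> (\<forall>i<n. t i < t (Suc i)) \<longrightarrow>
        free_elements \<tau> {..<n} (\<lambda>i. X (t (Suc i)) - X (t i))) \<and>
     (\<forall>s\<ge>0. \<exists>\<nu>. \<forall>t\<ge>0. has_law \<tau> (X (t + s) - X t) \<nu>)"

text \<open>The function \<open>w\<close> is the branch of the square root. The quotient has removable singularities at
  zeros of its denominator in the upper half plane (they exist if \<open>a\<^sup>2 < 4 * b\<close>), so these points are
  excluded.\<close>

definition is_free_meixner :: "real \<Rightarrow> real \<Rightarrow> real measure \<Rightarrow> bool" where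
  "is_free_meixner a b \<mu> \<longleftrightarrow>
     compactly_supported_prob \<mu> \<and>
     (\<exists>w. w holomorphic_on {z. Im z > 0} \<and>
        (\<forall>z. Im z > 0 \<longrightarrow>
           (w z)\<^sup>2 = (z - of_real a)\<^sup>2 - 4 * (1 + of_real b) \<and>
           Im (LINT y|\<mu>. 1 / (z - complex_of_real y)) \<le> 0 \<and>
           (of_real b * z\<^sup>2 + of_real a * z + 1 \<noteq> 0 \<longrightarrow>
              (LINT y|\<mu>. 1 / (z - complex_of_real y)) =
                ((1 + 2 * of_real b) * z + of_real a - w z) /
                (2 * (of_real b * z\<^sup>2 + of_real a * z + 1)))))"

end

theory Submission
  imports Defs
begin

text \<open>Every series is a formal power series in \<open>w\<close>, to be thought of as the value of the Cauchy
  transform. Let \<open>H\<^sub>t\<close> be \<open>w\<close> times the R-transform of \<open>X\<^sub>t\<close> at \<open>w\<close>. Then the resolvent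
  \<open>R = (1 + H\<^sub>s - w X\<^sub>s)\<^sup>-\<^sup>1\<close> has trace 1 and its coefficients span the polynomials in \<open>X\<^sub>s\<close>.
  Because these are ultraweakly dense in the von Neumann algebra generated by \<open>X\<^sub>s\<close>, the formula for the
  conditional expectation holds iff both sides have the same trace against \<open>R\<close>. Factorizing \<open>R\<close> into
  alternating products of centered series in the free elements \<open>X\<^sub>t\<close> and \<open>X\<^sub>s - X\<^sub>t\<close> yields
  \<open>w\<^sup>3 \<tau>(X\<^sub>t X\<^sub>s X\<^sub>t R) = H\<^sub>t + (2 + H\<^sub>s) H\<^sub>t\<^sup>2 - t w\<^sup>2\<close>. If \<open>H\<^sub>t = (t / s) H\<^sub>s\<close>, comparing
  this with the right-hand side leaves the equation \<open>b H\<^sub>s\<^sup>2 + a s w H\<^sub>s + s\<^sup>2 w\<^sup>2 = s H\<^sub>s\<close>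
  times an invertible factor, and this equation characterizes the free Meixner laws. The proportionality
  of \<open>H\<^sub>t\<close> and \<open>H\<^sub>s\<close> follows from either side of the equivalence.\<close>

section \<open>Operators and the ultraweak topology\<close>

text \<open>The choice of the variable keeps the free part purely algebraic. In terms of the value w
  of the Cauchy transform, inverse transforms of free elements add up: for \<open>U = X t\<close>,
  \<open>V = X s - X t\<close> and their inverse transforms \<open>u\<close>, \<open>v\<close>, the
  inverse of the resolvent is \<open>(u - w U) + (v - w V) - 1\<close>. If \<open>1 + a\<close> and
  \<open>1 + b\<close> denote the inverses of the two brackets (not the Meixner parameters),
  multiplying this sum by \<open>1 + a\<close> on the left and by \<open>1 + b\<close> on the right
  gives \<open>1 - a b\<close>. Hence \<open>R = (1 + b) (1 - a b)^-1 (1 + a)\<close>. The series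
  \<open>a\<close>, \<open>b\<close> are centered and start at order one, so \<open>R\<close> is a
  formal sum of alternating words; neither convergence nor cumulants enter. Analysis is confined to
  two places: normality of the trace carries moment conditions to the generated algebra, and the
  branch formula on the upper half plane has to be converted into a polynomial equation for the
  moment series. The obstacle in the converse direction is that \<open>H t\<close> comes with no
  regularity in \<open>t\<close>; additivity combined with the shape of the conditional expectation
  has to replace it.\<close>

lemma is_adjoint_sym: "is_adjoint S T \<Longrightarrow> is_adjoint T S"
  unfolding is_adjoint_def by (metis cinner_commute)

lemma cinner_add_right: "cinner x (y + z) = cinner x y + cinner x (z::'a::complex_hilbert)"
  by (metis cinner_add_left cinner_commute complex_cnj_add)

lemma cinner_scaleC_right: "cinner x (c *\<^sub>C y) = cnj c * cinner x (y::'a::complex_hilbert)"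
  by (metis cinner_commute cinner_scaleC_left complex_cnj_mult)

lemma cinner_minus_left: "cinner (- x) y = - cinner x (y::'a::complex_hilbert)"
  using cinner_add_left[of x "-x" y] cinner_add_left[of 0 0 y] by (simp add: eq_neg_iff_add_eq_0)

lemma cinner_diff_left: "cinner (x - y) z = cinner x z - cinner y (z::'a::complex_hilbert)"
  using cinner_add_left[of x "-y" z] by (simp add: cinner_minus_left)

lemma cinner_diff_right: "cinner x (y - z) = cinner x y - cinner x (z::'a::complex_hilbert)"
  by (metis cinner_commute cinner_diff_left complex_cnj_diff)

lemma is_adjoint_unique:
  assumes "is_adjoint S T" "is_adjoint S' T"
  shows "S = S'"
proof -
  have "app S x = app S' x" for x
  proof -
    have "cinner (app S x - app S' x) y = 0" for y
      using assms by (simp add: cinner_diff_left is_adjoint_def)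
    from this[of "app S x - app S' x"] show ?thesis
      by (simp add: cinner_self)
  qed
  then show ?thesis
    by (metis app_inverse ext)
qed

lemma app_simps:
  "app (S + T) x = app S x + app T x" "app (S * T) x = app S (app T x)"
  "app (c *\<^sub>C T) x = c *\<^sub>C app T x" "app 1 x = x" "app 0 x = 0"
  by (transfer; simp)+

lemma bounded_linear_app: "bounded_linear (app T)"
  by transfer (simp add: bounded_clinear_def)

lemma is_adjoint_add: "is_adjoint S S' \<Longrightarrow> is_adjoint T T' \<Longrightarrow> is_adjoint (S + T) (S' + T')"
  by (simp add: is_adjoint_def app_simps cinner_add_left cinner_add_right)

lemma is_adjoint_mult: "is_adjoint S S' \<Longrightarrow> is_adjoint T T' \<Longrightarrow> is_adjoint (S * T) (T' * S')"
  by (simp add: is_adjoint_def app_simps)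

lemma is_adjoint_scaleC: "is_adjoint S S' \<Longrightarrow> is_adjoint (c *\<^sub>C S) (cnj c *\<^sub>C S')"
  by (simp add: is_adjoint_def app_simps cinner_scaleC_left cinner_scaleC_right)

lemma is_adjoint_1: "is_adjoint 1 1"
  by (simp add: is_adjoint_def app_simps)

lemma is_adjoint_0: "is_adjoint 0 (0::'h::complex_hilbert oper)"
  using cinner_add_left[of "0::'h" 0] cinner_add_right[of _ "0::'h" 0]
  by (simp add: is_adjoint_def app_simps)

lemma is_adjoint_power: "is_adjoint T T' \<Longrightarrow> is_adjoint (T ^ n) (T' ^ n)"
proof (induction n)
  case (Suc n)
  then show ?case
    unfolding power_Suc2[of T'] by (auto intro: is_adjoint_mult)
qed (simp add: is_adjoint_1)

lemma oper_mult_scaleC_left: "(c *\<^sub>C S) * T = c *\<^sub>C (S * (T::'h::complex_hilbert oper))"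
  by transfer simp

lemma oper_mult_scaleC_right: "S * (c *\<^sub>C T) = c *\<^sub>C (S * (T::'h::complex_hilbert oper))"
  by transfer (simp add: bounded_clinear_def)

lemma scaleC_one: "1 *\<^sub>C x = (x::'a::complex_vector)"
  using scaleC_of_real[of 1 x] by simp

lemma scaleC_zero_left: "0 *\<^sub>C x = (0::'a::complex_vector)"
  using scaleC_of_real[of 0 x] by simp

lemma scaleC_zero_right: "c *\<^sub>C 0 = (0::'a::complex_vector)"
  using scaleC_add_right[of c 0 0] by simp

lemma scaleC_minus_one: "(-1) *\<^sub>C x = - (x::'a::complex_vector)"
  using scaleC_of_real[of "-1" x] by simp

lemma scaleC_minus_left: "(- c) *\<^sub>C x = - (c *\<^sub>C (x::'a::complex_vector))"
  using scaleC_add_left[of "-c" c x] by (simp add: scaleC_zero_left eq_neg_iff_add_eq_0)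

lemma scaleC_sum_right: "c *\<^sub>C (\<Sum>i\<in>I. f i) = (\<Sum>i\<in>I. c *\<^sub>C (f i :: 'a::complex_vector))"
  by (induction I rule: infinite_finite_induct) (simp_all add: scaleC_zero_right scaleC_add_right)

lemma scaleC_sum_left: "(\<Sum>i\<in>I. f i) *\<^sub>C x = (\<Sum>i\<in>I. f i *\<^sub>C (x :: 'a::complex_vector))"
  by (induction I rule: infinite_finite_induct) (simp_all add: scaleC_zero_left scaleC_add_left)

lemma norm_cinner_le: "norm (cinner x y) \<le> norm x * norm (y::'a::complex_hilbert)"
proof (cases "y = 0")
  case True
  then show ?thesis using cinner_add_right[of x 0 0] by simp
next
  case False
  define c where "c = cinner x y"
  define r where "r = (norm y)\<^sup>2"
  \<comment> \<open>\<open>v\<close> is \<open>r\<close> times the component of \<open>x\<close>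
    orthogonal to \<open>y\<close>; its squared norm is nonnegative, and no division by
    \<open>r\<close> occurs in its definition.\<close>
  define v where "v = complex_of_real r *\<^sub>C x - c *\<^sub>C y"
  have r: "r > 0" using False by (simp add: r_def)
  have yx: "cinner y x = cnj c" by (simp only: c_def cinner_commute[of y x])
  have yy: "cinner y y = of_real r" by (simp only: r_def cinner_self)
  have "cinner v v = of_real r * of_real r * cinner x x - of_real r * (c * cnj c)"
    unfolding v_def cinner_diff_left cinner_diff_right cinner_scaleC_left cinner_scaleC_right
        yx yy c_def[symmetric] by (simp add: algebra_simps)
  also have "\<dots> = of_real r * of_real r * of_real ((norm x)\<^sup>2) - of_real r * (c * cnj c)"
    by (simp only: cinner_self)
  also have "\<dots> = of_real (r * (r * (norm x)\<^sup>2 - (norm c)\<^sup>2))"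
    using complex_norm_square[of c] by (simp add: algebra_simps)
  finally have "(norm v)\<^sup>2 = r * (r * (norm x)\<^sup>2 - (norm c)\<^sup>2)"
    by (simp only: cinner_self of_real_eq_iff)
  then have "0 \<le> r * (r * (norm x)\<^sup>2 - (norm c)\<^sup>2)"
    by (metis zero_le_power2)
  then have "(norm c)\<^sup>2 \<le> (norm x * norm y)\<^sup>2"
    using r by (simp add: r_def zero_le_mult_iff power_mult_distrib mult.commute)
  then show ?thesis
    unfolding c_def by (rule power2_le_imp_le) simp
qed

section \<open>Ultraweak functionals and continuity of the algebra operations\<close>

lemma summable_norm_square_app:
  assumes "summable (\<lambda>n. (norm (\<xi> n))\<^sup>2)"
  shows "summable (\<lambda>n. (norm (app T (\<xi> n)))\<^sup>2)"
proof -
  obtain K where K: "\<And>x. norm (app T x) \<le> norm x * K"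
    using bounded_linear.bounded[OF bounded_linear_app[of T]] by blast
  have "(norm (app T (\<xi> n)))\<^sup>2 \<le> K\<^sup>2 * (norm (\<xi> n))\<^sup>2" for n
    using power_mono[OF K norm_ge_zero, of "\<xi> n" 2] by (simp add: power_mult_distrib mult.commute)
  then show ?thesis
    by (intro summable_comparison_test'[OF summable_mult[OF assms, of "K\<^sup>2"]]) simp
qed

lemma summable_cinner:
  assumes "summable (\<lambda>n. (norm (\<xi> n))\<^sup>2)" "summable (\<lambda>n. (norm (\<eta> n))\<^sup>2)"
  shows "summable (\<lambda>n. cinner (\<xi> n) (\<eta> n))"
proof (rule summable_comparison_test'[OF summable_add[OF assms]])
  fix n
  have "norm (cinner (\<xi> n) (\<eta> n)) \<le> norm (\<xi> n) * norm (\<eta> n)"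
    by (rule norm_cinner_le)
  also have "\<dots> \<le> (norm (\<xi> n))\<^sup>2 + (norm (\<eta> n))\<^sup>2"
    using sum_squares_bound[of "norm (\<xi> n)" "norm (\<eta> n)"]
      mult_nonneg_nonneg[of "norm (\<xi> n)" "norm (\<eta> n)"]
    unfolding mult.assoc using norm_ge_zero[of "\<xi> n"] norm_ge_zero[of "\<eta> n"] by linarith
  finally show "norm (cinner (\<xi> n) (\<eta> n)) \<le> (norm (\<xi> n))\<^sup>2 + (norm (\<eta> n))\<^sup>2" .
qed

lemma topspace_ultraweak [simp]: "topspace ultraweak_topology = UNIV"
proof -
  \<comment> \<open>The carrier of a generated topology is the union of the generating sets, so one
    functional must be exhibited. The one from zero sequences will do, as its preimage of the whole
    plane is everything.\<close>
  define \<phi> where "\<phi> = (\<lambda>T::'a oper. \<Sum>n::nat. cinner (app T 0) 0)"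
  have "\<phi> \<in> ultraweak_functionals"
    unfolding ultraweak_functionals_def \<phi>_def
    by (rule CollectI, rule exI[of _ "\<lambda>_. 0"], rule exI[of _ "\<lambda>_. 0"]) simp
  then have "\<phi> -` UNIV \<in> {\<phi> -` U | \<phi> U. \<phi> \<in> ultraweak_functionals \<and> open U}"
    using open_UNIV by blast
  then have "x \<in> \<Union> {\<phi> -` U | \<phi> U. (\<phi>::'a oper \<Rightarrow> complex) \<in> ultraweak_functionals \<and> open U}" for x
    by (rule UnionI) simp
  then have "\<Union> {\<phi> -` U | \<phi> U. (\<phi>::'a oper \<Rightarrow> complex) \<in> ultraweak_functionals \<and> open U} = UNIV"
    by (rule UNIV_eq_I[symmetric])
  then show ?thesis
    by (simp only: ultraweak_topology_def topology_generated_by_topspace)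
qed

lemma continuous_map_ultraweak_functional:
  assumes "\<phi> \<in> ultraweak_functionals"
  shows "continuous_map ultraweak_topology euclidean \<phi>"
  unfolding continuous_map_def
proof (intro conjI allI impI)
  fix U :: "complex set" assume "openin euclidean U"
  then have "openin ultraweak_topology (\<phi> -` U)"
    unfolding ultraweak_topology_def using assms
    by (intro topology_generated_by_Basis) auto
  then show "openin ultraweak_topology {x \<in> topspace ultraweak_topology. \<phi> x \<in> U}"
    by (simp add: vimage_def)
qed simp

text \<open>The universal property of an initial topology: continuity is tested on the defining
  functionals.\<close>

lemma continuous_map_into_ultraweak:
  assumes "\<And>\<phi>. \<phi> \<in> ultraweak_functionals \<Longrightarrow> continuous_map Z euclidean (\<lambda>x. \<phi> (f x))"
  shows "continuous_map Z ultraweak_topology f"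
  unfolding ultraweak_topology_def
proof (rule continuous_on_generated_topo)
  fix V assume "V \<in> {\<phi> -` U | \<phi> U. (\<phi>::'a oper \<Rightarrow> complex) \<in> ultraweak_functionals \<and> open U}"
  then obtain \<phi> U where \<phi>: "V = \<phi> -` U" "\<phi> \<in> ultraweak_functionals" "open U" by blast
  from assms[OF \<phi>(2)] \<phi>(3) have "openin Z {x \<in> topspace Z. \<phi> (f x) \<in> U}"
    by (auto simp: continuous_map_def)
  moreover have "{x \<in> topspace Z. \<phi> (f x) \<in> U} = f -` V \<inter> topspace Z"
    using \<phi>(1) by auto
  ultimately show "openin Z (f -` V \<inter> topspace Z)" by simp
next
  have "\<Union> {\<phi> -` U | \<phi> U. (\<phi>::'a oper \<Rightarrow> complex) \<in> ultraweak_functionals \<and> open U} = UNIV"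
    using topspace_ultraweak by (simp only: ultraweak_topology_def topology_generated_by_topspace)
  then show "f ` topspace Z \<subseteq> \<Union> {\<phi> -` U | \<phi> U. (\<phi>::'a oper \<Rightarrow> complex) \<in> ultraweak_functionals \<and> open U}"
    by simp
qed

lemma ultraweak_functional_cases:
  assumes "\<phi> \<in> ultraweak_functionals"
  obtains \<xi> \<eta> where "\<And>T. \<phi> T = (\<Sum>n. cinner (app T (\<xi> n)) (\<eta> n))"
    "summable (\<lambda>n. (norm (\<xi> n))\<^sup>2)" "summable (\<lambda>n. (norm (\<eta> n))\<^sup>2)"
  using assms unfolding ultraweak_functionals_def by blast

lemma ultraweak_functionalI:
  assumes "\<And>T. \<phi> T = (\<Sum>n. cinner (app T (\<xi> n)) (\<eta> n))"
    "summable (\<lambda>n. (norm (\<xi> n))\<^sup>2)" "summable (\<lambda>n. (norm (\<eta> n))\<^sup>2)"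
  shows "\<phi> \<in> ultraweak_functionals"
  using assms unfolding ultraweak_functionals_def by blast

text \<open>Multiplying by \<open>W\<close> replaces the vectors \<open>\<xi> n\<close> by their
  images under \<open>W\<close>, which are still square summable, so the composed functional is
  again ultraweak.\<close>

lemma continuous_map_ultraweak_mult_right:
  "continuous_map ultraweak_topology ultraweak_topology (\<lambda>T. T * W)"
proof (rule continuous_map_into_ultraweak, rule continuous_map_ultraweak_functional)
  fix \<phi> :: "'a oper \<Rightarrow> complex" assume "\<phi> \<in> ultraweak_functionals"
  then obtain \<xi> \<eta> where *: "\<And>T. \<phi> T = (\<Sum>n. cinner (app T (\<xi> n)) (\<eta> n))"
    "summable (\<lambda>n. (norm (\<xi> n))\<^sup>2)" "summable (\<lambda>n. (norm (\<eta> n))\<^sup>2)"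
    using ultraweak_functional_cases by blast
  show "(\<lambda>T. \<phi> (T * W)) \<in> ultraweak_functionals"
    by (rule ultraweak_functionalI[where \<xi> = "\<lambda>n. app W (\<xi> n)" and \<eta> = \<eta>])
      (simp_all add: * app_simps summable_norm_square_app)
qed

text \<open>\<open>W\<close> moves over to the vectors \<open>\<eta> n\<close> as its adjoint, which
  is taken as a hypothesis; inside a von Neumann algebra, closure under adjoints provides
  it.\<close>

lemma continuous_map_ultraweak_mult_left:
  assumes "is_adjoint W W'"
  shows "continuous_map ultraweak_topology ultraweak_topology (\<lambda>T. W * T)"
proof (rule continuous_map_into_ultraweak, rule continuous_map_ultraweak_functional)
  fix \<phi> :: "'a oper \<Rightarrow> complex" assume "\<phi> \<in> ultraweak_functionals"
  then obtain \<xi> \<eta> where *: "\<And>T. \<phi> T = (\<Sum>n. cinner (app T (\<xi> n)) (\<eta> n))"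
    "summable (\<lambda>n. (norm (\<xi> n))\<^sup>2)" "summable (\<lambda>n. (norm (\<eta> n))\<^sup>2)"
    using ultraweak_functional_cases by blast
  show "(\<lambda>T. \<phi> (W * T)) \<in> ultraweak_functionals"
    by (rule ultraweak_functionalI[where \<xi> = \<xi> and \<eta> = "\<lambda>n. app W' (\<eta> n)"])
      (use assms in \<open>simp_all add: * app_simps summable_norm_square_app is_adjoint_def\<close>)
qed

lemma continuous_map_ultraweak_add_left:
  "continuous_map ultraweak_topology ultraweak_topology (\<lambda>T. W + T)"
proof (rule continuous_map_into_ultraweak)
  fix \<phi> :: "'a oper \<Rightarrow> complex" assume \<phi>: "\<phi> \<in> ultraweak_functionals"
  then obtain \<xi> \<eta> where *: "\<And>T. \<phi> T = (\<Sum>n. cinner (app T (\<xi> n)) (\<eta> n))"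
    "summable (\<lambda>n. (norm (\<xi> n))\<^sup>2)" "summable (\<lambda>n. (norm (\<eta> n))\<^sup>2)"
    using ultraweak_functional_cases by blast
  have "\<phi> (W + T) = \<phi> W + \<phi> T" for T
    unfolding * app_simps cinner_add_left
    by (rule suminf_add[symmetric]; intro summable_cinner summable_norm_square_app *)
  then show "continuous_map ultraweak_topology euclidean (\<lambda>T. \<phi> (W + T))"
    using continuous_map_ultraweak_functional[OF \<phi>]
    by (auto intro!: continuous_map_add)
qed

text \<open>Passing to adjoints exchanges the roles of \<open>\<xi>\<close> and
  \<open>\<eta>\<close> up to complex conjugation, and conjugation is continuous. The restriction to
  \<open>B\<close> allows \<open>f\<close> to pick adjoints only where they are known to
  exist.\<close>

lemma continuous_map_ultraweak_adjoint:
  assumes "\<And>T. T \<in> B \<Longrightarrow> is_adjoint (f T) T"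
  shows "continuous_map (subtopology ultraweak_topology B) ultraweak_topology f"
proof (rule continuous_map_into_ultraweak)
  fix \<phi> :: "'a oper \<Rightarrow> complex" assume \<phi>: "\<phi> \<in> ultraweak_functionals"
  then obtain \<xi> \<eta> where *: "\<And>T. \<phi> T = (\<Sum>n. cinner (app T (\<xi> n)) (\<eta> n))"
    "summable (\<lambda>n. (norm (\<xi> n))\<^sup>2)" "summable (\<lambda>n. (norm (\<eta> n))\<^sup>2)"
    using ultraweak_functional_cases by blast
  define \<psi> where "\<psi> T = (\<Sum>n. cinner (app T (\<eta> n)) (\<xi> n))" for T
  have "\<psi> \<in> ultraweak_functionals"
    by (rule ultraweak_functionalI[OF \<psi>_def *(3,2)])
  then have "continuous_map (subtopology ultraweak_topology B) euclidean \<psi>"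
    by (intro continuous_map_from_subtopology continuous_map_ultraweak_functional)
  then have "continuous_map (subtopology ultraweak_topology B) euclidean (cnj \<circ> \<psi>)"
    by (rule continuous_map_compose) (simp add: continuous_on_cnj)
  moreover have "(cnj \<circ> \<psi>) T = \<phi> (f T)" if "T \<in> topspace (subtopology ultraweak_topology B)" for T
  proof -
    have T: "is_adjoint (f T) T" using that assms by simp
    have "cnj (\<psi> T) = (\<Sum>n. cnj (cinner (app T (\<eta> n)) (\<xi> n)))"
      unfolding \<psi>_def
      using bounded_linear.suminf[OF bounded_linear_cnj
          summable_cinner[OF summable_norm_square_app[OF *(3)] *(2)]] .
    also have "\<dots> = \<phi> (f T)"
      unfolding * using T by (simp add: is_adjoint_def flip: cinner_commute)
    finally show ?thesis by simp
  qed
  ultimately show "continuous_map (subtopology ultraweak_topology B) euclidean (\<lambda>x. \<phi> (f x))"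
    by (rule continuous_map_eq)
qed


section \<open>Polynomials in one operator\<close>

lemma poly_oper_altdef:
  assumes "degree p \<le> N"
  shows "poly_oper p T = (\<Sum>i\<le>N. coeff p i *\<^sub>C T ^ i)"
  unfolding poly_oper_def using assms
  by (intro sum.mono_neutral_left) (auto simp: coeff_eq_0 scaleC_zero_left)

lemma poly_oper_add: "poly_oper (p + q) T = poly_oper p T + poly_oper q T"
proof -
  define N where "N = max (degree p) (degree q)"
  have "degree (p + q) \<le> N" "degree p \<le> N" "degree q \<le> N"
    by (auto simp: N_def intro: degree_add_le)
  then show ?thesis
    by (simp add: poly_oper_altdef[where N = N] scaleC_add_left sum.distrib)
qed

lemma poly_oper_smult: "poly_oper (smult c p) T = c *\<^sub>C poly_oper p T"
  by (subst poly_oper_altdef[OF degree_smult_le])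
    (simp add: poly_oper_def scaleC_sum_right scaleC_scaleC)

lemma poly_oper_pCons: "poly_oper (pCons c p) T = c *\<^sub>C 1 + T * poly_oper p T"
proof -
  have "poly_oper (pCons c p) T = (\<Sum>i\<le>Suc (degree p). coeff (pCons c p) i *\<^sub>C T ^ i)"
    by (intro poly_oper_altdef degree_pCons_le)
  also have "\<dots> = c *\<^sub>C 1 + (\<Sum>i\<le>degree p. coeff p i *\<^sub>C (T * T ^ i))"
    by (subst sum.atMost_Suc_shift) simp
  also have "(\<Sum>i\<le>degree p. coeff p i *\<^sub>C (T * T ^ i)) = T * poly_oper p T"
    by (simp add: poly_oper_def sum_distrib_left oper_mult_scaleC_right)
  finally show ?thesis .
qed

lemma poly_oper_0: "poly_oper 0 T = 0"
  by (simp add: poly_oper_def scaleC_zero_left)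

lemma poly_oper_mult: "poly_oper (p * q) T = poly_oper p T * poly_oper q T"
  by (induction p)
    (simp_all add: poly_oper_0 poly_oper_pCons poly_oper_add poly_oper_smult distrib_right
      oper_mult_scaleC_left scaleC_zero_left mult.assoc)

definition poly_algebra :: "'h::complex_hilbert oper \<Rightarrow> 'h oper set" where
  "poly_algebra T = range (\<lambda>p. poly_oper p T)"

lemma poly_algebra_add: "x \<in> poly_algebra T \<Longrightarrow> y \<in> poly_algebra T \<Longrightarrow> x + y \<in> poly_algebra T"
  unfolding poly_algebra_def by (auto simp flip: poly_oper_add)

lemma poly_algebra_mult: "x \<in> poly_algebra T \<Longrightarrow> y \<in> poly_algebra T \<Longrightarrow> x * y \<in> poly_algebra T"
  unfolding poly_algebra_def by (auto simp flip: poly_oper_mult)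

lemma poly_algebra_scaleC: "x \<in> poly_algebra T \<Longrightarrow> c *\<^sub>C x \<in> poly_algebra T"
  unfolding poly_algebra_def by (auto simp flip: poly_oper_smult)

lemma poly_algebra_0: "0 \<in> poly_algebra T"
  unfolding poly_algebra_def using poly_oper_0[of T] by (metis rangeI)

lemma poly_algebra_1: "1 \<in> poly_algebra T"
  unfolding poly_algebra_def
  by (rule range_eqI[of _ _ "[:1:]"]) (simp add: poly_oper_pCons poly_oper_0 scaleC_one)

lemma poly_algebra_self: "T \<in> poly_algebra T"
  unfolding poly_algebra_def
  by (rule range_eqI[of _ _ "[:0, 1:]"])
    (simp add: poly_oper_pCons poly_oper_0 scaleC_one scaleC_zero_left)

lemma poly_algebra_sum: "(\<And>i. i \<in> I \<Longrightarrow> f i \<in> poly_algebra T) \<Longrightarrow> sum f I \<in> poly_algebra T"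
  by (induction I rule: infinite_finite_induct) (auto simp: poly_algebra_0 poly_algebra_add)

lemma poly_algebra_power: "T ^ n \<in> poly_algebra T"
  by (induction n) (simp_all add: poly_algebra_1 poly_algebra_mult poly_algebra_self)

section \<open>Membership in von Neumann algebras and density of the polynomials\<close>

lemma von_neumann_algebra_0: "von_neumann_algebra A \<Longrightarrow> 0 \<in> A"
  unfolding von_neumann_algebra_def by (metis scaleC_zero_left)

lemma von_neumann_algebra_sum:
  assumes "von_neumann_algebra A" "\<And>i. i \<in> I \<Longrightarrow> f i \<in> A"
  shows "sum f I \<in> A"
  using assms(2)
  by (induction I rule: infinite_finite_induct)
    (use assms(1) von_neumann_algebra_0 in \<open>auto simp: von_neumann_algebra_def\<close>)

lemma von_neumann_algebra_power: "von_neumann_algebra A \<Longrightarrow> T \<in> A \<Longrightarrow> T ^ n \<in> A"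
  by (induction n) (simp_all add: von_neumann_algebra_def)

lemma poly_algebra_subset: "von_neumann_algebra A \<Longrightarrow> T \<in> A \<Longrightarrow> poly_algebra T \<subseteq> A"
  unfolding poly_algebra_def poly_oper_def
  using von_neumann_algebra_power[of A T]
  by (auto intro!: von_neumann_algebra_sum simp: von_neumann_algebra_def)

lemma poly_algebra_subset_generated_vN: "poly_algebra T \<subseteq> generated_vN T"
  unfolding generated_vN_def hull_def using poly_algebra_subset by fastforce

lemma poly_algebra_adjoint:
  assumes "selfadjoint V" "T \<in> poly_algebra V"
  shows "\<exists>S\<in>poly_algebra V. is_adjoint S T"
proof -
  obtain p where p: "T = poly_oper p V"
    using assms(2) by (auto simp: poly_algebra_def)
  have "is_adjoint (\<Sum>i\<in>I. cnj (coeff p i) *\<^sub>C V ^ i) (\<Sum>i\<in>I. coeff p i *\<^sub>C V ^ i)" for I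
    using assms(1) is_adjoint_scaleC[OF is_adjoint_power, of V V "cnj (coeff p _)"]
    by (induction I rule: infinite_finite_induct)
      (auto simp: is_adjoint_0 is_adjoint_add selfadjoint_def)
  moreover have "(\<Sum>i\<in>I. cnj (coeff p i) *\<^sub>C V ^ i) \<in> poly_algebra V" for I
    by (intro poly_algebra_sum poly_algebra_scaleC poly_algebra_power)
  ultimately show ?thesis
    unfolding p poly_oper_def by blast
qed

text \<open>The closure is itself a von Neumann algebra containing \<open>V\<close>, so minimality
  of the hull applies. The operations are known to be continuous only in one argument at a time;
  sums and products of limits are therefore reached in two stages, first polynomial with limit, then
  limit with limit. The ambient \<open>A\<close> is closed, hence contains the closure and supplies
  adjoints of its elements.\<close>

lemma generated_vN_subset_closure:
  assumes A: "von_neumann_algebra A" and V: "V \<in> A" "selfadjoint V"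
  shows "generated_vN V \<subseteq> ultraweak_topology closure_of poly_algebra V"
proof -
  define C where "C = ultraweak_topology closure_of poly_algebra V"
  have PC: "poly_algebra V \<subseteq> C"
    unfolding C_def by (rule closure_of_subset) simp
  have CA: "C \<subseteq> A"
    unfolding C_def using A poly_algebra_subset[OF A V(1)]
    by (intro closure_of_minimal) (auto simp: von_neumann_algebra_def)
  have img: "f ` C \<subseteq> C" if "continuous_map ultraweak_topology ultraweak_topology f"
    "f ` poly_algebra V \<subseteq> C" for f
  proof -
    have "f ` C \<subseteq> ultraweak_topology closure_of (f ` poly_algebra V)"
      unfolding C_def by (rule continuous_map_image_closure_subset[OF that(1)])
    also have "\<dots> \<subseteq> C"
      using that(2) unfolding C_def by (simp add: closure_of_minimal)
    finally show ?thesis .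
  qed
  have scale: "c *\<^sub>C T \<in> C" if "T \<in> C" for c T
  proof -
    \<comment> \<open>Scaling is treated as left multiplication by a multiple of the identity, whose
      adjoint is explicit.\<close>
    have "(\<lambda>T. (c *\<^sub>C 1) * T) ` C \<subseteq> C"
      by (intro img continuous_map_ultraweak_mult_left[where W' = "cnj c *\<^sub>C 1"]
          is_adjoint_scaleC is_adjoint_1)
        (use PC in \<open>auto simp: oper_mult_scaleC_left intro: poly_algebra_scaleC\<close>)
    then show ?thesis
      using that by (auto simp: oper_mult_scaleC_left)
  qed
  have adj: "\<exists>S\<in>A. is_adjoint S T" if "T \<in> A" for T
    using A that unfolding von_neumann_algebra_def by blast
  have mult1: "S * T \<in> C" if "S \<in> poly_algebra V" "T \<in> C" for S T
  proof -
    obtain S' where "is_adjoint S S'"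
      using poly_algebra_adjoint[OF V(2)] is_adjoint_sym \<open>S \<in> poly_algebra V\<close> by blast
    then have "(\<lambda>T. S * T) ` C \<subseteq> C"
      by (intro img continuous_map_ultraweak_mult_left)
        (use PC that in \<open>auto intro: poly_algebra_mult\<close>)
    then show ?thesis
      using that by auto
  qed
  have mult: "S * T \<in> C" if "S \<in> C" "T \<in> C" for S T
  proof -
    have "(\<lambda>S. S * T) ` C \<subseteq> C"
      by (intro img continuous_map_ultraweak_mult_right) (use mult1 that in auto)
    then show ?thesis
      using that by auto
  qed
  have add1: "S + T \<in> C" if "S \<in> poly_algebra V" "T \<in> C" for S T
  proof -
    have "(\<lambda>T. S + T) ` C \<subseteq> C"
      by (intro img continuous_map_ultraweak_add_left)
        (use PC that in \<open>auto intro: poly_algebra_add\<close>)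
    then show ?thesis
      using that by auto
  qed
  have add: "S + T \<in> C" if "S \<in> C" "T \<in> C" for S T
  proof -
    have "(\<lambda>S. T + S) ` C \<subseteq> C"
      by (intro img continuous_map_ultraweak_add_left)
        (use add1 that in \<open>auto simp: add.commute[of T]\<close>)
    then show ?thesis
      using that by (auto simp: add.commute[of T])
  qed
  have adjoint: "\<exists>S\<in>C. is_adjoint S T" if "T \<in> C" for T
  proof -
    obtain f where f: "\<And>T. T \<in> A \<Longrightarrow> is_adjoint (f T) T"
      using adj by metis
    have "f ` poly_algebra V \<subseteq> poly_algebra V"
    proof (rule image_subsetI)
      fix T assume T: "T \<in> poly_algebra V"
      then obtain S where S: "S \<in> poly_algebra V" "is_adjoint S T"
        using poly_algebra_adjoint[OF V(2)] by blast
      have "is_adjoint (f T) T"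
        using T poly_algebra_subset[OF A V(1)] by (intro f) auto
      then show "f T \<in> poly_algebra V"
        using S is_adjoint_unique by blast
    qed
    moreover have "f ` (subtopology ultraweak_topology A closure_of poly_algebra V)
      \<subseteq> ultraweak_topology closure_of (f ` poly_algebra V)"
      by (intro continuous_map_image_closure_subset continuous_map_ultraweak_adjoint f)
    moreover have "subtopology ultraweak_topology A closure_of poly_algebra V = C"
      using poly_algebra_subset[OF A V(1)] CA
      by (simp add: closure_of_subtopology C_def Int_absorb1)
    ultimately have "f ` C \<subseteq> C"
      using closure_of_mono[of "f ` poly_algebra V" "poly_algebra V" ultraweak_topology]
      by (simp add: C_def)
    then show ?thesis
      using f CA that by blast
  qed
  have "von_neumann_algebra C"
    unfolding von_neumann_algebra_def
    using PC poly_algebra_1[of V] add mult scale adjoint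
    by (auto simp: C_def)
  moreover have "V \<in> C"
    using PC poly_algebra_self by blast
  ultimately show ?thesis
    unfolding generated_vN_def C_def[symmetric] by (intro hull_minimal) auto
qed

text \<open>The \<open>W\<close> in \<open>A\<close> with \<open>\<tau> (Y * W) = 0\<close> form an
  ultraweakly closed set because the trace is normal. By linearity it contains all polynomials in
  \<open>V\<close>, hence their closure and the generated algebra.\<close>

lemma trace_mult_generated_vN_eq_0:
  assumes A: "von_neumann_algebra A" and \<tau>: "normal_faithful_tracial_state A \<tau>"
    and V: "V \<in> A" "selfadjoint V" and Y: "Y \<in> A"
    and zero: "\<And>n. \<tau> (Y * V ^ n) = 0"
    and W: "W \<in> generated_vN V"
  shows "\<tau> (Y * W) = 0"
proof -
  have add: "\<tau> (S + T) = \<tau> S + \<tau> T" if "S \<in> A" "T \<in> A" for S T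
    using \<tau> that by (simp add: normal_faithful_tracial_state_def)
  have scale: "\<tau> (c *\<^sub>C T) = c * \<tau> T" if "T \<in> A" for c T
    using \<tau> that by (simp add: normal_faithful_tracial_state_def)
  have mult: "S * T \<in> A" if "S \<in> A" "T \<in> A" for S T
    using A that by (simp add: von_neumann_algebra_def)
  have scaleA: "c *\<^sub>C T \<in> A" if "T \<in> A" for c T
    using A that by (simp add: von_neumann_algebra_def)
  have \<tau>0: "\<tau> 0 = 0"
    using scale[OF von_neumann_algebra_0[OF A], of 0] by (simp add: scaleC_zero_left)
  have VA: "V ^ i \<in> A" for i
    by (intro von_neumann_algebra_power A V)
  define N where "N = {W \<in> A. \<tau> (Y * W) \<in> {0}}"
  have "poly_algebra V \<subseteq> N"
  proof
    fix W assume W: "W \<in> poly_algebra V"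
    then obtain p where p: "W = poly_oper p V"
      by (auto simp: poly_algebra_def)
    have "\<tau> (\<Sum>i\<in>I. coeff p i *\<^sub>C (Y * V ^ i)) = 0" for I
    proof (induction I rule: infinite_finite_induct)
      case (insert x F)
      then show ?case
        by (simp add: add scale zero von_neumann_algebra_sum A scaleA mult Y VA)
    qed (simp_all add: \<tau>0)
    then have "\<tau> (Y * W) = 0"
      by (simp add: p poly_oper_def sum_distrib_left oper_mult_scaleC_right)
    then show "W \<in> N"
      using W poly_algebra_subset[OF A V(1)] by (auto simp: N_def)
  qed
  \<comment> \<open>Continuity of the trace is available only on \<open>A\<close>, so
    \<open>N\<close> is first closed relative to \<open>A\<close>; closedness of \<open>A\<close>
    then removes the restriction.\<close>
  moreover have "closedin ultraweak_topology N"
  proof (rule closedin_trans_full)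
    obtain Y' where "is_adjoint Y Y'"
      using A Y is_adjoint_sym unfolding von_neumann_algebra_def by blast
    then have "continuous_map (subtopology ultraweak_topology A) (subtopology ultraweak_topology A) (\<lambda>W. Y * W)"
      using Y mult
      by (intro continuous_map_into_subtopology continuous_map_from_subtopology
          continuous_map_ultraweak_mult_left) auto
    moreover have "continuous_map (subtopology ultraweak_topology A) euclidean \<tau>"
      using \<tau> unfolding normal_faithful_tracial_state_def by (elim conjE)
    ultimately have "continuous_map (subtopology ultraweak_topology A) euclidean (\<tau> \<circ> (\<lambda>W. Y * W))"
      by (rule continuous_map_compose)
    then have "closedin (subtopology ultraweak_topology A)
        {W \<in> topspace (subtopology ultraweak_topology A). (\<tau> \<circ> (\<lambda>W. Y * W)) W \<in> {0}}"
      by (rule closedin_continuous_map_preimage) simp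
    then show "closedin (subtopology ultraweak_topology A) N"
      by (simp add: N_def)
    show "closedin ultraweak_topology A"
      using A by (simp add: von_neumann_algebra_def)
  qed
  ultimately have "ultraweak_topology closure_of poly_algebra V \<subseteq> N"
    by (rule closure_of_minimal)
  then show ?thesis
    using W generated_vN_subset_closure[OF A V] by (auto simp: N_def)
qed

section \<open>Formal resolvents\<close>

unbundle fps_syntax
unbundle no vec_syntax

definition coeffs_in :: "'a set \<Rightarrow> 'a::zero fps \<Rightarrow> bool" where
  "coeffs_in B f \<longleftrightarrow> (\<forall>n. f $ n \<in> B)"

text \<open>Three different sets are allowed so that the lemma serves subalgebras as well as
  alternating words, where left factor, right factor and product live in different places.\<close>

lemma coeffs_in_mult:
  fixes f g :: "'a::semiring_0 fps"
  assumes "coeffs_in B f" "coeffs_in C g"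
    and "0 \<in> D" "\<And>x y. x \<in> D \<Longrightarrow> y \<in> D \<Longrightarrow> x + y \<in> D"
    and "\<And>x y. x \<in> B \<Longrightarrow> y \<in> C \<Longrightarrow> x * y \<in> D"
  shows "coeffs_in D (f * g)"
proof -
  have "(\<Sum>i\<in>I. f $ i * g $ (n - i)) \<in> D" for n and I :: "nat set"
    by (induction I rule: infinite_finite_induct) (use assms in \<open>auto simp: coeffs_in_def\<close>)
  then show ?thesis
    by (simp add: coeffs_in_def fps_mult_nth)
qed

text \<open>The embedding of complex series as central elements among the operator series; the
  scalar factors of a resolvent are handled through it.\<close>

definition scalar_fps :: "complex fps \<Rightarrow> 'h::complex_hilbert oper fps" where
  "scalar_fps p = Abs_fps (\<lambda>n. (p $ n) *\<^sub>C 1)"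

lemma scalar_fps_mult_nth:
  "(scalar_fps p * f) $ n = (\<Sum>i=0..n. (p $ i) *\<^sub>C (f $ (n - i)))"
  by (simp add: fps_mult_nth scalar_fps_def oper_mult_scaleC_left)

lemma scalar_fps_commute: "f * scalar_fps p = scalar_fps p * f"
proof (rule fps_ext)
  fix n
  have "(f * scalar_fps p) $ n = (\<Sum>i=0..n. (p $ (n - i)) *\<^sub>C (f $ i))"
    by (simp add: fps_mult_nth scalar_fps_def oper_mult_scaleC_right)
  also have "\<dots> = (\<Sum>i=0..n. (p $ i) *\<^sub>C (f $ (n - i)))"
    by (subst sum.atLeastAtMost_rev) simp
  finally show "(f * scalar_fps p) $ n = (scalar_fps p * f) $ n"
    by (simp add: scalar_fps_mult_nth)
qed

lemma scalar_fps_mult: "scalar_fps (p * q) = scalar_fps p * scalar_fps q"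
  by (rule fps_ext, subst scalar_fps_mult_nth)
    (simp add: scalar_fps_def fps_mult_nth scaleC_scaleC scaleC_sum_left)

lemma scalar_fps_add: "scalar_fps (p + q) = scalar_fps p + scalar_fps q"
  by (rule fps_ext) (simp add: scalar_fps_def scaleC_add_left)

lemma scalar_fps_uminus: "scalar_fps (- p) = - scalar_fps p"
  by (rule fps_ext) (simp add: scalar_fps_def scaleC_minus_left)

lemma scalar_fps_diff: "scalar_fps (p - q) = scalar_fps p - scalar_fps q"
  using scalar_fps_add[of p "- q"] by (simp add: scalar_fps_uminus)

lemma scalar_fps_1: "scalar_fps 1 = 1"
  by (rule fps_ext) (simp add: scalar_fps_def scaleC_one scaleC_zero_left)

text \<open>On the zero space the operators \<open>0\<close> and \<open>1\<close> coincide, so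
  \<open>oper\<close> is no instance of a ring class with distinct zero and one; the unit laws for
  series are checked by hand.\<close>

lemma fps_oper_mult_1_left: "1 * f = (f :: 'h::complex_hilbert oper fps)"
proof (rule fps_ext)
  fix n
  have "(1 * f) $ n = (\<Sum>i=0..n. if i = 0 then f $ n else 0)"
    unfolding fps_mult_nth by (intro sum.cong) auto
  then show "(1 * f) $ n = f $ n" by simp
qed

lemma fps_oper_mult_1_right: "f * 1 = (f :: 'h::complex_hilbert oper fps)"
  using scalar_fps_commute[of f 1] by (simp add: scalar_fps_1 fps_oper_mult_1_left)

text \<open>This stands for the infinite sum of \<open>u ^ n * T ^ n\<close>. If \<open>u\<close>
  has no constant term, \<open>u ^ n\<close> starts at order \<open>n\<close>, so cutting the sum at
  \<open>k\<close> is exact for the coefficient \<open>k\<close>.\<close>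

definition geometric_fps :: "complex fps \<Rightarrow> 'h::complex_hilbert oper \<Rightarrow> 'h oper fps" where
  "geometric_fps u T = Abs_fps (\<lambda>k. \<Sum>n=0..k. ((u ^ n) $ k) *\<^sub>C T ^ n)"

lemma geometric_fps_nth_extend:
  assumes "u $ 0 = 0" "k \<le> N"
  shows "geometric_fps u T $ k = (\<Sum>n=0..N. ((u ^ n) $ k) *\<^sub>C T ^ n)"
  unfolding geometric_fps_def using assms startsby_zero_power_prefix[OF assms(1)]
  by (auto intro!: sum.mono_neutral_left simp: scaleC_zero_left)

lemma geometric_fps_eq:
  assumes u: "u $ 0 = 0"
  shows "geometric_fps u T = 1 + scalar_fps u * (fps_const T * geometric_fps u T)"
proof (rule fps_ext)
  fix k
  have "(scalar_fps u * (fps_const T * geometric_fps u T)) $ k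
      = (\<Sum>i=0..k. (u $ i) *\<^sub>C (T * (\<Sum>n=0..k. ((u ^ n) $ (k - i)) *\<^sub>C T ^ n)))"
    by (simp add: scalar_fps_mult_nth geometric_fps_nth_extend[OF u, of _ k])
  also have "\<dots> = (\<Sum>i=0..k. \<Sum>n=0..k. (u $ i * (u ^ n) $ (k - i)) *\<^sub>C T ^ Suc n)"
    by (simp add: sum_distrib_left oper_mult_scaleC_right scaleC_sum_right scaleC_scaleC)
  also have "\<dots> = (\<Sum>n=0..k. \<Sum>i=0..k. (u $ i * (u ^ n) $ (k - i)) *\<^sub>C T ^ Suc n)"
    by (rule sum.swap)
  also have "\<dots> = (\<Sum>n=0..k. ((u ^ Suc n) $ k) *\<^sub>C T ^ Suc n)"
    by (simp only: power_Suc[of u] fps_mult_nth scaleC_sum_left)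
  finally have 1: "(scalar_fps u * (fps_const T * geometric_fps u T)) $ k
      = (\<Sum>n=0..k. ((u ^ Suc n) $ k) *\<^sub>C T ^ Suc n)" .
  \<comment> \<open>One vanishing summand is added, so that splitting off \<open>n = 0\<close>
    leaves exactly the index range of the shifted sum.\<close>
  have "geometric_fps u T $ k = (\<Sum>n=0..Suc k. ((u ^ n) $ k) *\<^sub>C T ^ n)"
    by (rule geometric_fps_nth_extend[OF u]) simp
  also have "\<dots> = ((1::complex fps) $ k) *\<^sub>C 1 + (\<Sum>n=0..k. ((u ^ Suc n) $ k) *\<^sub>C T ^ Suc n)"
    by (subst sum.atLeast0_atMost_Suc_shift) (simp add: o_def)
  also have "\<dots> = (1 + scalar_fps u * (fps_const T * geometric_fps u T)) $ k"
    unfolding fps_add_nth 1 by (simp add: scaleC_one scaleC_zero_left)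
  finally show "geometric_fps u T $ k = \<dots>" .
qed

lemma geometric_fps_commute: "geometric_fps u T * fps_const T = fps_const T * geometric_fps u T"
  by (rule fps_ext)
    (simp add: geometric_fps_def sum_distrib_left sum_distrib_right oper_mult_scaleC_left
      oper_mult_scaleC_right power_commutes)

lemma coeffs_in_geometric_fps: "coeffs_in (poly_algebra T) (geometric_fps u T)"
  unfolding coeffs_in_def geometric_fps_def
  by (auto intro!: poly_algebra_sum poly_algebra_scaleC poly_algebra_power)

text \<open>The resolvent is \<open>(\<zeta> - w T)\<^sup>-\<^sup>1\<close>, where \<open>w\<close> is the formal variable. With \<open>w = 1 / z\<close> and
  \<open>\<zeta> = 1\<close> this is \<open>z (z - T)\<^sup>-\<^sup>1\<close>.\<close>

definition resolvent :: "complex fps \<Rightarrow> 'h::complex_hilbert oper \<Rightarrow> 'h oper fps" where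
  "resolvent \<zeta> T = scalar_fps (inverse \<zeta>) * geometric_fps (fps_X * inverse \<zeta>) T"

definition shifted :: "complex fps \<Rightarrow> 'h::complex_hilbert oper \<Rightarrow> 'h oper fps" where
  "shifted \<zeta> T = scalar_fps \<zeta> - scalar_fps fps_X * fps_const T"

lemma scalar_fps_inverse:
  assumes "\<zeta> $ 0 \<noteq> 0"
  shows "scalar_fps \<zeta> * (scalar_fps (inverse \<zeta>) * f) = f"
  using inverse_mult_eq_1'[OF assms]
  by (simp add: mult.assoc[symmetric] scalar_fps_mult[symmetric] scalar_fps_1 fps_oper_mult_1_left)

lemma shifted_mult_resolvent:
  assumes "\<zeta> $ 0 \<noteq> 0"
  shows "shifted \<zeta> T * resolvent \<zeta> T = 1"
proof -
  define G where "G = geometric_fps (fps_X * inverse \<zeta>) T"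
  have G: "G = 1 + scalar_fps (fps_X * inverse \<zeta>) * (fps_const T * G)"
    unfolding G_def by (rule geometric_fps_eq) simp
  have "scalar_fps fps_X * fps_const T * (scalar_fps (inverse \<zeta>) * G)
      = scalar_fps (fps_X * inverse \<zeta>) * (fps_const T * G)"
    unfolding scalar_fps_mult using scalar_fps_commute[of "fps_const T" "inverse \<zeta>"]
    by (metis mult.assoc)
  then show ?thesis
    unfolding shifted_def resolvent_def G_def[symmetric] left_diff_distrib
      scalar_fps_inverse[OF assms]
    using G by (metis add_diff_cancel_right')
qed

lemma resolvent_commute: "resolvent \<zeta> T * fps_const T = fps_const T * resolvent \<zeta> T"
  unfolding resolvent_def using geometric_fps_commute scalar_fps_commute by (metis mult.assoc)

lemma resolvent_mult_shifted:
  assumes "\<zeta> $ 0 \<noteq> 0"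
  shows "resolvent \<zeta> T * shifted \<zeta> T = 1"
proof -
  have "resolvent \<zeta> T * (scalar_fps fps_X * fps_const T)
      = scalar_fps fps_X * (resolvent \<zeta> T * fps_const T)"
    by (simp only: mult.assoc[symmetric] scalar_fps_commute)
  then have "resolvent \<zeta> T * shifted \<zeta> T = shifted \<zeta> T * resolvent \<zeta> T"
    by (simp only: shifted_def left_diff_distrib right_diff_distrib resolvent_commute
        scalar_fps_commute mult.assoc)
  then show ?thesis
    by (simp add: shifted_mult_resolvent[OF assms])
qed

lemma coeffs_in_scalar_mult:
  assumes "coeffs_in (poly_algebra T) f"
  shows "coeffs_in (poly_algebra T) (scalar_fps p * f)"
  using assms unfolding coeffs_in_def scalar_fps_mult_nth
  by (auto intro!: poly_algebra_sum poly_algebra_scaleC)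

lemma coeffs_in_resolvent: "coeffs_in (poly_algebra T) (resolvent \<zeta> T)"
  unfolding resolvent_def by (intro coeffs_in_scalar_mult coeffs_in_geometric_fps)

lemma resolvent_nth_0: "\<zeta> $ 0 = 1 \<Longrightarrow> resolvent \<zeta> T $ 0 = 1"
  by (simp add: resolvent_def scalar_fps_def geometric_fps_def scaleC_one)

section \<open>Trace series, moment series and the inverse Cauchy transform\<close>

definition trace_fps :: "('a::zero \<Rightarrow> complex) \<Rightarrow> 'a fps \<Rightarrow> complex fps" where
  "trace_fps \<tau> f = Abs_fps (\<lambda>n. \<tau> (f $ n))"

definition moment_fps :: "('h::complex_hilbert oper \<Rightarrow> complex) \<Rightarrow> 'h oper \<Rightarrow> complex fps" where
  "moment_fps \<tau> T = Abs_fps (\<lambda>n. \<tau> (T ^ n))"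

text \<open>With \<open>\<zeta> = moment_inverse M\<close>, the series \<open>\<zeta> / w\<close> is the inverse of the Cauchy transform
  belonging to the moment series \<open>M\<close>, so that \<open>(\<zeta> - 1) / w\<close> is the R-transform at \<open>w\<close>.\<close>

definition moment_inverse :: "complex fps \<Rightarrow> complex fps" where
  "moment_inverse M = M oo fps_inv (fps_X * M)"

text \<open>In the variable 1/z, \<open>fps_X * M\<close> is the Cauchy transform. So
  \<open>u\<close> is the reciprocal of the functional inverse K of the Cauchy transform, and
  \<open>moment_inverse M\<close> is w K(w) = w / u.\<close>

lemma moment_inverse_properties:
  assumes "M $ 0 = (1::complex)"
  defines "u \<equiv> fps_inv (fps_X * M)"
  shows "u $ 0 = 0" "u $ 1 = 1" "(fps_X * M) oo u = fps_X" "fps_X = u * moment_inverse M"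
    "u oo (fps_X * M) = fps_X" "moment_inverse M $ 0 = 1"
proof -
  show u0: "u $ 0 = 0" by (simp add: u_def fps_inv_def)
  show M1: "moment_inverse M $ 0 = 1" using assms by (simp add: moment_inverse_def)
  show inv: "(fps_X * M) oo u = fps_X"
    unfolding u_def by (rule fps_inv_right) (use assms(1) in auto)
  show *: "fps_X = u * moment_inverse M"
    unfolding moment_inverse_def u_def[symmetric]
    using inv u0 by (simp add: fps_compose_mult_distrib)
  show "u $ 1 = 1"
    using arg_cong[OF *, of "\<lambda>f. f $ 1"] u0 M1 by simp
  show "u oo (fps_X * M) = fps_X"
    unfolding u_def by (rule fps_inv) (use assms(1) in auto)
qed

text \<open>With \<open>v = fps_X * inverse \<zeta>\<close>, the fixed point equation says that
  \<open>fps_X * M\<close> composed with \<open>v\<close> is \<open>fps_X\<close>, and a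
  compositional right inverse must agree with the two-sided one.\<close>

lemma moment_inverse_unique:
  assumes M: "M $ 0 = (1::complex)" and \<zeta>: "\<zeta> $ 0 = 1"
  shows "M oo (fps_X * inverse \<zeta>) = \<zeta> \<longleftrightarrow> \<zeta> = moment_inverse M"
proof
  define u where "u = fps_inv (fps_X * M)"
  note aux = moment_inverse_properties[OF M, folded u_def]
  have div: "fps_X * inverse (moment_inverse M) = u"
    using inverse_mult_eq_1'[of "moment_inverse M"] aux(4,6)
    by (metis mult.assoc mult.right_neutral zero_neq_one)
  show "M oo (fps_X * inverse \<zeta>) = \<zeta>" if "\<zeta> = moment_inverse M"
    unfolding that div by (simp add: moment_inverse_def u_def)
  assume *: "M oo (fps_X * inverse \<zeta>) = \<zeta>"
  define v where "v = fps_X * inverse \<zeta>"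
  have v0: "v $ 0 = 0" by (simp add: v_def)
  have "(fps_X * M) oo v = v * \<zeta>"
    using * v0 unfolding v_def[symmetric] by (simp add: fps_compose_mult_distrib)
  also have "\<dots> = fps_X"
    using \<zeta> inverse_mult_eq_1[of \<zeta>] by (simp add: v_def mult.assoc)
  finally have "u oo ((fps_X * M) oo v) = u"
    by simp
  moreover have "u oo ((fps_X * M) oo v) = u oo (fps_X * M) oo v"
    by (rule fps_compose_assoc[OF v0]) simp
  ultimately have "v = u"
    using aux(5) v0 by simp
  then show "\<zeta> = moment_inverse M"
    using * by (simp add: moment_inverse_def u_def v_def)
qed

section \<open>The trace on series with coefficients in the algebra\<close>

locale tracial_algebra =
  fixes A :: "'h::complex_hilbert oper set" and \<tau> :: "'h oper \<Rightarrow> complex"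
  assumes vN: "von_neumann_algebra A" and state: "normal_faithful_tracial_state A \<tau>"
begin

lemma mem_add: "S \<in> A \<Longrightarrow> T \<in> A \<Longrightarrow> S + T \<in> A"
  and mem_mult: "S \<in> A \<Longrightarrow> T \<in> A \<Longrightarrow> S * T \<in> A"
  and mem_scaleC: "T \<in> A \<Longrightarrow> c *\<^sub>C T \<in> A"
  and mem_1: "1 \<in> A"
  using vN by (auto simp: von_neumann_algebra_def)

lemmas mem_0 = von_neumann_algebra_0[OF vN]
lemmas mem_sum = von_neumann_algebra_sum[OF vN]
lemmas mem_power = von_neumann_algebra_power[OF vN]

lemma mem_uminus: "T \<in> A \<Longrightarrow> - T \<in> A"
  using mem_scaleC[of T "-1"] by (simp add: scaleC_minus_one)

lemma mem_diff: "S \<in> A \<Longrightarrow> T \<in> A \<Longrightarrow> S - T \<in> A"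
  using mem_add[of S "- T"] mem_uminus[of T] by simp

lemma trace_add: "S \<in> A \<Longrightarrow> T \<in> A \<Longrightarrow> \<tau> (S + T) = \<tau> S + \<tau> T"
  and trace_scaleC: "T \<in> A \<Longrightarrow> \<tau> (c *\<^sub>C T) = c * \<tau> T"
  and trace_1: "\<tau> 1 = 1"
  and trace_commute: "S \<in> A \<Longrightarrow> T \<in> A \<Longrightarrow> \<tau> (S * T) = \<tau> (T * S)"
  using state by (simp_all add: normal_faithful_tracial_state_def)

lemma trace_0: "\<tau> 0 = 0"
  using trace_scaleC[OF mem_0, of 0] by (simp add: scaleC_zero_left)

lemma trace_diff: "S \<in> A \<Longrightarrow> T \<in> A \<Longrightarrow> \<tau> (S - T) = \<tau> S - \<tau> T"
  using trace_add[of S "- T"] trace_scaleC[of T "-1"] mem_uminus[of T]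
  by (simp add: scaleC_minus_one)

lemma trace_sum: "(\<And>i. i \<in> I \<Longrightarrow> f i \<in> A) \<Longrightarrow> \<tau> (sum f I) = (\<Sum>i\<in>I. \<tau> (f i))"
  by (induction I rule: infinite_finite_induct) (auto simp: trace_0 trace_add mem_sum)

lemma trace_scaleR: "T \<in> A \<Longrightarrow> \<tau> (r *\<^sub>R T) = of_real r * \<tau> T"
  by (simp add: scaleR_oper_def trace_scaleC)

lemma mem_scaleR: "T \<in> A \<Longrightarrow> r *\<^sub>R T \<in> A"
  by (simp add: scaleR_oper_def mem_scaleC)

lemma coeffs_in_simps:
  "coeffs_in A f \<Longrightarrow> coeffs_in A g \<Longrightarrow> coeffs_in A (f + g)"
  "coeffs_in A f \<Longrightarrow> coeffs_in A g \<Longrightarrow> coeffs_in A (f - g)"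
  "coeffs_in A f \<Longrightarrow> coeffs_in A g \<Longrightarrow> coeffs_in A (f * g)"
  "coeffs_in A (scalar_fps p)" "coeffs_in A 1"
  "T \<in> A \<Longrightarrow> coeffs_in A (fps_const T)"
proof -
  show "coeffs_in A f \<Longrightarrow> coeffs_in A g \<Longrightarrow> coeffs_in A (f * g)"
    by (rule coeffs_in_mult) (auto intro: mem_0 mem_add mem_mult)
qed (auto simp: coeffs_in_def mem_add mem_diff scalar_fps_def mem_scaleC mem_1 mem_0)

lemma coeffs_in_A_poly_algebra:
  "T \<in> A \<Longrightarrow> coeffs_in (poly_algebra T) f \<Longrightarrow> coeffs_in A f"
  using poly_algebra_subset[OF vN] by (auto simp: coeffs_in_def)

lemma trace_fps_add: "coeffs_in A f \<Longrightarrow> coeffs_in A g \<Longrightarrow>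
    trace_fps \<tau> (f + g) = trace_fps \<tau> f + trace_fps \<tau> g"
  by (rule fps_ext) (simp add: trace_fps_def coeffs_in_def trace_add)

lemma trace_fps_diff: "coeffs_in A f \<Longrightarrow> coeffs_in A g \<Longrightarrow>
    trace_fps \<tau> (f - g) = trace_fps \<tau> f - trace_fps \<tau> g"
  by (rule fps_ext) (simp add: trace_fps_def coeffs_in_def trace_diff)

lemma trace_fps_scalar: "coeffs_in A f \<Longrightarrow>
    trace_fps \<tau> (scalar_fps p * f) = p * trace_fps \<tau> f"
  by (rule fps_ext, simp only: trace_fps_def fps_nth_Abs_fps scalar_fps_mult_nth)
    (simp add: coeffs_in_def trace_scaleC mem_scaleC trace_sum fps_mult_nth)

lemma trace_fps_commute:
  assumes "coeffs_in A f" "coeffs_in A g"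
  shows "trace_fps \<tau> (f * g) = trace_fps \<tau> (g * f)"
proof (rule fps_ext)
  fix n
  have "\<tau> ((f * g) $ n) = (\<Sum>i=0..n. \<tau> (g $ (n - i) * f $ i))"
    using assms by (simp add: fps_mult_nth trace_sum coeffs_in_def mem_mult trace_commute)
  also have "\<dots> = (\<Sum>i=0..n. \<tau> (g $ i * f $ (n - i)))"
    by (subst sum.atLeastAtMost_rev) simp
  also have "\<dots> = \<tau> ((g * f) $ n)"
    using assms by (simp add: fps_mult_nth trace_sum coeffs_in_def mem_mult)
  finally show "trace_fps \<tau> (f * g) $ n = trace_fps \<tau> (g * f) $ n"
    by (simp add: trace_fps_def)
qed

lemma trace_fps_1: "trace_fps \<tau> 1 = 1"
  by (rule fps_ext) (simp add: trace_fps_def trace_1 trace_0)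

lemma trace_fps_scalar_1: "trace_fps \<tau> (scalar_fps p) = p"
  using trace_fps_scalar[OF coeffs_in_simps(5), of p] by (simp add: fps_oper_mult_1_right trace_fps_1)

lemma trace_fps_const: "trace_fps \<tau> (fps_const T) = fps_const (\<tau> T)"
  by (rule fps_ext) (simp add: trace_fps_def trace_0)

lemma trace_fps_geometric:
  assumes "Y \<in> A" "T \<in> A"
  shows "trace_fps \<tau> (fps_const Y * geometric_fps u T) = Abs_fps (\<lambda>n. \<tau> (Y * T ^ n)) oo u"
  by (rule fps_ext) (simp add: trace_fps_def geometric_fps_def fps_compose_nth sum_distrib_left
      oper_mult_scaleC_right trace_sum trace_scaleC mem_scaleC mem_mult mem_power assms mult.commute)

lemma coeffs_in_A_geometric: "T \<in> A \<Longrightarrow> coeffs_in A (geometric_fps u T)"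
  using coeffs_in_A_poly_algebra coeffs_in_geometric_fps by blast

lemma coeffs_in_A_resolvent: "T \<in> A \<Longrightarrow> coeffs_in A (resolvent \<zeta> T)"
  using coeffs_in_A_poly_algebra coeffs_in_resolvent by blast

lemma coeffs_in_A_shifted: "T \<in> A \<Longrightarrow> coeffs_in A (shifted \<zeta> T)"
  unfolding shifted_def by (intro coeffs_in_simps)

lemma trace_fps_resolvent:
  assumes "Y \<in> A" "T \<in> A"
  shows "trace_fps \<tau> (fps_const Y * resolvent \<zeta> T)
    = inverse \<zeta> * (Abs_fps (\<lambda>n. \<tau> (Y * T ^ n)) oo (fps_X * inverse \<zeta>))"
proof -
  have "fps_const Y * resolvent \<zeta> T
      = scalar_fps (inverse \<zeta>) * (fps_const Y * geometric_fps (fps_X * inverse \<zeta>) T)"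
    unfolding resolvent_def using scalar_fps_commute by (metis mult.assoc)
  then show ?thesis
    using assms
    by (simp add: trace_fps_scalar coeffs_in_simps coeffs_in_A_geometric trace_fps_geometric)
qed

text \<open>Up to the nonzero factor \<open>inverse \<zeta>\<close>, the trace is the generating
  series of \<open>\<tau> (Y * T ^ n)\<close> composed with a nonzero series without constant term,
  and such a composition is injective. Infinitely many moment conditions thus become one identity of
  series.\<close>

lemma trace_fps_resolvent_eq_0_iff:
  assumes "Y \<in> A" "T \<in> A" "\<zeta> $ 0 = 1"
  shows "trace_fps \<tau> (fps_const Y * resolvent \<zeta> T) = 0 \<longleftrightarrow> (\<forall>n. \<tau> (Y * T ^ n) = 0)"
proof -
  have "fps_X * inverse \<zeta> \<noteq> 0" "inverse \<zeta> \<noteq> 0"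
    using assms(3) by (auto simp: fps_inverse_eq_0_iff)
  then show ?thesis
    unfolding trace_fps_resolvent[OF assms(1,2)]
    by (simp add: fps_compose_eq_0_iff fps_eq_iff[of "Abs_fps _"])
qed

lemma moment_fps_nth_0: "moment_fps \<tau> T $ 0 = 1"
  by (simp add: moment_fps_def trace_1)

text \<open>The trace is \<open>M\<close> composed with \<open>fps_X * inverse \<zeta>\<close>,
  divided by \<open>\<zeta>\<close>; its being 1 is the fixed point equation of
  \<open>moment_inverse_unique\<close>. To find an R-transform it therefore suffices to find a
  \<open>\<zeta>\<close> whose resolvent has trace 1.\<close>

lemma trace_fps_resolvent_eq_1_iff:
  assumes "T \<in> A" "\<zeta> $ 0 = 1"
  shows "trace_fps \<tau> (resolvent \<zeta> T) = 1 \<longleftrightarrow> \<zeta> = moment_inverse (moment_fps \<tau> T)"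
proof -
  have "trace_fps \<tau> (resolvent \<zeta> T) = inverse \<zeta> * (moment_fps \<tau> T oo (fps_X * inverse \<zeta>))"
    using trace_fps_resolvent[OF mem_1 assms(1), of \<zeta>]
    by (simp add: fps_oper_mult_1_left moment_fps_def)
  moreover have "inverse \<zeta> * f = 1 \<longleftrightarrow> f = \<zeta>" for f
    using assms(2) inverse_mult_eq_1[of \<zeta>] inverse_mult_eq_1'[of \<zeta>]
    by (metis mult.assoc mult.commute mult_1 zero_neq_one)
  ultimately show ?thesis
    using moment_inverse_unique[OF moment_fps_nth_0 assms(2)] by simp
qed

end

section \<open>Freeness\<close>

lemma scalar_fps_left_commute: "x * (scalar_fps p * y) = scalar_fps p * (x * y)"
  by (simp only: mult.assoc[symmetric] scalar_fps_commute)

text \<open>Only the index \<open>i\<close> of the leftmost letter is recorded, since that is all a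
  further multiplication from the left has to know. Closure under sums is built in because
  coefficients of product series are sums of words of different lengths.\<close>

inductive alternating_span :: "('i \<Rightarrow> 'a::ring set) \<Rightarrow> 'i \<Rightarrow> 'a \<Rightarrow> bool" for P where
  zero: "alternating_span P i 0"
| single: "x \<in> P i \<Longrightarrow> alternating_span P i x"
| cons: "x \<in> P i \<Longrightarrow> i \<noteq> j \<Longrightarrow> alternating_span P j y \<Longrightarrow> alternating_span P i (x * y)"
| add: "alternating_span P i x \<Longrightarrow> alternating_span P i y \<Longrightarrow> alternating_span P i (x + y)"

lemma alternating_span_sum:
  "(\<And>k. k \<in> K \<Longrightarrow> alternating_span P i (f k)) \<Longrightarrow> alternating_span P i (sum f K)"
  by (induction K rule: infinite_finite_induct) (auto intro: alternating_span.intros)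

lemma free_subalgebras_prod_list:
  assumes "free_subalgebras \<tau> I B" "ws \<noteq> []"
    and ws: "\<And>w. w \<in> set ws \<Longrightarrow> fst w \<in> I \<and> snd w \<in> B (fst w) \<and> \<tau> (snd w) = 0"
    and alt: "successively (\<lambda>v w. fst v \<noteq> fst w) ws"
  shows "\<tau> (prod_list (map snd ws)) = 0"
proof -
  have "\<tau> (prod_list (map (\<lambda>j. snd (ws ! j)) [0..<length ws])) = 0"
    using assms(1) unfolding free_subalgebras_def
  proof (elim allE[of _ "length ws"] allE[of _ "\<lambda>j. fst (ws ! j)"]
      allE[of _ "\<lambda>j. snd (ws ! j)"] impE)
    show "1 \<le> length ws" using assms(2) by (cases ws) auto
    show "\<forall>j<length ws. fst (ws ! j) \<in> I \<and> snd (ws ! j) \<in> B (fst (ws ! j)) \<and> \<tau> (snd (ws ! j)) = 0"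
      using ws by auto
    show "\<forall>j. Suc j < length ws \<longrightarrow> fst (ws ! j) \<noteq> fst (ws ! Suc j)"
      using alt by (simp add: successively_conv_nth)
  qed
  moreover have "map (\<lambda>j. snd (ws ! j)) [0..<length ws] = map snd ws"
    by (rule nth_equalityI) auto
  ultimately show ?thesis by simp
qed

context tracial_algebra
begin

lemma alternating_span_free:
  assumes free: "free_subalgebras \<tau> I B" and sub: "\<And>i. i \<in> I \<Longrightarrow> B i \<subseteq> A"
    and P: "\<And>i. P i \<subseteq> {x \<in> B i. i \<in> I \<and> \<tau> x = 0}"
    and z: "alternating_span P i z"
  shows "z \<in> A" "\<tau> z = 0"
proof -
  have PA: "x \<in> A" if "x \<in> P i" for x i
    using that P sub by blast
  \<comment> \<open>The claim is strengthened by an arbitrary alternating prefix \<open>ws\<close>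
    not ending in \<open>i\<close>: in the case \<open>cons\<close> the letter \<open>x\<close>
    moves to the end of the prefix and the hypothesis for \<open>y\<close> applies.\<close>
  have "z \<in> A \<and> (\<forall>ws. (\<forall>w\<in>set ws. snd w \<in> P (fst w)) \<longrightarrow>
      successively (\<lambda>v w. fst v \<noteq> fst w) ws \<longrightarrow> (ws \<noteq> [] \<longrightarrow> fst (last ws) \<noteq> i) \<longrightarrow>
      \<tau> (prod_list (map snd ws) * z) = 0)"
    using z
  proof (induction rule: alternating_span.induct)
    case (zero i)
    then show ?case by (simp add: mem_0 trace_0)
  next
    case (single x i)
    have "\<tau> (prod_list (map snd ws) * x) = 0"
      if "\<forall>w\<in>set ws. snd w \<in> P (fst w)" "successively (\<lambda>v w. fst v \<noteq> fst w) ws"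
        "ws \<noteq> [] \<longrightarrow> fst (last ws) \<noteq> i" for ws
      using free_subalgebras_prod_list[OF free, of "ws @ [(i, x)]"] that single P
      by (fastforce simp: successively_append_iff)
    then show ?case using single PA by blast
  next
    case (cons x i j y)
    have "\<tau> (prod_list (map snd ws) * (x * y)) = 0"
      if "\<forall>w\<in>set ws. snd w \<in> P (fst w)" "successively (\<lambda>v w. fst v \<noteq> fst w) ws"
        "ws \<noteq> [] \<longrightarrow> fst (last ws) \<noteq> i" for ws
    proof -
      have "\<tau> (prod_list (map snd (ws @ [(i, x)])) * y) = 0"
        using that cons.hyps by (intro cons.IH[THEN conjunct2, rule_format])
          (auto simp: successively_append_iff)
      then show ?thesis by (simp add: mult.assoc)
    qed
    then show ?case using cons PA by (blast intro: mem_mult)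
  next
    case (add i x y)
    have "prod_list (map snd ws) \<in> A" if "\<forall>w\<in>set ws. snd w \<in> P (fst w)" for ws :: "(_ \<times> 'h oper) list"
      using that by (induction ws) (auto intro: mem_1 mem_mult PA)
    then show ?case
      using add by (auto simp: distrib_left trace_add mem_mult mem_add)
  qed
  from this[THEN conjunct1] this[THEN conjunct2, rule_format, of "[]"]
  show "z \<in> A" "\<tau> z = 0" by auto
qed

end

locale free_pair = tracial_algebra A \<tau> for A :: "'h::complex_hilbert oper set" and \<tau> +
  fixes U V :: "'h oper"
  assumes U: "U \<in> A" and V: "V \<in> A"
    and free: "free_elements \<tau> {..<2} (\<lambda>i::nat. if i = 0 then U else V)"
begin

definition alg :: "nat \<Rightarrow> 'h oper set" where
  "alg i = poly_algebra (if i = 0 then U else V)"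

definition centered :: "nat \<Rightarrow> 'h oper set" where
  "centered i = {x \<in> alg i. i < 2 \<and> \<tau> x = 0}"

lemma alg_subset: "alg i \<subseteq> A"
  unfolding alg_def using poly_algebra_subset[OF vN] U V by simp

lemma alternating_centered:
  assumes "alternating_span centered i z"
  shows "z \<in> A" "\<tau> z = 0"
proof -
  have "free_subalgebras \<tau> {..<2} alg"
    using free unfolding free_elements_def alg_def poly_algebra_def .
  then show "z \<in> A" "\<tau> z = 0"
    using alternating_span_free[OF _ _ _ assms] alg_subset
    by (auto simp: centered_def)
qed

lemma alg_decompose:
  assumes "x \<in> alg i" "i < 2"
  shows "x - \<tau> x *\<^sub>C 1 \<in> centered i"
proof -
  have "x + (- \<tau> x) *\<^sub>C 1 \<in> alg i"
    using assms unfolding alg_def by (intro poly_algebra_add poly_algebra_scaleC poly_algebra_1)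
  moreover have "\<tau> (x + (- \<tau> x) *\<^sub>C 1) = 0"
    using assms alg_subset[of i] by (subst trace_add) (auto simp: mem_scaleC mem_1 trace_scaleC trace_1)
  ultimately show ?thesis
    using assms(2) by (simp add: centered_def scaleC_minus_left)
qed

text \<open>Splitting \<open>x\<close> into a centered part and a multiple of 1 leaves two
  alternating expressions, both of trace 0. The gain is that the left factor need not be
  centered.\<close>

lemma trace_alg_mult_alternating:
  assumes x: "x \<in> alg i" "i < 2" and y: "alternating_span centered j y" "i \<noteq> j"
  shows "\<tau> (x * y) = 0"
proof -
  define x' where "x' = x - \<tau> x *\<^sub>C 1"
  have x': "alternating_span centered i (x' * y)"
    unfolding x'_def by (rule alternating_span.cons[OF alg_decompose[OF x] y(2,1)])
  have "x * y = x' * y + \<tau> x *\<^sub>C y"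
    by (simp add: x'_def left_diff_distrib oper_mult_scaleC_left)
  then show ?thesis
    using alternating_centered[OF x'] alternating_centered[OF y(1)]
    by (simp add: trace_add mem_scaleC trace_scaleC)
qed

lemma trace_fps_alg_mult_alternating:
  assumes "coeffs_in (alg i) f" "i < 2" "coeffs_in {y. alternating_span centered j y} g" "i \<noteq> j"
  shows "trace_fps \<tau> (f * g) = 0"
proof (rule fps_ext)
  fix n
  have "f $ k * g $ l \<in> A" for k l
  proof (rule mem_mult)
    show "f $ k \<in> A" using assms(1) alg_subset[of i] by (auto simp: coeffs_in_def)
    show "g $ l \<in> A"
      by (rule alternating_centered(1)[of j]) (use assms(3) in \<open>simp add: coeffs_in_def\<close>)
  qed
  then show "trace_fps \<tau> (f * g) $ n = 0 $ n"
    using assms by (auto simp: trace_fps_def fps_mult_nth trace_sum coeffs_in_def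
        intro!: sum.neutral trace_alg_mult_alternating[where i = i and j = j])
qed

lemma coeffs_in_centered_mult:
  assumes "coeffs_in (centered i) f" "coeffs_in {y. alternating_span centered j y} g" "i \<noteq> j"
  shows "coeffs_in {y. alternating_span centered i y} (f * g)"
  by (rule coeffs_in_mult[OF assms(1,2)])
    (use assms(3) in \<open>auto intro: alternating_span.intros\<close>)

end

text \<open>\<open>u\<close> and \<open>v\<close> are the inverse Cauchy transforms of \<open>U\<close> and \<open>V\<close> (up to the factor \<open>w\<close>), and
  \<open>u + v - 1\<close> turns out to be that of \<open>U + V\<close>.\<close>

locale free_resolvent = free_pair A \<tau> U V for A :: "'h::complex_hilbert oper set" and \<tau> U V +
  fixes u v :: "complex fps"
  defines "u \<equiv> moment_inverse (moment_fps \<tau> U)" and "v \<equiv> moment_inverse (moment_fps \<tau> V)"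
begin

definition "\<zeta> = u + v - 1"
definition "R = resolvent \<zeta> (U + V)"
definition "a = resolvent u U - 1"
definition "b = resolvent v V - 1"
text \<open>By \<open>R = (1 + b) (1 - a b)^-1 (1 + a)\<close>, the outer factors
  \<open>shifted u U\<close>, inverse to \<open>1 + a\<close>, reduce this to
  \<open>b (1 - a b)^-1 = b + b a b + ...\<close>: the sum of all alternating words that begin and
  end with \<open>b\<close>.\<close>

definition "d = shifted u U * R * shifted u U - shifted u U"

abbreviation "AU \<equiv> shifted u U"
abbreviation "BV \<equiv> shifted v V"
abbreviation w :: "'h oper fps" where "w \<equiv> scalar_fps fps_X"
abbreviation "tr \<equiv> trace_fps \<tau>"

lemma nth_0: "u $ 0 = 1" "v $ 0 = 1" "\<zeta> $ 0 = 1"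
  using moment_inverse_properties(6)[OF moment_fps_nth_0] by (simp_all add: u_def v_def \<zeta>_def)

lemma inverses:
  "AU * (1 + a) = 1" "(1 + a) * AU = 1" "BV * (1 + b) = 1" "(1 + b) * BV = 1"
  "shifted \<zeta> (U + V) * R = 1" "R * shifted \<zeta> (U + V) = 1"
  using nth_0 by (simp_all add: a_def b_def R_def shifted_mult_resolvent resolvent_mult_shifted)

lemma shifted_add: "shifted \<zeta> (U + V) = AU + BV - 1"
proof -
  have "fps_const (U + V) = fps_const U + fps_const V"
    by simp
  then show ?thesis
    unfolding shifted_def \<zeta>_def scalar_fps_diff scalar_fps_add scalar_fps_1
    by (simp only: distrib_left) (simp add: algebra_simps)
qed

text \<open>This recursion takes the place of summing the geometric series for \<open>d\<close>. It
  results from eliminating \<open>R * AU\<close> between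
  \<open>(1 + b) * d = (1 + b) * (R * AU) - R * AU\<close> and
  \<open>R * AU = 1 + (1 + a) * d\<close>.\<close>

lemma d_eq: "d = b + b * (a * d)"
proof -
  have "(AU + BV - 1) * R * AU = AU"
    using inverses(5) by (simp add: shifted_add fps_oper_mult_1_left)
  then have 1: "d = R * AU - BV * (R * AU)"
    by (simp add: d_def algebra_simps fps_oper_mult_1_left)
  have "(1 + b) * d = (1 + b) * (R * AU) - (1 + b) * BV * (R * AU)"
    unfolding 1 by (simp only: right_diff_distrib mult.assoc)
  then have 2: "(1 + b) * d = (1 + b) * (R * AU) - R * AU"
    by (simp only: inverses fps_oper_mult_1_left)
  have "(1 + a) * d = (1 + a) * AU * (R * AU) - (1 + a) * AU"
    unfolding d_def by (simp only: right_diff_distrib mult.assoc)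
  then have "R * AU = 1 + (1 + a) * d"
    by (simp add: inverses fps_oper_mult_1_left)
  with 2 have "(1 + b) * d = (1 + b) * (1 + (1 + a) * d) - (1 + (1 + a) * d)"
    by simp
  then show ?thesis
    by (simp add: distrib_right distrib_left fps_oper_mult_1_left fps_oper_mult_1_right mult.assoc)
qed

lemma coeffs_in_alg:
  "coeffs_in (alg 0) (1 + a)" "coeffs_in (alg (Suc 0)) (1 + b)"
  using coeffs_in_resolvent by (auto simp: alg_def a_def b_def)

lemma trace_resolvents: "tr (1 + a) = 1" "tr (1 + b) = 1"
  using trace_fps_resolvent_eq_1_iff[OF U nth_0(1)] trace_fps_resolvent_eq_1_iff[OF V nth_0(2)]
  by (simp_all add: a_def b_def u_def v_def)

lemma coeffs_in_centered:
  "coeffs_in (centered 0) a" "coeffs_in (centered (Suc 0)) b"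
proof -
  have *: "coeffs_in (centered i) f" if "coeffs_in (alg i) (1 + f)" "tr (1 + f) = 1" "i < 2" for i f
    unfolding coeffs_in_def centered_def
  proof safe
    fix n
    have "(1 + f) $ n + (- (1 $ n)) *\<^sub>C 1 \<in> alg i"
      using that(1) unfolding alg_def coeffs_in_def
      by (intro poly_algebra_add poly_algebra_scaleC poly_algebra_1) auto
    moreover have "(1 + f) $ n + (- (1 $ n)) *\<^sub>C 1 = f $ n"
      by (simp add: scaleC_minus_one scaleC_zero_left)
    ultimately show alg: "f $ n \<in> alg i" by (simp only:)
    have "\<tau> ((1 + f) $ n) = 1 $ n"
      using that(2) by (simp add: trace_fps_def fps_eq_iff)
    moreover have "\<tau> ((1 + f) $ n) = \<tau> (1 $ n) + \<tau> (f $ n)"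
      using alg alg_subset[of i] unfolding fps_add_nth by (subst trace_add) (auto simp: mem_0 mem_1)
    ultimately show "\<tau> (f $ n) = 0"
      by (auto simp: trace_1 trace_0 split: if_splits)
  qed (use that in simp)
  show "coeffs_in (centered 0) a" "coeffs_in (centered (Suc 0)) b"
    by (intro * coeffs_in_alg trace_resolvents; simp)+
qed

text \<open>Strong induction through \<open>d_eq\<close>: since \<open>b\<close> has no constant
  term, the coefficient \<open>n\<close> of \<open>b * (a * d)\<close> involves only earlier
  coefficients of \<open>d\<close>.\<close>

lemma coeffs_in_d: "coeffs_in {y. alternating_span centered (Suc 0) y} d"
proof -
  have b0: "b $ 0 = 0" by (simp add: b_def resolvent_nth_0 nth_0)
  have "alternating_span centered (Suc 0) (d $ n)" for n
  proof (induction n rule: less_induct)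
    case (less n)
    have "alternating_span centered (Suc 0) (b $ i * (a * d) $ (n - i))" if "i \<le> n" for i
    proof (cases "i = 0")
      case True
      then show ?thesis by (simp add: b0 alternating_span.zero)
    next
      case False
      then have "alternating_span centered 0 ((a * d) $ (n - i))"
        unfolding fps_mult_nth using coeffs_in_centered(1) \<open>i \<le> n\<close>
        by (intro alternating_span_sum alternating_span.cons[of _ _ _ "Suc 0"] less.IH)
          (auto simp: coeffs_in_def)
      then show ?thesis
        using coeffs_in_centered(2)
        by (intro alternating_span.cons[of _ _ _ 0]) (auto simp: coeffs_in_def)
    qed
    moreover have "alternating_span centered (Suc 0) (b $ n)"
      using coeffs_in_centered(2) by (intro alternating_span.single) (auto simp: coeffs_in_def)
    ultimately have "alternating_span centered (Suc 0) (b $ n + (\<Sum>i=0..n. b $ i * (a * d) $ (n - i)))"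
      by (intro alternating_span.add alternating_span_sum) auto
    then show ?case
      by (subst d_eq) (simp add: fps_mult_nth[of b])
  qed
  then show ?thesis by (simp add: coeffs_in_def)
qed

lemma coeffs_in_A:
  "coeffs_in A AU" "coeffs_in A BV" "coeffs_in A R" "coeffs_in A a" "coeffs_in A b" "coeffs_in A d"
  "coeffs_in A (fps_const U)" "coeffs_in A (fps_const V)" "coeffs_in A (fps_const (U + V))"
  by (auto simp: R_def a_def b_def d_def U V mem_add
      intro!: coeffs_in_simps coeffs_in_A_shifted coeffs_in_A_resolvent)

lemmas coeffs_in_A_rules = coeffs_in_A coeffs_in_simps

lemma trace_alg_d: "coeffs_in (alg 0) f \<Longrightarrow> tr (f * d) = 0"
  using trace_fps_alg_mult_alternating[OF _ _ coeffs_in_d] by simp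

text \<open>\<open>R = (1 + a) + (1 + a) * d * (1 + a)\<close>. By cyclicity the second term has the
  trace of \<open>(1 + a) * (1 + a) * d\<close>, an element of the algebra of \<open>U\<close> times
  words starting in that of \<open>V\<close>, so it vanishes.\<close>

lemma trace_R: "tr R = 1"
proof -
  have "(1 + a) * (d * (1 + a)) = (1 + a) * AU * R * (AU * (1 + a)) - (1 + a) * AU * (1 + a)"
    unfolding d_def by (simp only: right_diff_distrib left_diff_distrib mult.assoc)
  then have R: "R = (1 + a) + (1 + a) * d * (1 + a)"
    by (simp add: inverses fps_oper_mult_1_left fps_oper_mult_1_right mult.assoc)
  have "tr ((1 + a) * d * (1 + a)) = tr ((1 + a) * ((1 + a) * d))"
    by (intro trace_fps_commute coeffs_in_A_rules)
  also have "\<dots> = tr ((1 + a) * (1 + a) * d)"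
    by (simp only: mult.assoc)
  also have "\<dots> = 0"
    by (intro trace_alg_d coeffs_in_mult[OF coeffs_in_alg(1) coeffs_in_alg(1)])
      (auto simp: alg_def intro: poly_algebra_0 poly_algebra_add poly_algebra_mult)
  finally show ?thesis
    unfolding R using trace_resolvents
    by (subst trace_fps_add) (auto intro!: coeffs_in_A_rules)
qed

text \<open>Additivity of the R-transform: \<open>trace_R\<close> shows that the guessed
  \<open>\<zeta>\<close> has the property characterizing the inverse transform of
  \<open>U + V\<close>.\<close>

lemma moment_inverse_add: "moment_inverse (moment_fps \<tau> (U + V)) = u + v - 1"
  using trace_R trace_fps_resolvent_eq_1_iff[OF mem_add[OF U V] nth_0(3)]
  unfolding R_def \<zeta>_def by simp

text \<open>\<open>AU * R = 1 + d * (1 + a)\<close>, and by cyclicity the second term has the trace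
  of \<open>(1 + a) * d\<close>, which is 0 because the words in \<open>d\<close> start in the
  algebra of \<open>V\<close>.\<close>

lemma trace_U_shifted_R: "tr (AU * R) = 1"
proof -
  have "d * (1 + a) = AU * R * (AU * (1 + a)) - AU * (1 + a)"
    unfolding d_def by (simp only: left_diff_distrib mult.assoc)
  then have "AU * R = 1 + d * (1 + a)"
    by (simp add: inverses fps_oper_mult_1_right)
  moreover have "tr (d * (1 + a)) = tr ((1 + a) * d)"
    by (intro trace_fps_commute coeffs_in_A_rules)
  ultimately show ?thesis
    using trace_alg_d[OF coeffs_in_alg(1)]
    by (simp add: trace_fps_add trace_fps_1 coeffs_in_A_rules)
qed


section \<open>Traces of products with the resolvent of the sum\<close>

lemma X_mult_U: "w * fps_const U = scalar_fps u - AU"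
  and X_mult_V: "w * fps_const V = scalar_fps v - BV"
  and X_mult_sum: "w * fps_const (U + V) = scalar_fps \<zeta> - shifted \<zeta> (U + V)"
  by (simp_all add: shifted_def)

text \<open>Each application trades one factor \<open>U + V\<close> next to \<open>R\<close>,
  together with one power of w, for the scalar \<open>\<zeta>\<close> and a term without
  \<open>R\<close>; hence the powers of \<open>fps_X\<close> in the trace formulas below.\<close>

lemma X_S_R: "w * (fps_const (U + V) * R) = scalar_fps \<zeta> * R - 1"
  using inverses(5) by (simp add: mult.assoc[symmetric] X_mult_sum left_diff_distrib)

lemma X_R_S: "w * (R * fps_const (U + V)) = scalar_fps \<zeta> * R - 1"
  using X_S_R resolvent_commute[of \<zeta> "U + V"] by (simp add: R_def)

lemma trace_S_R: "fps_X * tr (fps_const (U + V) * R) = \<zeta> - 1"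
proof -
  have "fps_X * tr (fps_const (U + V) * R) = tr (w * (fps_const (U + V) * R))"
    by (intro trace_fps_scalar[symmetric] coeffs_in_A_rules)
  then show ?thesis
    by (simp add: X_S_R trace_fps_diff trace_fps_scalar coeffs_in_A_rules trace_R trace_fps_1)
qed

lemma trace_SS_R:
  "fps_X ^ 2 * tr (fps_const ((U + V) * (U + V)) * R)
    = \<zeta> * (\<zeta> - 1) - fps_X * fps_const (\<tau> (U + V))"
proof -
  have "fps_X * tr (fps_const ((U + V) * (U + V)) * R)
      = tr (w * (fps_const ((U + V) * (U + V)) * R))"
    by (intro trace_fps_scalar[symmetric] coeffs_in_A_rules mem_mult mem_add U V)
  also have "w * (fps_const ((U + V) * (U + V)) * R)
      = fps_const (U + V) * (w * (fps_const (U + V) * R))"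
    by (simp only: fps_const_mult[symmetric] mult.assoc
        scalar_fps_left_commute[of "fps_const (U + V)"])
  also have "\<dots> = scalar_fps \<zeta> * (fps_const (U + V) * R) - fps_const (U + V)"
    unfolding X_S_R right_diff_distrib
    by (simp only: mult.assoc[symmetric] scalar_fps_commute fps_oper_mult_1_right)
  finally have "fps_X * tr (fps_const ((U + V) * (U + V)) * R)
      = \<zeta> * tr (fps_const (U + V) * R) - fps_const (\<tau> (U + V))"
    by (simp add: trace_fps_diff trace_fps_scalar coeffs_in_A_rules trace_fps_const del: fps_const_add)
  note * = this
  have "fps_X ^ 2 * tr (fps_const ((U + V) * (U + V)) * R)
      = \<zeta> * (fps_X * tr (fps_const (U + V) * R)) - fps_X * fps_const (\<tau> (U + V))"
    unfolding power2_eq_square mult.assoc * right_diff_distrib by (simp only: mult.left_commute)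
  then show ?thesis by (simp add: trace_S_R)
qed

lemma trace_SSS_R:
  "fps_X ^ 3 * tr (fps_const ((U + V) * ((U + V) * (U + V))) * R)
    = \<zeta>\<^sup>2 * (\<zeta> - 1) - \<zeta> * fps_X * fps_const (\<tau> (U + V))
      - fps_X ^ 2 * fps_const (\<tau> ((U + V) * (U + V)))"
proof -
  define S where "S = U + V"
  have SA: "S \<in> A" "S * S \<in> A" "S * (S * S) \<in> A" by (auto simp: S_def mem_add mem_mult U V)
  have "fps_X * tr (fps_const (S * (S * S)) * R) = tr (w * (fps_const (S * (S * S)) * R))"
    by (intro trace_fps_scalar[symmetric] coeffs_in_A_rules SA)
  also have "w * (fps_const (S * (S * S)) * R) = fps_const (S * S) * (w * (fps_const S * R))"
    by (simp only: fps_const_mult[symmetric] mult.assoc scalar_fps_left_commute[of "fps_const S"])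
  also have "\<dots> = scalar_fps \<zeta> * (fps_const (S * S) * R) - fps_const (S * S)"
    unfolding X_S_R[folded S_def] right_diff_distrib
    by (simp only: mult.assoc[symmetric] scalar_fps_commute fps_oper_mult_1_right)
  finally have "fps_X * tr (fps_const (S * (S * S)) * R)
      = \<zeta> * tr (fps_const (S * S) * R) - fps_const (\<tau> (S * S))"
    by (simp add: trace_fps_diff trace_fps_scalar coeffs_in_A_rules SA trace_fps_const)
  note * = this
  have "fps_X ^ 3 * tr (fps_const (S * (S * S)) * R)
      = \<zeta> * (fps_X ^ 2 * tr (fps_const (S * S) * R)) - fps_X ^ 2 * fps_const (\<tau> (S * S))"
    unfolding power2_eq_square power3_eq_cube mult.assoc * right_diff_distrib
    by (simp only: mult.left_commute)
  then show ?thesis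
    unfolding S_def trace_SS_R by (simp add: power2_eq_square algebra_simps)
qed

lemma trace_shifted_U: "tr AU = u - fps_X * fps_const (\<tau> U)"
  unfolding shifted_def
  by (simp add: trace_fps_diff trace_fps_scalar trace_fps_scalar_1 trace_fps_const coeffs_in_A_rules)

text \<open>\<open>AU\<close> separates \<open>U + V\<close> from \<open>R\<close> on the left;
  cyclicity brings \<open>U + V\<close> behind \<open>R\<close>, where \<open>X_R_S\<close>
  applies.\<close>

lemma trace_S_AU_R: "fps_X * tr (fps_const (U + V) * (AU * R)) = \<zeta> - tr AU"
proof -
  have "tr (fps_const (U + V) * (AU * R)) = tr (AU * R * fps_const (U + V))"
    by (intro trace_fps_commute coeffs_in_A_rules)
  then have "fps_X * tr (fps_const (U + V) * (AU * R)) = tr (w * (AU * R * fps_const (U + V)))"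
    by (simp add: trace_fps_scalar coeffs_in_A_rules del: fps_const_add)
  also have "w * (AU * R * fps_const (U + V)) = AU * (w * (R * fps_const (U + V)))"
    by (simp only: mult.assoc[symmetric] scalar_fps_commute)
  also have "\<dots> = scalar_fps \<zeta> * (AU * R) - AU"
    unfolding X_R_S right_diff_distrib
    by (simp only: mult.assoc[symmetric] scalar_fps_commute fps_oper_mult_1_right)
  finally show ?thesis
    by (simp add: trace_fps_diff trace_fps_scalar coeffs_in_A_rules trace_U_shifted_R del: fps_const_add)
qed

lemma trace_S_R_AU: "fps_X * tr (fps_const (U + V) * (R * AU)) = \<zeta> - tr AU"
proof -
  have "fps_X * tr (fps_const (U + V) * (R * AU)) = tr (w * (fps_const (U + V) * (R * AU)))"
    by (intro trace_fps_scalar[symmetric] coeffs_in_A_rules)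
  also have "w * (fps_const (U + V) * (R * AU)) = w * (fps_const (U + V) * R) * AU"
    by (simp only: mult.assoc)
  also have "\<dots> = scalar_fps \<zeta> * (R * AU) - AU"
    unfolding X_S_R left_diff_distrib by (simp only: mult.assoc fps_oper_mult_1_left)
  finally have "fps_X * tr (fps_const (U + V) * (R * AU)) = \<zeta> * tr (R * AU) - tr AU"
    by (simp add: trace_fps_diff trace_fps_scalar coeffs_in_A_rules del: fps_const_add)
  moreover have "tr (R * AU) = tr (AU * R)"
    by (intro trace_fps_commute coeffs_in_A_rules)
  ultimately show ?thesis
    by (simp add: trace_U_shifted_R)
qed

text \<open>\<open>U * d\<close> has trace 0 since \<open>d\<close> starts with \<open>b\<close>. In
  \<open>V * d = V * b + V * b * (a * d)\<close> the factor \<open>V * b\<close> stays in the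
  algebra of \<open>V\<close>, so the last term has trace 0 as well; only \<open>V * b\<close>
  remains, and it comes from the resolvent of \<open>V\<close> alone.\<close>

lemma trace_S_d: "fps_X * tr (fps_const (U + V) * d) = v - 1 - fps_X * fps_const (\<tau> V)"
proof -
  have "tr (fps_const U * d) = 0"
    by (intro trace_alg_d)
      (auto simp: coeffs_in_def alg_def poly_algebra_self poly_algebra_0)
  moreover have "tr (fps_const V * d) = tr (fps_const V * b) + tr (fps_const V * b * (a * d))"
    by (subst d_eq) (simp add: distrib_left mult.assoc trace_fps_add coeffs_in_A_rules)
  moreover have "tr (fps_const V * b * (a * d)) = 0"
  proof (rule trace_fps_alg_mult_alternating[of "Suc 0" _ 0])
    show "coeffs_in (alg (Suc 0)) (fps_const V * b)"
      by (rule coeffs_in_mult[of "alg (Suc 0)" _ "alg (Suc 0)"])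
        (use coeffs_in_centered(2) in \<open>auto simp: alg_def centered_def coeffs_in_def
          poly_algebra_self poly_algebra_0 poly_algebra_add poly_algebra_mult\<close>)
    show "coeffs_in {y. alternating_span centered 0 y} (a * d)"
      by (rule coeffs_in_centered_mult[OF coeffs_in_centered(1) coeffs_in_d]) simp
  qed simp_all
  moreover have "tr (fps_const (U + V) * d) = tr (fps_const U * d) + tr (fps_const V * d)"
    unfolding fps_const_add[symmetric] distrib_right by (intro trace_fps_add coeffs_in_A_rules)
  moreover have "fps_X * tr (fps_const V * b) = v - 1 - fps_X * fps_const (\<tau> V)"
  proof -
    have "w * (fps_const V * (1 + b)) = (scalar_fps v - BV) * (1 + b)"
      by (simp only: X_mult_V mult.assoc[symmetric])
    also have "\<dots> = scalar_fps v * (1 + b) - 1"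
      by (simp only: left_diff_distrib inverses)
    finally have "fps_X * tr (fps_const V * (1 + b)) = tr (scalar_fps v * (1 + b) - 1)"
      using trace_fps_scalar[of "fps_const V * (1 + b)" fps_X] by (simp add: coeffs_in_A_rules)
    also have "\<dots> = v * tr (1 + b) - 1"
      by (subst trace_fps_diff, (intro coeffs_in_A_rules)+, subst trace_fps_scalar)
        (auto intro!: coeffs_in_A_rules simp: trace_fps_1)
    also have "tr (fps_const V * (1 + b)) = fps_const (\<tau> V) + tr (fps_const V * b)"
      by (simp add: distrib_left fps_oper_mult_1_right trace_fps_add coeffs_in_A_rules trace_fps_const)
    finally show ?thesis
      by (simp add: trace_resolvents distrib_left algebra_simps)
  qed
  ultimately show ?thesis by simp
qed

lemma trace_S_AU: "tr (fps_const (U + V) * AU)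
    = u * fps_const (\<tau> (U + V)) - fps_X * fps_const (\<tau> ((U + V) * U))"
proof -
  have "fps_const (U + V) * AU = scalar_fps u * fps_const (U + V) - w * fps_const ((U + V) * U)"
    unfolding shifted_def right_diff_distrib fps_const_mult[symmetric]
    by (simp only: mult.assoc[symmetric] scalar_fps_commute)
  then show ?thesis
    by (simp add: trace_fps_diff trace_fps_scalar trace_fps_const coeffs_in_A_rules mem_mult mem_add
        U V del: fps_const_add fps_const_mult)
qed

lemma trace_V_U: "\<tau> (V * U) = \<tau> V * \<tau> U"
proof -
  have "alternating_span centered 0 (U - \<tau> U *\<^sub>C 1)"
    by (intro alternating_span.single alg_decompose) (auto simp: alg_def poly_algebra_self)
  then have "\<tau> (V * (U - \<tau> U *\<^sub>C 1)) = 0"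
    by (intro trace_alg_mult_alternating[of V "Suc 0" 0]) (auto simp: alg_def poly_algebra_self)
  then show ?thesis
    by (simp add: right_diff_distrib oper_mult_scaleC_right trace_diff mem_mult mem_scaleC U V trace_scaleC)
qed

text \<open>Cyclicity places one \<open>U\<close> on each side of \<open>R\<close>. Two powers of w
  turn these into \<open>scalar_fps u - AU\<close>, and the third serves the remaining factor
  \<open>U + V\<close>.\<close>

theorem trace_U_S_U_R:
  assumes "\<tau> U = 0" "\<tau> V = 0"
  shows "fps_X ^ 3 * tr (fps_const (U * (U + V) * U) * R)
    = u\<^sup>2 * (\<zeta> - 1) - 2 * u * (\<zeta> - u) - fps_X ^ 2 * fps_const (\<tau> (U * U)) + (v - 1)"
proof -
  define S where "S = fps_const (U + V)"
  have SA: "coeffs_in A S" by (simp add: S_def U V mem_add coeffs_in_simps)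
  have cyc: "tr (fps_const (U * (U + V) * U) * R) = tr (S * (fps_const U * (R * fps_const U)))"
  proof -
    have "fps_const (U * (U + V) * U) * R = fps_const U * (S * (fps_const U * R))"
      by (simp only: fps_const_mult[symmetric] mult.assoc S_def)
    also have "tr \<dots> = tr (S * (fps_const U * R) * fps_const U)"
      by (intro trace_fps_commute coeffs_in_A_rules SA)
    finally show ?thesis by (simp only: mult.assoc)
  qed
  have "fps_X * (fps_X * tr (S * (fps_const U * (R * fps_const U))))
      = tr (w * (w * (S * (fps_const U * (R * fps_const U)))))"
    by (simp add: trace_fps_scalar coeffs_in_A_rules SA)
  also have "w * (w * (S * (fps_const U * (R * fps_const U))))
      = S * ((w * fps_const U) * R * (w * fps_const U))"
    by (simp only: mult.assoc scalar_fps_left_commute[of S] scalar_fps_left_commute[of R]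
        scalar_fps_left_commute[of "fps_const U"])
  also have "\<dots> = S * ((scalar_fps u - AU) * R * (scalar_fps u - AU))"
    by (simp only: X_mult_U)
  \<comment> \<open>The product \<open>AU * R * AU\<close> has been replaced by
    \<open>AU + d\<close>, so every term is one of the traces computed above.\<close>
  also have "\<dots> = scalar_fps u * (scalar_fps u * (S * R)) - scalar_fps u * (S * (AU * R))
      - scalar_fps u * (S * (R * AU)) + (S * AU + S * d)"
    unfolding d_def
    by (simp only: left_diff_distrib right_diff_distrib mult.assoc scalar_fps_commute[of R]
        scalar_fps_commute[of AU] scalar_fps_left_commute[of S] scalar_fps_left_commute[of AU])
      (simp add: algebra_simps)
  finally have "fps_X * (fps_X * tr (S * (fps_const U * (R * fps_const U))))
      = u * (u * tr (S * R)) - u * tr (S * (AU * R)) - u * tr (S * (R * AU))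
        + (tr (S * AU) + tr (S * d))"
    by (simp add: trace_fps_diff trace_fps_add trace_fps_scalar coeffs_in_A_rules SA)
  note * = this
  have "fps_X ^ 3 * tr (S * (fps_const U * (R * fps_const U)))
      = u\<^sup>2 * (fps_X * tr (S * R)) - u * (fps_X * tr (S * (AU * R)))
        - u * (fps_X * tr (S * (R * AU))) + (fps_X * tr (S * AU) + fps_X * tr (S * d))"
    unfolding power2_eq_square power3_eq_cube mult.assoc * by (simp add: algebra_simps)
  also have "\<dots> = u\<^sup>2 * (\<zeta> - 1) - u * (\<zeta> - u) - u * (\<zeta> - u)
      + (- fps_X * (fps_X * fps_const (\<tau> (U * U))) + (v - 1))"
    unfolding S_def trace_S_R trace_S_AU_R trace_S_R_AU trace_shifted_U trace_S_AU trace_S_d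
    using assms trace_V_U by (simp add: trace_add distrib_right mem_mult U V)
  finally show ?thesis
    unfolding cyc by (simp add: power2_eq_square algebra_simps)
qed

end

section \<open>Cauchy transforms of free Meixner laws\<close>

locale compact_law =
  fixes \<mu> :: "real measure"
  assumes law: "compactly_supported_prob \<mu>"
begin

sublocale prob_space \<mu>
  using law by (simp add: compactly_supported_prob_def)

lemma sets_eq: "sets \<mu> = sets borel"
  using law by (simp add: compactly_supported_prob_def)

lemma ex_bound: "\<exists>r>0. AE y in \<mu>. \<bar>y\<bar> \<le> r"
proof -
  obtain K where K: "compact K" "AE y in \<mu>. y \<in> K"
    using law by (auto simp: compactly_supported_prob_def)
  obtain r where r: "\<And>y. y \<in> K \<Longrightarrow> norm y \<le> r"
    using compact_imp_bounded[OF K(1)] by (auto simp: bounded_iff)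
  have "AE y in \<mu>. \<bar>y\<bar> \<le> max r 1"
    using K(2) by eventually_elim (use r in \<open>fastforce simp: le_max_iff_disj\<close>)
  then show ?thesis
    by (intro exI[of _ "max r 1"]) auto
qed

definition "r = (SOME r. r > 0 \<and> (AE y in \<mu>. \<bar>y\<bar> \<le> r))"

lemma r: "r > 0" "AE y in \<mu>. \<bar>y\<bar> \<le> r"
  using someI_ex[OF ex_bound[unfolded Bex_def]] unfolding r_def by auto

lemma borel_measurable_law:
  assumes "f \<in> borel_measurable borel"
  shows "f \<in> borel_measurable \<mu>"
  using assms sets_eq by (simp cong: measurable_cong_sets)

lemma integrable_bounded:
  fixes f :: "real \<Rightarrow> 'b::{banach, second_countable_topology}"
  assumes "f \<in> borel_measurable borel" "\<And>y. \<bar>y\<bar> \<le> r \<Longrightarrow> norm (f y) \<le> B"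
  shows "integrable \<mu> f"
  by (rule integrable_const_bound[where B = B])
    (use assms r(2) borel_measurable_law in \<open>auto elim!: eventually_mono\<close>)

lemma norm_integral_le:
  fixes f :: "real \<Rightarrow> 'b::{banach, second_countable_topology}"
  assumes "f \<in> borel_measurable borel" "\<And>y. \<bar>y\<bar> \<le> r \<Longrightarrow> norm (f y) \<le> B"
  shows "norm (LINT y|\<mu>. f y) \<le> B"
proof -
  have "norm (LINT y|\<mu>. f y) \<le> (LINT y|\<mu>. norm (f y))"
    by (rule integral_norm_bound)
  also have "\<dots> \<le> (LINT y|\<mu>. B)"
    using r(2) assms(2)
    by (intro integral_mono_AE integrable_norm integrable_bounded[OF assms]) (auto elim!: eventually_mono)
  finally show ?thesis by (simp add: prob_space)
qed

definition moments :: "complex fps" where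
  "moments = Abs_fps (\<lambda>n. complex_of_real (LINT y|\<mu>. y ^ n))"

definition transform :: "complex \<Rightarrow> complex" where
  "transform z = (LINT y|\<mu>. 1 / (z - complex_of_real y))"

definition moment_fun :: "complex \<Rightarrow> complex" where
  "moment_fun u = (LINT y|\<mu>. 1 / (1 - u * complex_of_real y))"

text \<open>For \<open>\<bar>y\<bar> \<le> r\<close> the geometric series in \<open>u y\<close> has
  ratio at most \<open>q < 1\<close>, so the remainder bound \<open>q ^ n / (1 - q)\<close> is
  uniform in y and survives integration.\<close>

lemma moment_fun_sums:
  assumes u: "norm u < 1 / r"
  shows "(\<lambda>n. moments $ n * u ^ n) sums moment_fun u"
proof -
  define q where "q = norm u * r"
  have q: "0 \<le> q" "q < 1"
    using u r(1) by (auto simp: q_def field_simps)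
  have le: "norm (u * complex_of_real y) \<le> q" if "\<bar>y\<bar> \<le> r" for y
    using that by (simp add: q_def norm_mult mult_left_mono)
  have den: "1 - q \<le> norm (1 - u * complex_of_real y)" if "\<bar>y\<bar> \<le> r" for y
    using norm_triangle_ineq2[of 1 "u * complex_of_real y"] le[OF that] by simp
  have int1: "integrable \<mu> (\<lambda>y. 1 / (1 - u * complex_of_real y))"
  proof (rule integrable_bounded[where B = "1 / (1 - q)"])
    show "norm (1 / (1 - u * complex_of_real y)) \<le> 1 / (1 - q)" if "\<bar>y\<bar> \<le> r" for y
      using den[OF that] q by (simp add: norm_divide divide_le_cancel frac_le)
  qed simp
  have intp: "integrable \<mu> (\<lambda>y. (u * complex_of_real y) ^ n)" for n
    by (rule integrable_bounded[where B = "q ^ n"]) (auto simp: norm_power intro!: power_mono le)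
  have le_n: "norm (moment_fun u - (\<Sum>k<n. moments $ k * u ^ k)) \<le> q ^ n / (1 - q)" for n
  proof -
    have "(\<Sum>k<n. moments $ k * u ^ k) = (\<Sum>k<n. (LINT y|\<mu>. (u * complex_of_real y) ^ k))"
      by (intro sum.cong refl)
        (simp add: moments_def power_mult_distrib integral_complex_of_real[symmetric] mult.commute)
    also have "\<dots> = (LINT y|\<mu>. (\<Sum>k<n. (u * complex_of_real y) ^ k))"
      by (intro Bochner_Integration.integral_sum[symmetric] intp)
    finally have "moment_fun u - (\<Sum>k<n. moments $ k * u ^ k)
        = (LINT y|\<mu>. 1 / (1 - u * complex_of_real y) - (\<Sum>k<n. (u * complex_of_real y) ^ k))"
      unfolding moment_fun_def
      by (simp add: Bochner_Integration.integral_diff[OF int1] intp)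
    also have "norm \<dots> \<le> q ^ n / (1 - q)"
    proof (rule norm_integral_le)
      fix y assume y: "\<bar>y\<bar> \<le> r"
      define x where "x = u * complex_of_real y"
      have x: "x \<noteq> 1" using le[OF y] q by (auto simp: x_def)
      have "1 / (1 - x) - (\<Sum>k<n. x ^ k) = x ^ n / (1 - x)"
        using x by (simp add: sum_gp_strict field_simps)
      then show "norm (1 / (1 - u * complex_of_real y) - (\<Sum>k<n. (u * complex_of_real y) ^ k))
          \<le> q ^ n / (1 - q)"
        unfolding x_def[symmetric] using le[OF y] den[OF y] q
        by (simp add: norm_divide norm_power x_def[symmetric])
          (intro frac_le power_mono; simp)
    qed simp
    finally show ?thesis .
  qed
  have lim: "(\<lambda>n. q ^ n / (1 - q)) \<longlonglongrightarrow> 0"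
    by (rule tendsto_divide_zero[OF LIMSEQ_realpow_zero[OF q]])
  have "(\<lambda>n. moment_fun u - (\<Sum>k<n. moments $ k * u ^ k)) \<longlonglongrightarrow> 0"
    by (rule Lim_null_comparison[OF always_eventually[OF allI[OF le_n]] lim])
  from tendsto_diff[OF tendsto_const[of "moment_fun u"] this] show ?thesis
    by (simp add: sums_def)
qed

lemma moment_fun_has_fps_expansion: "moment_fun has_fps_expansion moments"
proof (rule has_fps_expansionI)
  show "eventually (\<lambda>u. (\<lambda>n. moments $ n * u ^ n) sums moment_fun u) (nhds 0)"
    unfolding eventually_nhds_metric
    using r(1) moment_fun_sums by (intro exI[of _ "1 / r"]) auto
qed

lemma transform_eq: "z \<noteq> 0 \<Longrightarrow> transform z = moment_fun (1 / z) / z"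
proof -
  assume z: "z \<noteq> 0"
  \<comment> \<open>At z = y both sides are 0, the value of a quotient by zero.\<close>
  have "1 / (z - complex_of_real y) = (1 / z) * (1 / (1 - 1 / z * complex_of_real y))" for y
    using z by (cases "z = complex_of_real y") (auto simp: field_simps)
  then have "transform z = (LINT y|\<mu>. (1 / z) * (1 / (1 - 1 / z * complex_of_real y)))"
    unfolding transform_def by presburger
  also have "\<dots> = (1 / z) * moment_fun (1 / z)"
    unfolding moment_fun_def by (rule integral_mult_right_zero)
  finally show ?thesis by simp
qed

lemma norm_diff_ge_Im:
  "\<bar>Im z\<bar> \<le> norm (z - complex_of_real y)"
  using abs_Im_le_cmod[of "z - complex_of_real y"] by simp

lemma integrable_transform:
  assumes "Im z > 0"
  shows "integrable \<mu> (\<lambda>y. (1 / (z - complex_of_real y)) ^ n)"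
proof (rule integrable_bounded[where B = "(1 / Im z) ^ n"])
  show "norm ((1 / (z - complex_of_real y)) ^ n) \<le> (1 / Im z) ^ n" if "\<bar>y\<bar> \<le> r" for y
    unfolding norm_power
    using norm_diff_ge_Im[of z y] assms by (intro power_mono) (auto simp: norm_divide intro!: frac_le)
qed simp

text \<open>Differentiation under the integral by an explicit estimate: the error of the difference
  quotient is \<open>h\<close> times the integral of a product of three factors, each bounded by
  \<open>2 / Im z\<close>.\<close>

lemma transform_holomorphic: "transform holomorphic_on {z. Im z > 0}"
proof -
  have "(transform has_field_derivative - (LINT y|\<mu>. (1 / (z - complex_of_real y)) ^ 2)) (at z)"
    if z: "Im z > 0" for z
  proof -
    define D where "D = - (LINT y|\<mu>. (1 / (z - complex_of_real y)) ^ 2)"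
    have bound: "norm ((transform (z + h) - transform z) / h - D) \<le> norm h * (2 / Im z) ^ 3"
      \<comment> \<open>This bound keeps \<open>z + h\<close> at distance more than
        \<open>Im z / 2\<close> from the real axis.\<close>
      if h: "h \<noteq> 0" "norm h < Im z / 2" for h
    proof -
      have Im_h: "Im (z + h) > Im z / 2"
        using abs_Im_le_cmod[of h] h by simp
      have int: "integrable \<mu> (\<lambda>y. 1 / (z' - complex_of_real y))" if "Im z' > 0" for z'
        using integrable_transform[OF that, of 1] by simp
      have zh: "Im (z + h) > 0" using Im_h z by linarith
      have "transform (z + h) - transform z
          = (LINT y|\<mu>. 1 / (z + h - complex_of_real y) - 1 / (z - complex_of_real y))"
        unfolding transform_def by (intro Bochner_Integration.integral_diff[symmetric] int z zh)
      then have "(transform (z + h) - transform z) / h - D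
          = (LINT y|\<mu>. (1 / (z + h - complex_of_real y) - 1 / (z - complex_of_real y)) / h
              + (1 / (z - complex_of_real y)) ^ 2)"
        unfolding D_def using integrable_transform[OF z, of 2] int[OF z] int[OF zh]
        by (subst Bochner_Integration.integral_add) auto
      also have "\<dots> = (LINT y|\<mu>. h * ((1 / (z + h - complex_of_real y)) * (1 / (z - complex_of_real y)) ^ 2))"
      proof (rule Bochner_Integration.integral_cong[OF refl])
        fix y
        have "z - complex_of_real y \<noteq> 0" "z + h - complex_of_real y \<noteq> 0"
          using z zh by (auto simp: complex_eq_iff)
        then show "(1 / (z + h - complex_of_real y) - 1 / (z - complex_of_real y)) / h
              + (1 / (z - complex_of_real y)) ^ 2
            = h * ((1 / (z + h - complex_of_real y)) * (1 / (z - complex_of_real y)) ^ 2)"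
          using h(1) by (simp add: divide_simps power2_eq_square)
      qed
      also have "norm \<dots> \<le> norm h * (2 / Im z) ^ 3"
      proof (rule norm_integral_le)
        fix y :: real
        have 1: "norm (1 / (z + h - complex_of_real y)) \<le> 2 / Im z"
          using norm_diff_ge_Im[of "z + h" y] Im_h z zh
          using frac_le[of 1 1 "Im z / 2" "norm (z + h - complex_of_real y)"] by (simp add: norm_divide)
        have 2: "norm (1 / (z - complex_of_real y)) \<le> 2 / Im z"
          using norm_diff_ge_Im[of z y] z
          using frac_le[of 1 1 "Im z" "norm (z - complex_of_real y)"]
            divide_right_mono[of 1 2 "Im z"] by (simp add: norm_divide)
        have "norm (1 / (z + h - complex_of_real y)) * norm (1 / (z - complex_of_real y)) ^ 2
            \<le> 2 / Im z * (2 / Im z) ^ 2"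
          by (intro mult_mono power_mono 1 2) (use z in auto)
        then show "norm (h * ((1 / (z + h - complex_of_real y)) * (1 / (z - complex_of_real y)) ^ 2))
            \<le> norm h * (2 / Im z) ^ 3"
          unfolding norm_mult norm_power
          by (intro mult_left_mono) (simp_all add: power3_eq_cube power2_eq_square mult.assoc)
      qed simp
      finally show ?thesis .
    qed
    have "((\<lambda>h. (transform (z + h) - transform z) / h - D) \<longlongrightarrow> 0) (at 0)"
    proof (rule Lim_null_comparison)
      have "eventually (\<lambda>h::complex. h \<noteq> 0 \<and> norm h < Im z / 2) (at 0)"
        unfolding eventually_at by (rule exI[of _ "Im z / 2"]) (use z in \<open>auto simp: dist_norm\<close>)
      then show "\<forall>\<^sub>F h in at 0. norm ((transform (z + h) - transform z) / h - D) \<le> norm h * (2 / Im z) ^ 3"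
        by eventually_elim (use bound in auto)
      show "((\<lambda>h::complex. norm h * (2 / Im z) ^ 3) \<longlongrightarrow> 0) (at 0)"
        by (auto intro!: tendsto_eq_intros)
    qed
    then have "((\<lambda>h. (transform (z + h) - transform z) / h) \<longlongrightarrow> D) (at 0)"
      by (rule LIM_zero_cancel)
    then show ?thesis
      unfolding D_def DERIV_def .
  qed
  then show ?thesis
    unfolding holomorphic_on_def field_differentiable_def
    by (blast intro: has_field_derivative_at_within)
qed

lemma Im_transform:
  assumes "Im z > 0"
  shows "Im (transform z) \<le> 0"
proof -
  have int: "integrable \<mu> (\<lambda>y. 1 / (z - complex_of_real y))"
    using integrable_transform[OF assms, of 1] by simp
  have "Im (transform z) = (LINT y|\<mu>. Im (1 / (z - complex_of_real y)))"
    unfolding transform_def by (rule integral_Im[OF int, symmetric])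
  also have "\<dots> = - (LINT y|\<mu>. Im z / (norm (z - complex_of_real y))\<^sup>2)"
    by (simp add: Im_divide cmod_power2 flip: Bochner_Integration.integral_minus)
  also have "\<dots> \<le> 0"
    using assms by (simp add: integral_nonneg_AE)
  finally show ?thesis .
qed

text \<open>Isolating and squaring the root in the formula for the transform g gives
  \<open>(b z^2 + a z + 1) g^2 - ((1 + 2 b) z + a) g + (1 + b) = 0\<close>; here z = 1/w and g = w
  times the moment series.\<close>

definition meixner_fps :: "complex \<Rightarrow> complex \<Rightarrow> complex fps" where
  "meixner_fps a b = (fps_const b + fps_const a * fps_X + fps_X\<^sup>2) * moments\<^sup>2
     - (fps_const (1 + 2 * b) + fps_const a * fps_X) * moments + fps_const (1 + b)"

definition meixner_fun :: "complex \<Rightarrow> complex \<Rightarrow> complex \<Rightarrow> complex" where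
  "meixner_fun a b u = (b + a * u + u\<^sup>2) * (moment_fun u)\<^sup>2
     - ((1 + 2 * b) + a * u) * moment_fun u + (1 + b)"

lemma meixner_fun_has_fps_expansion: "meixner_fun a b has_fps_expansion meixner_fps a b"
  unfolding meixner_fun_def[abs_def] meixner_fps_def power2_eq_square
  by (intro fps_expansion_intros moment_fun_has_fps_expansion)

lemma meixner_fun_transform:
  assumes "z \<noteq> 0"
  shows "meixner_fun a b (1 / z) = (b * z\<^sup>2 + a * z + 1) * (transform z)\<^sup>2
     - ((1 + 2 * b) * z + a) * transform z + (1 + b)"
  unfolding meixner_fun_def transform_eq[OF assms]
  using assms by (simp add: divide_simps power2_eq_square) (simp add: algebra_simps)

text \<open>The quadratic equation holds at the points of the upper half plane where the formula is
  imposed. These yield zeros of \<open>meixner_fun\<close> accumulating at 0, which forces its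
  expansion to vanish.\<close>

lemma meixner_fps_zero_if:
  fixes a b :: real
  assumes "is_free_meixner a b \<mu>"
  shows "meixner_fps a b = 0"
proof -
  obtain w where w: "\<And>z. Im z > 0 \<Longrightarrow> (w z)\<^sup>2 = (z - of_real a)\<^sup>2 - 4 * (1 + of_real b)"
    "\<And>z. Im z > 0 \<Longrightarrow> of_real b * z\<^sup>2 + of_real a * z + 1 \<noteq> 0 \<Longrightarrow>
       transform z = ((1 + 2 * of_real b) * z + of_real a - w z) /
                (2 * (of_real b * z\<^sup>2 + of_real a * z + 1))"
    using assms unfolding is_free_meixner_def transform_def by blast
  have zero: "meixner_fun a b (1 / z) = 0"
    if z: "Im z > 0" and D: "of_real b * z\<^sup>2 + of_real a * z + 1 \<noteq> 0" for z
  proof -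
    define D where "D = of_real b * z\<^sup>2 + of_real a * z + 1"
    define P where "P = (1 + 2 * of_real b) * z + of_real a"
    have D0: "D \<noteq> 0"
      using D unfolding D_def .
    moreover have "transform z = (P - w z) / (2 * D)"
      using w(2)[OF z D] unfolding D_def P_def .
    ultimately have "2 * D * transform z = P - w z"
      by simp
    then have "w z = P - 2 * D * transform z" by simp
    then have "(P - 2 * D * transform z)\<^sup>2 = (z - of_real a)\<^sup>2 - 4 * (1 + of_real b)"
      using w(1)[OF z] by simp
    then have "4 * D * (D * (transform z)\<^sup>2 - P * transform z + (1 + of_real b)) = 0"
      unfolding D_def P_def by (simp add: power2_eq_square algebra_simps)
    then have "D * (transform z)\<^sup>2 - P * transform z + (1 + of_real b) = 0"
      using D0 by simp
    then show ?thesis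
      using z by (subst meixner_fun_transform) (auto simp: D_def P_def)
  qed
  \<comment> \<open>The reciprocals are the points \<open>\<i> * of_nat (Suc n)\<close>, which run
    to infinity inside the upper half plane.\<close>
  define s where "s n = - \<i> / of_nat (Suc n)" for n :: nat
  have s_lim: "filterlim s (at 0) sequentially"
  proof -
    have "(\<lambda>n. - \<i> * (1 / of_nat (Suc n))) \<longlonglongrightarrow> - \<i> * 0"
      by (intro tendsto_intros LIMSEQ_Suc lim_1_over_n)
    moreover have "(\<lambda>n. - \<i> * (1 / of_nat (Suc n))) = s" by (simp add: s_def fun_eq_iff)
    ultimately have "s \<longlonglongrightarrow> 0" by (simp only: mult_zero_right)
    moreover have "s n \<noteq> 0" for n by (simp add: s_def del: of_nat_Suc)
    ultimately show ?thesis
      unfolding filterlim_at by simp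
  qed
  \<comment> \<open>The excluded zeros of the denominator are avoided: on the imaginary axis its
    real part is \<open>1 - b * (Suc n)^2\<close>, nonzero for large n.\<close>
  have D: "eventually (\<lambda>n. of_real b * (1 / s n)\<^sup>2 + of_real a * (1 / s n) + 1 \<noteq> 0) sequentially"
  proof -
    have inv: "1 / s n = of_nat (Suc n) * \<i>" for n
      by (simp add: s_def field_simps)
    have Re: "Re (of_real b * (1 / s n)\<^sup>2 + of_real a * (1 / s n) + 1) = 1 - b * (real (Suc n))\<^sup>2" for n
      unfolding inv power_mult_distrib by (simp add: power2_eq_square)
    have "eventually (\<lambda>n. 1 - b * (real (Suc n))\<^sup>2 \<noteq> 0) sequentially"
    proof (cases "b = 0")
      case False
      show ?thesis
      proof (rule eventually_mono[OF eventually_gt_at_top[of "nat \<lceil>1 / \<bar>b\<bar>\<rceil>"]])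
        fix n assume n: "nat \<lceil>1 / \<bar>b\<bar>\<rceil> < n"
        then have "1 / \<bar>b\<bar> < real (Suc n)" by linarith
        also have "\<dots> \<le> (real (Suc n))\<^sup>2" by (simp add: power2_eq_square)
        finally have "1 < \<bar>b\<bar> * (real (Suc n))\<^sup>2" using False by (simp add: field_simps)
        also have "\<dots> = \<bar>b * (real (Suc n))\<^sup>2\<bar>" by (simp add: abs_mult)
        finally show "1 - b * (real (Suc n))\<^sup>2 \<noteq> 0" by auto
      qed
    qed simp
    then show ?thesis
      by eventually_elim (metis Re zero_complex.sel(1))
  qed
  have ev: "eventually (\<lambda>n. meixner_fun a b (s n) = 0) sequentially"
    using D
  proof eventually_elim
    case (elim n)
    have "Im (1 / s n) > 0"
      by (simp add: s_def Im_divide)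
    from zero[OF this elim] show ?case by simp
  qed
  show ?thesis
  proof (rule ccontr)
    assume "meixner_fps a b \<noteq> 0"
    then have "eventually (\<lambda>u. meixner_fun a b u \<noteq> 0) (at 0)"
      using has_laurent_expansion_eventually_nonzero_iff'[OF
          has_laurent_expansion_fps[OF meixner_fun_has_fps_expansion[of a b]]] by simp
    then have "eventually (\<lambda>n. meixner_fun a b (s n) \<noteq> 0) sequentially"
      using s_lim by (rule eventually_compose_filterlim)
    with ev have "eventually (\<lambda>n::nat. False) sequentially"
      by eventually_elim simp
    then show False by simp
  qed
qed

text \<open>The equation holds near infinity, hence on the whole half plane by analytic
  continuation. The sign condition on the imaginary part is automatic for the transform of a
  measure.\<close>

lemma is_free_meixnerI:
  fixes a b :: real
  assumes "meixner_fps a b = 0"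
  shows "is_free_meixner a b \<mu>"
proof -
  define D where "D z = of_real b * z\<^sup>2 + of_real a * z + 1" for z :: complex
  define P where "P z = (1 + 2 * of_real b) * z + of_real a" for z :: complex
  define F where "F z = D z * (transform z)\<^sup>2 - P z * transform z + (1 + of_real b)" for z
  have "eventually (\<lambda>u. meixner_fun a b u = 0) (nhds 0)"
    using meixner_fun_has_fps_expansion[of a b] unfolding assms
    by (auto simp: has_fps_expansion_def)
  then obtain e where e: "e > 0" "\<And>u. norm u < e \<Longrightarrow> meixner_fun a b u = 0"
    by (auto simp: eventually_nhds_metric)
  have hol: "F holomorphic_on {z. Im z > 0}"
    unfolding F_def D_def P_def by (intro holomorphic_intros transform_holomorphic)
  have large: "F z = 0" if "Im z > 1 / e" for z
  proof -
    have "norm z > 1 / e" using that abs_Im_le_cmod[of z] by linarith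
    moreover from this have z: "z \<noteq> 0" using e(1) by auto
    ultimately have "norm (1 / z) < e" using e(1) by (simp add: norm_divide field_simps)
    from e(2)[OF this] show ?thesis
      unfolding meixner_fun_transform[OF z] F_def D_def P_def by simp
  qed
  have F0: "F z = 0" if "Im z > 0" for z
  proof (rule analytic_continuation_open[of "{z. Im z > 1 / e}" "{z. Im z > 0}" F "\<lambda>_. 0"])
    show "open {z. Im z > 1 / e}" "open {z::complex. Im z > 0}"
      by (simp_all add: open_halfspace_Im_gt)
    show "{z. Im z > 1 / e} \<noteq> {}"
      by (auto intro!: exI[of _ "of_real (1 / e + 1) * \<i>"])
    show "connected {z::complex. Im z > 0}"
      by (intro convex_connected convex_halfspace_Im_gt)
    show "{z. Im z > 1 / e} \<subseteq> {z. Im z > 0}"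
      using e(1) by (auto intro: less_trans[of 0 "1 / e"])
  qed (use hol large that in auto)
  \<comment> \<open>The branch is obtained by solving the formula for the root, which makes it
    holomorphic also at zeros of the denominator.\<close>
  define w where "w z = P z - 2 * D z * transform z" for z
  have "w holomorphic_on {z. Im z > 0}"
    unfolding w_def D_def P_def by (intro holomorphic_intros transform_holomorphic)
  moreover have "(w z)\<^sup>2 = (z - of_real a)\<^sup>2 - 4 * (1 + of_real b)" if "Im z > 0" for z
  proof -
    have "(w z)\<^sup>2 = 4 * D z * F z + ((P z)\<^sup>2 - 4 * D z * (1 + of_real b))"
      unfolding w_def F_def by (simp add: power2_eq_square algebra_simps)
    also have "(P z)\<^sup>2 - 4 * D z * (1 + of_real b) = (z - of_real a)\<^sup>2 - 4 * (1 + of_real b)"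
      unfolding D_def P_def by (simp add: power2_eq_square algebra_simps)
    finally show ?thesis by (simp add: F0[OF that])
  qed
  moreover have "transform z = (P z - w z) / (2 * D z)" if "D z \<noteq> 0" for z
    using that by (simp add: w_def)
  ultimately show ?thesis
    unfolding is_free_meixner_def transform_def[symmetric] D_def P_def
    using law Im_transform by (intro conjI exI[of _ w]) auto
qed

lemma is_free_meixner_iff:
  fixes a b :: real
  shows "is_free_meixner a b \<mu> \<longleftrightarrow> meixner_fps a b = 0"
  using is_free_meixnerI meixner_fps_zero_if by blast

end

section \<open>Free Levy processes\<close>

text \<open>Composition with \<open>u\<close>, the inverse of \<open>fps_X * M\<close>, turns
  \<open>M\<close> into \<open>moment_inverse M\<close> and \<open>fps_X * M\<close> into
  \<open>fps_X\<close>. It carries the right equation to the left one and is injective.\<close>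

lemma quadratic_moment_inverse_iff:
  fixes M :: "complex fps"
  assumes M: "M $ 0 = 1"
  defines "H \<equiv> moment_inverse M - 1"
  shows "fps_const b * H\<^sup>2 + fps_const (a * s) * fps_X * H + fps_const (s\<^sup>2) * fps_X\<^sup>2 - fps_const s * H = 0
    \<longleftrightarrow> (fps_const b + fps_const (a * s) * fps_X + fps_const (s\<^sup>2) * fps_X\<^sup>2) * M\<^sup>2
        - (fps_const (s + 2 * b) + fps_const (a * s) * fps_X) * M + fps_const (s + b) = 0"
    (is "?L = 0 \<longleftrightarrow> ?Q = 0")
proof -
  define u where "u = fps_inv (fps_X * M)"
  define z where "z = moment_inverse M"
  note aux = moment_inverse_properties[OF M, folded u_def z_def]
  have Mu: "M oo u = z" by (simp add: u_def z_def moment_inverse_def)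
  have "?Q oo u = (fps_const b + fps_const (a * s) * u + fps_const (s\<^sup>2) * u\<^sup>2) * z\<^sup>2
        - (fps_const (s + 2 * b) + fps_const (a * s) * u) * z + fps_const (s + b)"
    using aux(1) by (simp only: fps_compose_add_distrib fps_compose_sub_distrib
        fps_compose_mult_distrib[OF aux(1)] fps_compose_power[OF aux(1), symmetric] Mu fps_const_compose
        fps_X_fps_compose_startby0)
  also have "\<dots> = fps_const b * z\<^sup>2 + fps_const (a * s) * (u * z) + fps_const (s\<^sup>2) * (u * z)\<^sup>2
        - fps_const (s + 2 * b) * z - fps_const (a * s) * (u * z) + (fps_const (a * s) * (u * z) * z
        - fps_const (a * s) * (u * z)) + fps_const (s + b)"
    by (simp add: algebra_simps power2_eq_square)
  also have "\<dots> = ?L"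
    unfolding aux(4)[symmetric] H_def z_def[symmetric] mult_2 fps_const_add[symmetric]
    by (simp add: algebra_simps power2_eq_square del: fps_const_add fps_const_mult)
  finally have "?Q oo u = ?L" .
  moreover have "u \<noteq> 0" using aux(2) by auto
  ultimately show ?thesis
    using fps_compose_eq_0_iff[OF aux(1), of ?Q] by auto
qed

text \<open>Here \<open>h\<close>, \<open>X\<close>, \<open>th\<close> stand for \<open>H s\<close>,
  w, t / s. The left side is the difference of the two sides of the traced equation when
  \<open>H t = th * h\<close>. The terms with \<open>th^2 * h^2\<close> and
  \<open>th^2 * h^3\<close> cancel, leaving a multiple of \<open>th * (1 - th)\<close>, which the
  hypothesis converts into a multiple of \<open>k\<close>.\<close>

lemma resolvent_identity:
  fixes th b s a X h k :: "'a::comm_ring_1"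
  assumes "k * (b + s)\<^sup>2 = th * (1 - th)"
  shows "k * (b\<^sup>2 * ((1 + h)\<^sup>2 * h - X\<^sup>2 * s) + 2 * b * a * s * (X * ((1 + h) * h))
      + (b + a\<^sup>2) * s\<^sup>2 * (X\<^sup>2 * h) + a * s ^ 3 * X ^ 3) + th\<^sup>2 * ((1 + h)\<^sup>2 * h - X\<^sup>2 * s)
      - (th * h + (2 + h) * (th * h)\<^sup>2 - X\<^sup>2 * (th * s))
    = k * (b * h\<^sup>2 + a * s * X * h + s\<^sup>2 * X\<^sup>2 - s * h) * (b * h + a * s * X + 2 * b + s)"
    (is "k * ?B + _ - _ = _")
proof -
  have "k * ?B + th\<^sup>2 * ((1 + h)\<^sup>2 * h - X\<^sup>2 * s) - (th * h + (2 + h) * (th * h)\<^sup>2 - X\<^sup>2 * (th * s))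
      = k * ?B - th * (1 - th) * (h - X\<^sup>2 * s)"
    by (simp add: algebra_simps power2_eq_square)
  also have "\<dots> = k * (?B - (b + s)\<^sup>2 * (h - X\<^sup>2 * s))"
    unfolding assms[symmetric] by (simp add: algebra_simps)
  also have "?B - (b + s)\<^sup>2 * (h - X\<^sup>2 * s)
      = (b * h\<^sup>2 + a * s * X * h + s\<^sup>2 * X\<^sup>2 - s * h) * (b * h + a * s * X + 2 * b + s)"
    by (simp add: algebra_simps power2_eq_square power3_eq_cube)
  finally show ?thesis by (simp add: mult.assoc)
qed

text \<open>The difference of two solutions is annihilated by a series with constant coefficient
  1.\<close>

lemma quadratic_fps_unique:
  fixes e1 e2 :: "complex fps"
  assumes "e1 = fps_X\<^sup>2 + a * fps_X * e1 + b * e1\<^sup>2" "e2 = fps_X\<^sup>2 + a * fps_X * e2 + b * e2\<^sup>2"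
    and "e1 $ 0 = 0" "e2 $ 0 = 0"
  shows "e1 = e2"
proof -
  have "e1 - e2 = (fps_X\<^sup>2 + a * fps_X * e1 + b * e1\<^sup>2) - (fps_X\<^sup>2 + a * fps_X * e2 + b * e2\<^sup>2)"
    using assms(1,2) by simp
  then have "(e1 - e2) * (1 - a * fps_X - b * (e1 + e2)) = 0"
    by (simp add: algebra_simps power2_eq_square)
  moreover have "(1 - a * fps_X - b * (e1 + e2)) $ 0 \<noteq> 0"
    using assms(3,4) by simp
  then have "1 - a * fps_X - b * (e1 + e2) \<noteq> 0"
    by (metis fps_zero_nth)
  ultimately show ?thesis by simp
qed

section \<open>The process and the additivity of its R-transforms\<close>

locale free_levy = tracial_algebra A \<tau> for A :: "'h::complex_hilbert oper set" and \<tau> +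
  fixes X :: "real \<Rightarrow> 'h oper"
  assumes levy: "free_levy_process A \<tau> X"
    and mean: "t > 0 \<Longrightarrow> \<tau> (X t) = 0"
    and variance: "t > 0 \<Longrightarrow> \<tau> ((X t)\<^sup>2) = complex_of_real t"
begin

lemma X_mem: "t \<ge> 0 \<Longrightarrow> X t \<in> A"
  and X_selfadjoint: "t \<ge> 0 \<Longrightarrow> selfadjoint (X t)"
  and X_0: "X 0 = 0"
  using levy by (auto simp: free_levy_process_def)

lemma increment_law:
  assumes "s \<ge> 0"
  shows "\<exists>\<nu>. \<forall>t\<ge>0. has_law \<tau> (X (t + s) - X t) \<nu>"
  using levy assms by (auto simp: free_levy_process_def)

lemma increment_moments:
  assumes "t \<ge> 0" "s \<ge> 0"
  shows "moment_fps \<tau> (X (t + s) - X t) = moment_fps \<tau> (X s)"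
proof -
  obtain \<nu> where \<nu>: "\<And>t. t \<ge> 0 \<Longrightarrow> has_law \<tau> (X (t + s) - X t) \<nu>"
    using increment_law[OF assms(2)] by blast
  show ?thesis
    using \<nu>[OF assms(1)] \<nu>[of 0] by (simp add: has_law_def moment_fps_def X_0)
qed

lemma free_increments:
  assumes "0 < t" "t < s"
  shows "free_elements \<tau> {..<2} (\<lambda>i::nat. if i = 0 then X t else X s - X t)"
proof -
  \<comment> \<open>The partition 0 < t < s; since \<open>X 0 = 0\<close>, its first increment is
    \<open>X t\<close> itself.\<close>
  define p where "p i = (if i = 0 then 0 else if i = 1 then t else s)" for i :: nat
  have "free_elements \<tau> {..<2} (\<lambda>i. X (p (Suc i)) - X (p i))"
  proof -
    have "\<forall>n (t :: nat \<Rightarrow> real). 0 \<le> t 0 \<longrightarrow> (\<forall>i<n. t i < t (Suc i)) \<longrightarrow>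
        free_elements \<tau> {..<n} (\<lambda>i. X (t (Suc i)) - X (t i))"
      using levy unfolding free_levy_process_def by (elim conjE)
    moreover have "0 \<le> p 0" "\<forall>i<2. p i < p (Suc i)"
      using assms by (auto simp: p_def less_2_cases_iff)
    ultimately show ?thesis by blast
  qed
  moreover have "X (p (Suc i)) - X (p i) = (if i = 0 then X t else X s - X t)" if "i < 2" for i
    using that by (auto simp: p_def X_0 less_2_cases_iff)
  ultimately show ?thesis
    unfolding free_elements_def free_subalgebras_def by (auto cong: conj_cong)
qed

definition H :: "real \<Rightarrow> complex fps" where
  "H t = moment_inverse (moment_fps \<tau> (X t)) - 1"

lemma H_nth_0: "H t $ 0 = 0"
  using moment_inverse_properties(6)[OF moment_fps_nth_0] by (simp add: H_def)

lemma free_resolvent_increments: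
  assumes "0 < t" "t < s"
  shows "free_resolvent A \<tau> (X t) (X s - X t)"
  by unfold_locales (use assms X_mem free_increments in \<open>auto intro: mem_diff\<close>)

lemma moment_inverse_increment:
  assumes "0 < t" "t < s"
  shows "moment_inverse (moment_fps \<tau> (X s - X t)) = 1 + H (s - t)"
  using increment_moments[of t "s - t"] assms by (simp add: H_def)

lemma H_add:
  assumes "0 < t" "t < s"
  shows "H s = H t + H (s - t)"
proof -
  interpret free_resolvent A \<tau> "X t" "X s - X t"
    "moment_inverse (moment_fps \<tau> (X t))" "moment_inverse (moment_fps \<tau> (X s - X t))"
    using free_resolvent_increments[OF assms] by simp_all
  show ?thesis
    using moment_inverse_add moment_inverse_increment[OF assms] by (simp add: H_def)
qed

text \<open>At \<open>h = H s\<close> this is w^3 times the trace of the proposed conditional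
  expectation against the resolvent; \<open>k\<close> and \<open>q\<close> are the weights of the
  bracket and of the extra cube.\<close>

definition cond_exp_rhs :: "complex \<Rightarrow> complex \<Rightarrow> complex \<Rightarrow> complex \<Rightarrow> complex \<Rightarrow> complex fps \<Rightarrow> complex fps" where
  "cond_exp_rhs k q a b s h =
     fps_const k * (fps_const (b\<^sup>2) * ((1 + h)\<^sup>2 * h - fps_X\<^sup>2 * fps_const s)
       + fps_const (2 * b * a * s) * (fps_X * ((1 + h) * h))
       + fps_const ((b + a\<^sup>2) * s\<^sup>2) * (fps_X\<^sup>2 * h) + fps_const (a * s ^ 3) * fps_X ^ 3)
     + fps_const q * ((1 + h)\<^sup>2 * h - fps_X\<^sup>2 * fps_const s)"

lemma trace_fps_scaleR:
  assumes "T \<in> A" "coeffs_in A f"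
  shows "trace_fps \<tau> (fps_const (c *\<^sub>R T) * f) = fps_const (of_real c) * trace_fps \<tau> (fps_const T * f)"
  by (rule fps_ext) (use assms in \<open>simp add: trace_fps_def trace_scaleR mem_mult coeffs_in_def\<close>)

lemma trace_fps_const_add:
  assumes "S \<in> A" "T \<in> A" "coeffs_in A f"
  shows "trace_fps \<tau> (fps_const (S + T) * f) = trace_fps \<tau> (fps_const S * f) + trace_fps \<tau> (fps_const T * f)"
  unfolding fps_const_add[symmetric] distrib_right
  by (intro trace_fps_add coeffs_in_simps assms)

lemma generated_vN_subset: "V \<in> A \<Longrightarrow> generated_vN V \<subseteq> A"
  unfolding generated_vN_def by (intro hull_minimal) (auto simp: vN)

text \<open>A polynomial in \<open>X s\<close> lies in the generated algebra anyway, so only the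
  orthogonality of \<open>Y\<close> to all powers of \<open>X s\<close> is at stake, and the
  resolvent encodes that in one series.\<close>

lemma cond_exp_polynomial_iff:
  fixes k q a b t s :: real
  assumes ts: "0 < t" "t < s"
  defines "E \<equiv> k *\<^sub>R (b\<^sup>2 *\<^sub>R (X s) ^ 3 + (2 * b * a * s) *\<^sub>R (X s)\<^sup>2
                    + ((b + a\<^sup>2) * s\<^sup>2) *\<^sub>R X s + (a * s ^ 3) *\<^sub>R 1) + q *\<^sub>R (X s) ^ 3"
  shows "is_cond_exp \<tau> (X t * X s * X t) (X s) E \<longleftrightarrow>
    H t + (2 + H s) * (H t)\<^sup>2 - fps_X\<^sup>2 * fps_const (of_real t) = cond_exp_rhs k q a b s (H s)"
proof -
  interpret free_resolvent A \<tau> "X t" "X s - X t"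
    "moment_inverse (moment_fps \<tau> (X t))" "moment_inverse (moment_fps \<tau> (X s - X t))"
    using free_resolvent_increments[OF ts] by simp_all
  define S where "S = X s"
  have S: "X t + (X s - X t) = S" by (simp add: S_def)
  have SA: "S \<in> A" "S ^ 3 \<in> A" "S\<^sup>2 \<in> A"
    using ts X_mem[of s] by (auto simp: S_def mem_power)
  have tA: "X t \<in> A" using ts X_mem by simp
  have u: "moment_inverse (moment_fps \<tau> (X t)) = 1 + H t" by (simp add: H_def)
  have v: "moment_inverse (moment_fps \<tau> (X s - X t)) = 1 + H (s - t)"
    using moment_inverse_increment[OF ts] .
  have \<zeta>: "\<zeta> = 1 + H s"
    unfolding \<zeta>_def u v using H_add[OF ts] by simp
  have R: "R = resolvent \<zeta> S" unfolding R_def S ..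
  have EA: "E \<in> A"
    unfolding E_def using SA by (intro mem_add mem_scaleR) (auto simp: S_def mem_1)
  define Y where "Y = X t * X s * X t - E"
  have YA: "Y \<in> A" unfolding Y_def
    using tA SA EA by (auto simp: S_def intro: mem_diff mem_mult)
  have "is_cond_exp \<tau> (X t * X s * X t) S E \<longleftrightarrow> (\<forall>n. \<tau> (Y * S ^ n) = 0)"
  proof
    have *: "\<tau> (X t * X s * X t * W) = \<tau> (E * W) \<longleftrightarrow> \<tau> (Y * W) = 0" if "W \<in> A" for W
      unfolding Y_def left_diff_distrib using that tA SA EA
      by (subst trace_diff) (auto simp: S_def intro: mem_mult)
    have gen: "poly_algebra S \<subseteq> generated_vN S" "generated_vN S \<subseteq> A"
      using poly_algebra_subset_generated_vN generated_vN_subset[OF SA(1)] by auto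
    show "\<forall>n. \<tau> (Y * S ^ n) = 0" if "is_cond_exp \<tau> (X t * X s * X t) S E"
      using that gen * poly_algebra_power[of S] unfolding is_cond_exp_def by blast
    assume zero: "\<forall>n. \<tau> (Y * S ^ n) = 0"
    have "E \<in> poly_algebra S"
      unfolding E_def S_def[symmetric] scaleR_oper_def
      by (intro poly_algebra_add poly_algebra_scaleC poly_algebra_power poly_algebra_self poly_algebra_1)
    moreover have "\<tau> (Y * W) = 0" if "W \<in> generated_vN S" for W
      by (rule trace_mult_generated_vN_eq_0[OF vN state SA(1) _ YA _ that])
        (use zero X_selfadjoint[of s] ts in \<open>auto simp: S_def\<close>)
    ultimately show "is_cond_exp \<tau> (X t * X s * X t) S E"
      using gen * unfolding is_cond_exp_def by blast
  qed
  also have "\<dots> \<longleftrightarrow> tr (fps_const Y * R) = 0"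
    unfolding R using trace_fps_resolvent_eq_0_iff[OF YA SA(1) nth_0(3)] by simp
  \<comment> \<open>Complex power series form an integral domain; the factor supplies the powers of
    w in the trace formulas.\<close>
  also have "\<dots> \<longleftrightarrow> fps_X ^ 3 * tr (fps_const Y * R) = 0"
    by simp
  also have "fps_X ^ 3 * tr (fps_const Y * R)
      = fps_X ^ 3 * tr (fps_const (X t * S * X t) * R) - fps_X ^ 3 * tr (fps_const E * R)"
  proof -
    have "tr (fps_const Y * R) = tr (fps_const (X t * S * X t) * R) - tr (fps_const E * R)"
      unfolding Y_def fps_const_sub[symmetric] left_diff_distrib S_def
      using tA SA EA by (intro trace_fps_diff coeffs_in_A_rules mem_mult) (auto simp: S_def)
    then show ?thesis by (simp add: right_diff_distrib)
  qed
  also have "fps_X ^ 3 * tr (fps_const (X t * S * X t) * R)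
      = H t + (2 + H s) * (H t)\<^sup>2 - fps_X\<^sup>2 * fps_const (of_real t)"
  proof -
    have "\<tau> (X s - X t) = 0"
      using ts mean X_mem by (simp add: trace_diff)
    then have "fps_X ^ 3 * tr (fps_const (X t * S * X t) * R)
        = (1 + H t)\<^sup>2 * (1 + H s - 1) - 2 * (1 + H t) * (1 + H s - (1 + H t))
          - fps_X ^ 2 * fps_const (of_real t) + (1 + H (s - t) - 1)"
      using trace_U_S_U_R mean[OF ts(1)] variance[OF ts(1)]
      unfolding S \<zeta> u v by (simp add: power2_eq_square)
    also have "H (s - t) = H s - H t"
      using H_add[OF ts] by simp
    finally show ?thesis
      by (simp add: power2_eq_square algebra_simps)
  qed
  also have "fps_X ^ 3 * tr (fps_const E * R) = cond_exp_rhs k q a b s (H s)"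
  proof -
    have s: "s > 0" using ts by simp
    have m1: "fps_X * tr (fps_const S * R) = H s"
      using trace_S_R unfolding S \<zeta> by simp
    have m2: "fps_X\<^sup>2 * tr (fps_const (S\<^sup>2) * R) = (1 + H s) * H s"
      using trace_SS_R mean[OF s] unfolding S \<zeta> by (simp add: power2_eq_square S_def)
    have m3: "fps_X ^ 3 * tr (fps_const (S ^ 3) * R) = (1 + H s)\<^sup>2 * H s - fps_X\<^sup>2 * fps_const (of_real s)"
      using trace_SSS_R mean[OF s] variance[OF s] unfolding S \<zeta>
      by (simp add: power3_eq_cube S_def mult.assoc power2_eq_square)
    have E_S: "E = k *\<^sub>R (b\<^sup>2 *\<^sub>R S ^ 3 + (2 * b * a * s) *\<^sub>R S\<^sup>2
                    + ((b + a\<^sup>2) * s\<^sup>2) *\<^sub>R S + (a * s ^ 3) *\<^sub>R 1) + q *\<^sub>R S ^ 3"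
      by (simp only: E_def S_def)
    have m0: "tr (fps_const 1 * R) = 1"
      using trace_R by (simp add: fps_oper_mult_1_left)
    have "tr (fps_const E * R) = fps_const (of_real k) * (fps_const (of_real (b\<^sup>2)) * tr (fps_const (S ^ 3) * R)
        + fps_const (of_real (2 * b * a * s)) * tr (fps_const (S\<^sup>2) * R)
        + fps_const (of_real ((b + a\<^sup>2) * s\<^sup>2)) * tr (fps_const S * R)
        + fps_const (of_real (a * s ^ 3)) * tr (fps_const 1 * R)) + fps_const (of_real q) * tr (fps_const (S ^ 3) * R)"
      unfolding E_S
      by (simp only: trace_fps_const_add trace_fps_scaleR mem_add mem_scaleR SA mem_1 coeffs_in_A)
    then have "fps_X ^ 3 * tr (fps_const E * R)
      = fps_const (of_real k) * (fps_const (of_real (b\<^sup>2)) * (fps_X ^ 3 * tr (fps_const (S ^ 3) * R))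
        + fps_const (of_real (2 * b * a * s)) * (fps_X * (fps_X\<^sup>2 * tr (fps_const (S\<^sup>2) * R)))
        + fps_const (of_real ((b + a\<^sup>2) * s\<^sup>2)) * (fps_X\<^sup>2 * (fps_X * tr (fps_const S * R)))
        + fps_const (of_real (a * s ^ 3)) * fps_X ^ 3)
        + fps_const (of_real q) * (fps_X ^ 3 * tr (fps_const (S ^ 3) * R))"
      unfolding m0 by (simp only: power2_eq_square power3_eq_cube distrib_left mult_1_right mult_1_left ac_simps)
    then show ?thesis
      unfolding m1 m2 m3 cond_exp_rhs_def by simp
  qed
  finally show ?thesis
    unfolding S_def by simp
qed


text \<open>For s = 1 and \<open>h = w r\<close> the equation is, after division by w,
  \<open>b w r^2 - (1 - a w) r + w = 0\<close>; its solution regular at 0 is the R-transform of the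
  free Meixner law.\<close>

definition quadratic_fps :: "complex \<Rightarrow> complex \<Rightarrow> complex \<Rightarrow> complex fps \<Rightarrow> complex fps" where
  "quadratic_fps a b s h = fps_const b * h\<^sup>2 + fps_const (a * s) * fps_X * h
     + fps_const (s\<^sup>2) * fps_X\<^sup>2 - fps_const s * h"

lemma cond_exp_rhs_proportional:
  assumes k: "k * (b + s)\<^sup>2 = \<theta> * (1 - \<theta>)"
  shows "cond_exp_rhs k (\<theta>\<^sup>2) a b s h
      - (fps_const \<theta> * h + (2 + h) * (fps_const \<theta> * h)\<^sup>2 - fps_X\<^sup>2 * fps_const (\<theta> * s))
    = fps_const k * quadratic_fps a b s h
        * (fps_const b * h + fps_const a * fps_const s * fps_X + 2 * fps_const b + fps_const s)"
proof -
  have "fps_const k * (fps_const b + fps_const s)\<^sup>2 = fps_const \<theta> * (1 - fps_const \<theta>)"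
    using k by (simp add: power2_eq_square flip: fps_const_1_eq_1)
  from resolvent_identity[OF this, where a = "fps_const a" and X = fps_X and h = h] show ?thesis
    unfolding cond_exp_rhs_def quadratic_fps_def
    by (simp add: power2_eq_square power3_eq_cube numeral_fps_const mult.assoc)
qed

text \<open>Dividing \<open>H s\<close> by s yields a solution of
  \<open>e = w^2 + a w e + b e^2\<close>, an equation without s, whose solution with zero constant
  term is unique.\<close>

lemma H_proportional_of_quadratic:
  assumes quad: "\<And>s. s > 0 \<Longrightarrow> quadratic_fps a b (of_real s) (H s) = 0"
    and t: "t > 0" "s > 0"
  shows "H t = fps_const (of_real (t / s)) * H s"
proof -
  have *: "fps_const (1 / of_real s) * H s = fps_X\<^sup>2 + fps_const a * fps_X * (fps_const (1 / of_real s) * H s)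
      + fps_const b * (fps_const (1 / of_real s) * H s)\<^sup>2" if "s > 0" for s
  proof -
    define c where "c = fps_const (1 / complex_of_real s)"
    have c: "c * fps_const (of_real s) = 1" using that by (simp add: c_def)
    have "c * c * quadratic_fps a b (of_real s) (H s)
      = fps_const b * (c * H s)\<^sup>2 + fps_const a * (c * fps_const (of_real s)) * fps_X * (c * H s)
        + (c * fps_const (of_real s))\<^sup>2 * fps_X\<^sup>2 - (c * fps_const (of_real s)) * (c * H s)"
      unfolding quadratic_fps_def fps_const_mult[symmetric] fps_const_power[symmetric]
      by (simp add: algebra_simps power2_eq_square del: fps_const_mult)
    then have "fps_X\<^sup>2 + fps_const a * fps_X * (c * H s) + fps_const b * (c * H s)\<^sup>2 - c * H s = 0"
      unfolding c quad[OF that] by (simp add: add_ac)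
    then show ?thesis
      unfolding c_def[symmetric] right_minus_eq by (rule sym)
  qed
  have "fps_const (1 / of_real t) * H t = fps_const (1 / of_real s) * H s"
    by (rule quadratic_fps_unique[OF *[OF t(1)] *[OF t(2)]]) (simp_all add: H_nth_0)
  then have "fps_const (of_real t) * (fps_const (1 / of_real t) * H t)
      = fps_const (of_real t) * (fps_const (1 / of_real s) * H s)"
    by simp
  then show ?thesis
    using t by (simp add: mult.assoc[symmetric])
qed

text \<open>This accounts for the denominator of the weight: \<open>(b + s)^2\<close> is the factor
  demanded by \<open>resolvent_identity\<close>, and it is nonzero since \<open>b \<ge> 0\<close>
  and \<open>s > 0\<close>.\<close>

lemma coefficient_weight:
  fixes b s t :: real
  assumes "b \<ge> 0" "0 < t" "t < s"
  shows "complex_of_real ((s - t) * t / (s\<^sup>2 * (b + s)\<^sup>2)) * (of_real b + of_real s)\<^sup>2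
    = of_real (t / s) * (1 - of_real (t / s))"
proof -
  have "(s - t) * t / (s\<^sup>2 * (b + s)\<^sup>2) * (b + s)\<^sup>2 = t / s * (1 - t / s)"
    using assms by (simp add: divide_simps power2_eq_square)
  from arg_cong[OF this, of complex_of_real] show ?thesis
    by (simp only: of_real_mult of_real_divide of_real_diff of_real_power of_real_add of_real_1)
qed

definition cond_exp_eq :: "real \<Rightarrow> real \<Rightarrow> real \<Rightarrow> real \<Rightarrow> bool" where
  "cond_exp_eq a b t s \<longleftrightarrow>
     H t + (2 + H s) * (H t)\<^sup>2 - fps_X\<^sup>2 * fps_const (of_real t)
     = cond_exp_rhs (of_real ((s - t) * t / (s\<^sup>2 * (b + s)\<^sup>2))) (of_real (t\<^sup>2 / s\<^sup>2))
         (of_real a) (of_real b) (of_real s) (H s)"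

text \<open>Both factors beside the quadratic cancel: \<open>k\<close> is nonzero because 0 < t < s,
  and \<open>c\<close> is a nonzero series because its constant coefficient \<open>2 * b + s\<close>
  is positive.\<close>

lemma cond_exp_eq_proportional_iff:
  fixes a b s t :: real
  assumes b: "b \<ge> 0" and ts: "0 < t" "t < s"
    and lin: "H t = fps_const (of_real (t / s)) * H s"
  shows "cond_exp_eq a b t s \<longleftrightarrow> quadratic_fps (of_real a) (of_real b) (of_real s) (H s) = 0"
proof -
  define k where "k = complex_of_real ((s - t) * t / (s\<^sup>2 * (b + s)\<^sup>2))"
  define \<theta> where "\<theta> = complex_of_real (t / s)"
  define c where "c = fps_const (complex_of_real b) * H s
    + fps_const (of_real a) * fps_const (of_real s) * fps_X + 2 * fps_const (of_real b) + fps_const (of_real s)"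
  have k: "k * (of_real b + of_real s)\<^sup>2 = \<theta> * (1 - \<theta>)"
    unfolding k_def \<theta>_def by (rule coefficient_weight[OF b ts])
  have \<theta>: "complex_of_real (t\<^sup>2 / s\<^sup>2) = \<theta>\<^sup>2" "complex_of_real t = \<theta> * of_real s"
    using ts by (simp_all add: \<theta>_def power_divide)
  have "c $ 0 = complex_of_real (2 * b + s)"
    by (simp add: c_def H_nth_0 numeral_fps_const)
  moreover have "2 * b + s \<noteq> 0"
    using b ts by simp
  ultimately have "c \<noteq> 0"
    by (metis fps_zero_nth of_real_eq_0_iff)
  moreover have "fps_const k \<noteq> 0"
  proof -
    have "b + s > 0" using b ts by simp
    then have "(s - t) * t / (s\<^sup>2 * (b + s)\<^sup>2) \<noteq> 0" using ts by simp
    then have "k \<noteq> 0" unfolding k_def of_real_eq_0_iff .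
    then show ?thesis by simp
  qed
  moreover have "cond_exp_eq a b t s \<longleftrightarrow>
      cond_exp_rhs k (\<theta>\<^sup>2) (of_real a) (of_real b) (of_real s) (H s)
      - (fps_const \<theta> * H s + (2 + H s) * (fps_const \<theta> * H s)\<^sup>2 - fps_X\<^sup>2 * fps_const (\<theta> * of_real s)) = 0"
    unfolding cond_exp_eq_def lin \<theta> k_def[symmetric] \<theta>_def[symmetric] by auto
  ultimately show ?thesis
    unfolding cond_exp_rhs_proportional[OF k] c_def[symmetric] by simp
qed

text \<open>The deviation of \<open>H t\<close> from \<open>(t / s) H s\<close> is additive in \<open>t\<close>, whereas the equation makes its
  first possibly nonzero coefficient a quadratic polynomial in \<open>t / s\<close> without constant term. An
  additive function of this kind which vanishes at \<open>1 / 2\<close> is zero.\<close>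

lemma H_proportional_of_cond_exp_eq:
  fixes a b s :: real
  assumes b: "b \<ge> 0" and eq: "\<And>t. 0 < t \<Longrightarrow> t < s \<Longrightarrow> cond_exp_eq a b t s"
    and ts: "0 < t" "t < s"
  shows "H t = fps_const (of_real (t / s)) * H s"
proof -
  define y where "y t = H t - fps_const (of_real (t / s)) * H s" for t
  \<comment> \<open>The dependence on t is isolated: \<open>L\<close> is one series for all t, with
    weight \<open>\<theta> (1 - \<theta>)\<close> where \<open>\<theta> = t / s\<close>.\<close>
  obtain L where L: "\<And>t. 0 < t \<Longrightarrow> t < s \<Longrightarrow>
      cond_exp_rhs (of_real ((s - t) * t / (s\<^sup>2 * (b + s)\<^sup>2))) (of_real (t\<^sup>2 / s\<^sup>2))
         (of_real a) (of_real b) (of_real s) (H s)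
      = fps_const (of_real (t / s * (1 - t / s))) * L
        + fps_const (of_real ((t / s)\<^sup>2)) * ((1 + H s)\<^sup>2 * H s - fps_X\<^sup>2 * fps_const (of_real s))"
  proof
    fix t assume t: "0 < t" "t < s"
    have "of_real ((s - t) * t / (s\<^sup>2 * (b + s)\<^sup>2))
        = complex_of_real (t / s * (1 - t / s)) * of_real (1 / (b + s)\<^sup>2)"
    proof -
      have "(s - t) * t / (s\<^sup>2 * (b + s)\<^sup>2) = t / s * (1 - t / s) * (1 / (b + s)\<^sup>2)"
        using b t by (simp add: divide_simps power2_eq_square)
      then show ?thesis by (simp only: of_real_mult)
    qed
    then show "cond_exp_rhs (of_real ((s - t) * t / (s\<^sup>2 * (b + s)\<^sup>2))) (of_real (t\<^sup>2 / s\<^sup>2))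
         (of_real a) (of_real b) (of_real s) (H s)
      = fps_const (of_real (t / s * (1 - t / s)))
        * cond_exp_rhs (of_real (1 / (b + s)\<^sup>2)) 0 (of_real a) (of_real b) (of_real s) (H s)
        + fps_const (of_real ((t / s)\<^sup>2)) * ((1 + H s)\<^sup>2 * H s - fps_X\<^sup>2 * fps_const (of_real s))"
      unfolding cond_exp_rhs_def by (simp only: fps_const_mult[symmetric] power_divide mult.assoc
          fps_const_0_eq_0 mult_zero_left add_0_right)
  qed
  \<comment> \<open>\<open>B\<close> and \<open>C\<close> collect the coefficients of
    \<open>\<theta>\<close> and of its square after substituting
    \<open>H t = \<theta> H s + y t\<close>; the remaining terms contain \<open>y t\<close> as a
    factor.\<close>
  define B where "B = L + fps_X\<^sup>2 * fps_const (of_real s) - H s"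
  define C where "C = (1 + H s)\<^sup>2 * H s - fps_X\<^sup>2 * fps_const (of_real s) - L - (2 + H s) * (H s)\<^sup>2"
  have y_eq: "y t = fps_const (of_real (t / s)) * B + fps_const (of_real (t / s)) ^ 2 * C
      - (2 + H s) * (2 * fps_const (of_real (t / s)) * H s + y t) * y t"
    if t: "0 < t" "t < s" for t
  proof -
    define \<theta> where "\<theta> = fps_const (complex_of_real (t / s))"
    have Ht: "H t = \<theta> * H s + y t" by (simp add: y_def \<theta>_def)
    have \<theta>s: "fps_const (of_real t) = \<theta> * fps_const (of_real s)"
      using t by (simp add: \<theta>_def)
    have \<theta>2: "fps_const (of_real (t / s * (1 - t / s))) = \<theta> * (1 - \<theta>)"
      "fps_const (of_real ((t / s)\<^sup>2)) = \<theta>\<^sup>2"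
      by (simp_all add: \<theta>_def power2_eq_square flip: fps_const_1_eq_1)
    show ?thesis
      using eq[OF t] unfolding cond_exp_eq_def L[OF t] Ht \<theta>s \<theta>2 \<theta>_def[symmetric] B_def C_def
      by (simp add: algebra_simps power2_eq_square)
  qed
  have y_add: "y (t + t') = y t + y t'" if "0 < t" "0 < t'" "t + t' < s" for t t'
    using H_add[of t "t + t'"] that
    by (simp add: y_def add_divide_distrib algebra_simps flip: fps_const_add)
  have "y t $ n = 0" if "0 < t" "t < s" for n t
    using that
  proof (induction n arbitrary: t rule: less_induct)
    case (less n)
    have y_n: "y t $ n = of_real (t / s) * B $ n + of_real (t / s) ^ 2 * C $ n"
      if t: "0 < t" "t < s" for t
    proof -
      \<comment> \<open>As \<open>g\<close> has no constant term, the coefficient \<open>n\<close>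
        of \<open>g * y t\<close> involves only coefficients of \<open>y t\<close> already known to
        vanish.\<close>
      define g where "g = (2 + H s) * (2 * fps_const (of_real (t / s)) * H s + y t)"
      have g0: "g $ 0 = 0" by (simp add: g_def y_def H_nth_0)
      have "(g * y t) $ n = 0"
        unfolding fps_mult_nth
      proof (intro sum.neutral ballI)
        fix i assume "i \<in> {0..n}"
        then show "g $ i * y t $ (n - i) = 0"
          using g0 less.IH[OF _ t, of "n - i"] by (cases "i = 0") auto
      qed
      moreover have "y t = fps_const (of_real (t / s)) * B + fps_const (of_real (t / s)) ^ 2 * C - g * y t"
        using y_eq[OF t] unfolding g_def .
      from arg_cong[OF this, of "\<lambda>f. f $ n"]
      have "y t $ n = of_real (t / s) * B $ n + of_real (t / s) ^ 2 * C $ n - (g * y t) $ n"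
        by (simp only: fps_sub_nth fps_add_nth fps_const_power fps_mult_left_const_nth)
      ultimately show ?thesis by simp
    qed
    have s: "s > 0" using ts by simp
    \<comment> \<open>\<open>y_add\<close> covers only sums below s, so the midpoint is obtained
      from \<open>H_add\<close> directly.\<close>
    have half: "y (s / 2) = 0"
    proof -
      have "H s = H (s / 2) + H (s - s / 2)"
        using s by (intro H_add) auto
      moreover have "s - s / 2 = s / 2" by simp
      ultimately have "H s = 2 * H (s / 2)" by simp
      then have "2 * y (s / 2) = 0"
        using s by (simp add: y_def algebra_simps numeral_fps_const mult.assoc[symmetric])
      then show ?thesis by simp
    qed
    \<comment> \<open>Additivity passes the zero on to s / 4. The conditions at s / 2 and s / 4 are
      independent linear equations for \<open>B $ n\<close> and \<open>C $ n\<close>.\<close>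
    have "y (s / 2) = y (s / 4) + y (s / 4)"
      using y_add[of "s / 4" "s / 4"] s by simp
    then have 1: "y (s / 2) $ n = 2 * y (s / 4) $ n"
      by simp
    have 2: "y (s / 2) $ n = B $ n / 2 + C $ n / 4"
      using y_n[of "s / 2"] s by (simp add: power2_eq_square)
    have 3: "y (s / 4) $ n = B $ n / 4 + C $ n / 16"
      using y_n[of "s / 4"] s by (simp add: power2_eq_square)
    have 4: "B $ n / 2 + C $ n / 4 = 0" "B $ n / 2 + C $ n / 8 = 0"
      using 1 2 3 half by simp_all
    have "C $ n = 8 * ((B $ n / 2 + C $ n / 4) - (B $ n / 2 + C $ n / 8))"
      by (simp add: field_simps)
    then have "C $ n = 0" unfolding 4 by simp
    moreover from this 4 have "B $ n = 0" by simp
    ultimately show ?case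
      using y_n[OF less.prems] by simp
  qed
  then have "y t = 0"
    using ts by (intro fps_ext) simp
  then show ?thesis by (simp add: y_def)
qed

lemma cond_exp_eq_iff_quadratic:
  assumes b: "b \<ge> 0"
  shows "(\<forall>t s. 0 < t \<and> t < s \<longrightarrow> cond_exp_eq a b t s)
    \<longleftrightarrow> (\<forall>s>0. quadratic_fps (of_real a) (of_real b) (of_real s) (H s) = 0)"
proof (intro iffI allI impI)
  fix s :: real
  assume *: "\<forall>t s. 0 < t \<and> t < s \<longrightarrow> cond_exp_eq a b t s" and s: "0 < s"
  \<comment> \<open>One intermediate time is enough here: once proportionality holds, the equation
    no longer depends on t.\<close>
  have "H (s / 2) = fps_const (of_real (s / 2 / s)) * H s"
    by (rule H_proportional_of_cond_exp_eq[OF b, of s a]) (use * s in auto)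
  then show "quadratic_fps (of_real a) (of_real b) (of_real s) (H s) = 0"
    using cond_exp_eq_proportional_iff[OF b, of "s / 2" s a] * s by auto
next
  fix t s :: real
  assume *: "\<forall>s>0. quadratic_fps (of_real a) (of_real b) (of_real s) (H s) = 0" and ts: "0 < t \<and> t < s"
  have "H t = fps_const (of_real (t / s)) * H s"
    by (rule H_proportional_of_quadratic[of "of_real a" "of_real b"]) (use * ts in auto)
  then show "cond_exp_eq a b t s"
    using cond_exp_eq_proportional_iff[OF b, of t s a] * ts by auto
qed

text \<open>A law must be an actual compactly supported measure; it is the image of the law of the
  increment under y -> c y.\<close>

lemma has_law_scaled_increment:
  assumes "t \<ge> 0" "s > 0"
  shows "\<exists>\<mu>. has_law \<tau> (c *\<^sub>R (X (t + s) - X t)) \<mu>"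
proof -
  define D where "D = X (t + s) - X t"
  have DA: "D \<in> A" using assms X_mem by (auto simp: D_def intro: mem_diff)
  obtain \<nu> where \<nu>: "has_law \<tau> D \<nu>"
    using increment_law[of s] assms by (auto simp: D_def)
  then have csp: "compactly_supported_prob \<nu>" by (simp add: has_law_def)
  then interpret prob_space \<nu> by (simp add: compactly_supported_prob_def)
  obtain K where K: "compact K" "AE y in \<nu>. y \<in> K" and sets: "sets \<nu> = sets borel"
    using csp by (auto simp: compactly_supported_prob_def)
  have meas [measurable]: "(\<lambda>y. c * y) \<in> measurable \<nu> borel"
    by (subst measurable_cong_sets[OF sets refl]) simp
  define \<mu> where "\<mu> = distr \<nu> borel (\<lambda>y. c * y)"
  have "compactly_supported_prob \<mu>"
    unfolding compactly_supported_prob_def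
  proof (intro conjI exI)
    show "prob_space \<mu>" unfolding \<mu>_def by (rule prob_space_distr[OF meas])
    show K': "compact ((\<lambda>y. c * y) ` K)"
      by (intro compact_continuous_image K continuous_intros)
    have "{y \<in> space borel. y \<in> (\<lambda>y. c * y) ` K} \<in> sets borel"
      using borel_closed[OF compact_imp_closed[OF K']] by simp
    then show "AE y in \<mu>. y \<in> (\<lambda>y. c * y) ` K"
      unfolding \<mu>_def using K(2) by (subst AE_distr_iff[OF meas]) (auto elim!: eventually_mono)
  qed (simp add: \<mu>_def)
  moreover have "\<tau> ((c *\<^sub>R D) ^ n) = complex_of_real (LINT y|\<mu>. y ^ n)" for n
  proof -
    have "(LINT y|\<mu>. y ^ n) = c ^ n * (LINT y|\<nu>. y ^ n)"
      unfolding \<mu>_def by (subst integral_distr[OF meas]) (simp_all add: power_mult_distrib)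
    moreover have "(c *\<^sub>R D) ^ n = c ^ n *\<^sub>R D ^ n"
      by (induction n) simp_all
    ultimately show ?thesis
      using \<nu> DA by (simp add: has_law_def trace_scaleR mem_power)
  qed
  ultimately show ?thesis
    unfolding has_law_def D_def by blast
qed

text \<open>Scaling the operator by \<open>c = 1 / sqrt s\<close> replaces the series variable by c
  w. In the moment form of the quadratic equation this produces s times the Meixner equation with
  parameters \<open>a / sqrt s\<close> and \<open>b / s\<close>.\<close>

lemma is_free_meixner_scaled_increment_iff:
  assumes "t \<ge> 0" "s > 0" and has_law: "has_law \<tau> ((1 / sqrt s) *\<^sub>R (X (t + s) - X t)) \<mu>"
  shows "is_free_meixner (a / sqrt s) (b / s) \<mu>
    \<longleftrightarrow> quadratic_fps (of_real a) (of_real b) (of_real s) (H s) = 0"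
proof -
  interpret compact_law \<mu>
    using has_law by unfold_locales (simp add: has_law_def)
  define D where "D = X (t + s) - X t"
  have DA: "D \<in> A" using assms X_mem by (auto simp: D_def intro: mem_diff)
  define c where "c = complex_of_real (1 / sqrt s)"
  define M where "M = moment_fps \<tau> (X s)"
  define q where "q = (fps_const (of_real b) + fps_const (of_real a * of_real s) * fps_X
      + fps_const ((of_real s)\<^sup>2) * fps_X\<^sup>2) * M\<^sup>2
    - (fps_const (of_real s + 2 * of_real b) + fps_const (of_real a * of_real s) * fps_X) * M
    + fps_const (complex_of_real s + of_real b)"
  have M: "M = moment_fps \<tau> D"
    unfolding M_def D_def using increment_moments[of t s] assms by simp
  have "moments = M oo (fps_const c * fps_X)"
  proof (rule fps_ext)
    fix n
    have "((1 / sqrt s) *\<^sub>R D) ^ n = (1 / sqrt s) ^ n *\<^sub>R D ^ n"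
      by (induction n) simp_all
    then have "\<tau> (((1 / sqrt s) *\<^sub>R D) ^ n) = c ^ n * \<tau> (D ^ n)"
      using DA by (simp add: trace_scaleR mem_power c_def power_divide)
    moreover have "moments $ n = \<tau> (((1 / sqrt s) *\<^sub>R D) ^ n)"
    proof -
      have "\<tau> (((1 / sqrt s) *\<^sub>R D) ^ n) = complex_of_real (LINT y|\<mu>. y ^ n)"
        using has_law unfolding has_law_def D_def by blast
      then show ?thesis by (simp add: moments_def)
    qed
    ultimately show "moments $ n = (M oo (fps_const c * fps_X)) $ n"
      by (simp add: fps_compose_linear M moment_fps_def)
  qed
  then have N: "M oo (fps_const c * fps_X) = moments" by simp
  have lin0: "(fps_const c * fps_X) $ 0 = 0" by simp
  have sc: "complex_of_real s * c\<^sup>2 = 1" "complex_of_real s * c = of_real (sqrt s)"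
  proof -
    have "s * (1 / sqrt s)\<^sup>2 = 1" using assms(2) by (simp add: power_divide)
    from arg_cong[OF this, of complex_of_real] show "complex_of_real s * c\<^sup>2 = 1"
      by (simp add: c_def)
    have "s * (1 / sqrt s) = sqrt s" using assms(2) by (simp add: real_div_sqrt)
    from arg_cong[OF this, of complex_of_real] show "complex_of_real s * c = of_real (sqrt s)"
      by (simp add: c_def)
  qed
  have "q oo (fps_const c * fps_X)
    = (fps_const (of_real b) + fps_const (of_real a * of_real s) * (fps_const c * fps_X)
      + fps_const ((of_real s)\<^sup>2) * (fps_const c * fps_X)\<^sup>2) * moments\<^sup>2
    - (fps_const (of_real s + 2 * of_real b) + fps_const (of_real a * of_real s) * (fps_const c * fps_X)) * moments
    + fps_const (complex_of_real s + of_real b)"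
    unfolding q_def by (simp only: fps_compose_add_distrib fps_compose_sub_distrib
        fps_compose_mult_distrib[OF lin0] fps_compose_power[OF lin0, symmetric] N fps_const_compose
        fps_X_fps_compose_startby0[OF lin0])
  also have "\<dots> = (fps_const (of_real b) + fps_const (of_real a * (of_real s * c)) * fps_X
      + fps_const (of_real s * (of_real s * c\<^sup>2)) * fps_X\<^sup>2) * moments\<^sup>2
    - (fps_const (of_real s + 2 * of_real b) + fps_const (of_real a * (of_real s * c)) * fps_X) * moments
    + fps_const (complex_of_real s + of_real b)"
    by (simp add: power_mult_distrib power2_eq_square mult.assoc flip: fps_const_mult)
  also have "\<dots> = fps_const (of_real s) * meixner_fps (of_real (a / sqrt s)) (of_real (b / s))"
  proof -
    have *: "(fps_const (\<sigma> * \<beta>) + fps_const (\<sigma> * \<alpha>) * fps_X + fps_const (\<sigma> * 1) * fps_X\<^sup>2) * moments\<^sup>2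
        - (fps_const (\<sigma> + 2 * (\<sigma> * \<beta>)) + fps_const (\<sigma> * \<alpha>) * fps_X) * moments + fps_const (\<sigma> + \<sigma> * \<beta>)
      = fps_const \<sigma> * meixner_fps \<alpha> \<beta>" for \<sigma> \<alpha> \<beta>
      unfolding meixner_fps_def mult_2 fps_const_add[symmetric] fps_const_mult[symmetric]
      by (simp add: algebra_simps del: fps_const_add fps_const_mult)
    have "a * sqrt s = s * (a / sqrt s)"
      using assms(2) by (simp add: field_simps)
    then have "complex_of_real a * of_real (sqrt s) = of_real s * of_real (a / sqrt s)"
      by (metis of_real_mult)
    moreover have "complex_of_real b = of_real s * of_real (b / s)"
      using assms(2) by simp
    ultimately show ?thesis
      unfolding sc by (simp only: *)
  qed
  finally have q: "q oo (fps_const c * fps_X)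
      = fps_const (of_real s) * meixner_fps (of_real (a / sqrt s)) (of_real (b / s))" .
  have "c \<noteq> 0" using assms(2) by (simp add: c_def)
  then have "fps_const c * fps_X \<noteq> 0" by simp
  then have "q oo (fps_const c * fps_X) = 0 \<longleftrightarrow> q = 0"
    using fps_compose_eq_0_iff[OF lin0, of q] by blast
  moreover have "q = 0 \<longleftrightarrow> quadratic_fps (of_real a) (of_real b) (of_real s) (H s) = 0"
    unfolding q_def quadratic_fps_def H_def M_def
    by (rule quadratic_moment_inverse_iff[symmetric]) (rule moment_fps_nth_0)
  ultimately show ?thesis
    using q assms(2) by (simp add: is_free_meixner_iff)
qed

end

theorem proposition3p4:
  fixes A :: "'h::complex_hilbert oper set"
    and \<tau> :: "'h oper \<Rightarrow> complex"
    and X :: "real \<Rightarrow> 'h oper"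
    and a b :: real
  assumes "von_neumann_algebra A"
    and "normal_faithful_tracial_state A \<tau>"
    and "free_levy_process A \<tau> X"
    and "\<And>t. t > 0 \<Longrightarrow> \<tau> (X t) = 0"
    and "\<And>t. t > 0 \<Longrightarrow> \<tau> ((X t)\<^sup>2) = complex_of_real t"
    and "b \<ge> 0"
  shows "(\<forall>t>0. \<forall>s>0. \<exists>\<mu>. is_free_meixner (a / sqrt s) (b / s) \<mu> \<and>
             has_law \<tau> ((1 / sqrt s) *\<^sub>R (X (t + s) - X t)) \<mu>)
     \<longleftrightarrow>
         (\<forall>t s. 0 < t \<and> t < s \<longrightarrow>
             is_cond_exp \<tau> (X t * X s * X t) (X s)
               (((s - t) * t / (s\<^sup>2 * (b + s)\<^sup>2)) *\<^sub>R
                  (b\<^sup>2 *\<^sub>R (X s) ^ 3 + (2 * b * a * s) *\<^sub>R (X s)\<^sup>2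
                    + ((b + a\<^sup>2) * s\<^sup>2) *\<^sub>R X s + (a * s ^ 3) *\<^sub>R 1)
                + (t\<^sup>2 / s\<^sup>2) *\<^sub>R (X s) ^ 3))"
    (is "?meixner \<longleftrightarrow> ?cond")
proof -
  interpret free_levy A \<tau> X
    by unfold_locales (use assms in auto)
  have "?meixner \<longleftrightarrow> (\<forall>s>0. quadratic_fps (of_real a) (of_real b) (of_real s) (H s) = 0)"
  proof (intro iffI allI impI)
    fix s :: real assume *: ?meixner and s: "s > 0"
    \<comment> \<open>The starting time 1 is arbitrary, as the law of an increment depends only on
      its length.\<close>
    obtain \<mu> where "is_free_meixner (a / sqrt s) (b / s) \<mu>"
      "has_law \<tau> ((1 / sqrt s) *\<^sub>R (X (1 + s) - X 1)) \<mu>"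
      using * s zero_less_one by blast
    then show "quadratic_fps (of_real a) (of_real b) (of_real s) (H s) = 0"
      using is_free_meixner_scaled_increment_iff[of 1 s \<mu> a b] s by simp
  next
    fix t s :: real
    assume *: "\<forall>s>0. quadratic_fps (of_real a) (of_real b) (of_real s) (H s) = 0"
      and t: "t > 0" and s: "s > 0"
    obtain \<mu> where "has_law \<tau> ((1 / sqrt s) *\<^sub>R (X (t + s) - X t)) \<mu>"
      using has_law_scaled_increment[of t s] t s by auto
    then show "\<exists>\<mu>. is_free_meixner (a / sqrt s) (b / s) \<mu> \<and>
             has_law \<tau> ((1 / sqrt s) *\<^sub>R (X (t + s) - X t)) \<mu>"
      using is_free_meixner_scaled_increment_iff[of t s \<mu> a b] t s * by auto
  qed
  also have "\<dots> \<longleftrightarrow> (\<forall>t s. 0 < t \<and> t < s \<longrightarrow> cond_exp_eq a b t s)"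
    using cond_exp_eq_iff_quadratic[OF \<open>b \<ge> 0\<close>] by simp
  also have "\<dots> \<longleftrightarrow> ?cond"
    unfolding cond_exp_eq_def using cond_exp_polynomial_iff by simp
  finally show ?thesis .
qed

end
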